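(* Let $\lambda_0\in\mathbb{R}$ and $t_0\in(0,1)$, and assume: (i) $\lambda_0\notin\operatorname{Spec}_{\mathrm{ess}}(\mathcal{N}_{t_0}+V_{t_0})$; (ii) $\dim\ker(\mathcal{N}_{t_0}+V_{t_0}-\lambda_0)=1$ (so that $(\lambda_0,t_0)$ is a simple conjugate point); and that there is an interval $\mathcal{I}\subset[0,1]$ containing $t_0$ in its interior such that (iii) the mappings $t\mapsto V_t$, $t\mapsto P_t$, $t\mapsto Q_t$, $t\mapsto\mathrm{T}_t$ are $C^2$ on $\mathcal{I}$; (iv) $\ker\big((N^*+V_t^*-\lambda)\tau\big)\cap\operatorname{dom}(\tau N)=\{0\}$ for all $t\in\mathcal{I}$ and all real $\lambda$ near $\lambda_0$. Let $\mathbf{u}_{t_0}\in\ker(\mathcal{N}_{t_0}+V_{t_0}-\lambda_0)$ and $\mathbf{q}:=(\mathrm{T}_{t_0}\mathbf{u}_{t_0},\mathrm{T}_{t_0}\mathbf{u}_{t_0})^\top\in\Upsilon_{\lambda_0,t_0}\cap\mathfrak{D}$. Then the $t$-crossing form of the Lagrangian path $t\mapsto\Upsilon_{\lambda_0,t}$ with respect to the reference plane $\mathfrak{D}$ is given by $$\mathfrak{m}_{t_0}(\mathbf{q},\mathbf{q})=\langle\tau\dot V_{t_0}\mathbf{u}_{t_0},\mathbf{u}_{t_0}\rangle_{\mathcal{H}^2}+\Omega\big((\dot P_{t_0}\oplus\dot Q_{t_0})\mathrm{T}_{t_0}\mathbf{u}_{t_0},\mathrm{T}_{t_0}\mathbf{u}_{t_0}\big)+\Omega\big(\mathrm{T}_{t_0}\mathbf{u}_{t_0},\dot{\mathrm{T}}_{t_0}\mathbf{u}_{t_0}\big),$$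 while the $\lambda$-crossing form of the Lagrangian path $\lambda\mapsto\Upsilon_{\lambda,t_0}$ with respect to $\mathfrak{D}$ is given by $$\mathfrak{m}_{\lambda_0}(\mathbf{q},\mathbf{q})=-\langle\tau\mathbf{u}_{t_0},\mathbf{u}_{t_0}\rangle_{\mathcal{H}^2}.$$
   Context: $\mathcal{H},\mathfrak{H}$ are separable complex Hilbert spaces. $A$ is a closed, densely defined, symmetric linear operator in $\mathcal{H}$ with $\dim\ker(A^*+i)=\dim\ker(A^*-i)<\infty$. $\mathcal{H}_+:=\operatorname{dom}(A^* )$ carries the graph scalar product of $A^*$. Put $\mathcal{H}^2=\mathcal{H}\times\mathcal{H}$, $\mathcal{H}_+^2=\mathcal{H}_+\times\mathcal{H}_+$, $\mathfrak{H}^2=\mathfrak{H}\times\mathfrak{H}$, $\mathfrak{H}^4=\mathfrak{H}^2\times\mathfrak{H}^2$, and $$N=\begin{pmatrix}0&-A\\ A&0\end{pmatrix},\ \operatorname{dom}N=\operatorname{dom}A\times\operatorname{dom}A,\qquad N^*=\begin{pmatrix}0&A^*\\ -A^*&0\end{pmatrix},\ \operatorname{dom}N^*=\mathcal{H}_+^2,\qquad \tau=\begin{pmatrix}0&I_{\mathcal{H}}\\ I_{\mathcal{H}}&0\end{pmatrix},$$ $$J=\begin{pmatrix}0&I_{\mathfrak{H}}\\ -I_{\mathfrak{H}}&0\end{pmatrix}\ \text{on }\mathfrak{H}^2,\qquad \mathcal{J}=J\oplus(-J)\ \text{on }\mathfrak{H}^4,\qquad \Omega(f,g)=\langle\mathcal{J}f,g\rangle_{\mathfrak{H}^4},\qquad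 \tilde\Omega=\Omega\oplus(-\Omega)\ \text{on }\mathfrak{H}^4\oplus\mathfrak{H}^4.$$ A subspace of $\mathfrak{H}^2$ is Lagrangian if it equals its annihilator with respect to $\omega(f,g)=\langle Jf,g\rangle_{\mathfrak{H}^2}$. $X\oplus Y$ denotes the block diagonal operator on $\mathfrak{H}^4=\mathfrak{H}^2\times\mathfrak{H}^2$. Standing assumptions on one-parameter families, $t\in[0,1]$: (a) $\operatorname{tr}_t=(\Gamma_{0,t},\Gamma_{1,t})^\top\in\mathcal{B}(\mathcal{H}_+,\mathfrak{H}^2)$ is surjective and satisfies $\langle A^*u,v\rangle_{\mathcal{H}}-\langle u,A^*v\rangle_{\mathcal{H}}=\langle\Gamma_{1,t}u,\Gamma_{0,t}v\rangle_{\mathfrak{H}}-\langle\Gamma_{0,t}u,\Gamma_{1,t}v\rangle_{\mathfrak{H}}$ for all $u,v\in\mathcal{H}_+$; $\mathrm{T}_t:=\operatorname{tr}_t\oplus\operatorname{tr}_t\in\mathcal{B}(\mathcal{H}_+^2,\mathfrak{H}^4)$. (b) $P_t,Q_t\in\mathcal{B}(\mathfrak{H}^2)$ are orthogonal projections with Lagrangian ranges. (c) $\mathcal{A}_t,\mathcal{B}_t$ are self-adjoint extensions of $A$ with $\operatorname{tr}_t(\operatorname{dom}\mathcal{A}_t)=\operatorname{ran}P_t$, $\operatorname{tr}_t(\operatorname{dom}\mathcal{B}_t)=\operatorname{ran}Q_t$, and $\mathcal{N}_t=\begin{pmatrix}0&-\mathcal{B}_t\\ \mathcal{A}_t&0\end{pmatrix}$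 with $\operatorname{dom}\mathcal{N}_t=\operatorname{dom}\mathcal{A}_t\times\operatorname{dom}\mathcal{B}_t$. (d) $F_t,G_t\in\mathcal{B}(\mathcal{H})$ are self-adjoint and $V_t=\begin{pmatrix}0&-G_t\\ F_t&0\end{pmatrix}\in\mathcal{B}(\mathcal{H}^2)$. Regularity of $V_t,\mathrm{T}_t,P_t,Q_t$ is in operator norm (with $\mathrm{T}_t\in\mathcal{B}(\mathcal{H}_+^2,\mathfrak{H}^4)$); the dot denotes $d/dt$. $\operatorname{Spec}_{\mathrm{ess}}(\mathcal{N}_t+V_t)$ is the set of $\lambda$ for which $\mathcal{N}_t+V_t-\lambda$ is not Fredholm. Crossing forms. For $\lambda\in\mathbb{R}$, $t\in[0,1]$ let $$\mathbb{K}_{\lambda,t}=\mathrm{T}_t\big(\ker((N^*+V_t^*-\lambda)\tau)\big),\quad \mathcal{F}_t=\operatorname{ran}P_t\times\operatorname{ran}Q_t,\quad \Upsilon_{\lambda,t}=\mathbb{K}_{\lambda,t}\oplus\mathcal{F}_t\subset\mathfrak{H}^4\oplus\mathfrak{H}^4,\quad \mathfrak{D}=\{(q,q)^\top:q\in\mathfrak{H}^4\}.$$ $(\lambda_0,t_0)$ is a conjugate point if $\Upsilon_{\lambda_0,t_0}\cap\mathfrak{D}\neq\{0\}$, equivalently $\ker(\mathcal{N}_{t_0}+V_{t_0}-\lambda_0)\ne\{0\}$. For $t$ near $t_0$, $\Upsilon_{\lambda_0,t}$ is the graph $\{\mathbf{q}+\mathscr{M}_{\lambda_0,t}\mathbf{q}:\mathbf{q}\in\Upsilon_{\lambda_0,t_0}\}$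 of an operator $\mathscr{M}_{\lambda_0,t}:\Upsilon_{\lambda_0,t_0}\to(\Upsilon_{\lambda_0,t_0})^\perp$, $C^1$ in $t$, vanishing at $t=t_0$; similarly, for $\lambda$ near $\lambda_0$, $\Upsilon_{\lambda,t_0}$ is the graph over $\Upsilon_{\lambda_0,t_0}$ of an operator $\mathscr{M}_{\lambda,t_0}:\Upsilon_{\lambda_0,t_0}\to(\Upsilon_{\lambda_0,t_0})^\perp$ vanishing at $\lambda=\lambda_0$. For $\mathbf{q},\mathbf{p}\in\Upsilon_{\lambda_0,t_0}\cap\mathfrak{D}$ the crossing forms are $$\mathfrak{m}_{t_0}(\mathbf{q},\mathbf{p})=\frac{d}{dt}\Big|_{t=t_0}\tilde\Omega(\mathbf{q},\mathscr{M}_{\lambda_0,t}\mathbf{p}),\qquad \mathfrak{m}_{\lambda_0}(\mathbf{q},\mathbf{p})=\frac{d}{d\lambda}\Big|_{\lambda=\lambda_0}\tilde\Omega(\mathbf{q},\mathscr{M}_{\lambda,t_0}\mathbf{p}).$$ *)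

theory Defs
  imports "HOL-Analysis.Analysis"
begin

section \<open>Complex inner product spaces\<close>

text \<open>The complex inner product is linear in its first argument; its real part is the
  library's real inner product, so norm and topology are those of \<^class>\<open>real_inner\<close>.
  A separable complex Hilbert space is a type of sort \<open>{complex_inner, polish_space}\<close>:
  \<^class>\<open>polish_space\<close> is \<^class>\<open>complete_space\<close> plus \<^class>\<open>second_countable_topology\<close>,
  and for metric spaces the latter is separability.\<close>

class complex_inner = real_inner +
  fixes scaleC :: "complex \<Rightarrow> 'a \<Rightarrow> 'a" (infixr \<open>*\<^sub>C\<close> 75)
    and cinner :: "'a \<Rightarrow> 'a \<Rightarrow> complex"
  assumes scaleC_add_right: "c *\<^sub>C (x + y) = c *\<^sub>C x + c *\<^sub>C y"
    and scaleC_add_left: "(c + d) *\<^sub>C x = c *\<^sub>C x + d *\<^sub>C x"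
    and scaleC_scaleC: "c *\<^sub>C d *\<^sub>C x = (c * d) *\<^sub>C x"
    and scaleR_scaleC: "r *\<^sub>R x = complex_of_real r *\<^sub>C x"
    and cinner_commute: "cinner x y = cnj (cinner y x)"
    and cinner_add_left: "cinner (x + y) z = cinner x z + cinner y z"
    and cinner_scaleC_left: "cinner (c *\<^sub>C x) y = c * cinner x y"
    and inner_eq_Re_cinner: "inner x y = Re (cinner x y)"

instantiation prod :: (complex_inner, complex_inner) complex_inner
begin

definition scaleC_prod_def: "c *\<^sub>C p = (c *\<^sub>C fst p, c *\<^sub>C snd p)"

definition cinner_prod_def: "cinner p q = cinner (fst p) (fst q) + cinner (snd p) (snd q)"

instance
proof
  fix x y z :: "'a \<times> 'b" and c d :: complex and r :: real
  show "c *\<^sub>C (x + y) = c *\<^sub>C x + c *\<^sub>C y"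
    by (simp add: scaleC_prod_def scaleC_add_right)
  show "(c + d) *\<^sub>C x = c *\<^sub>C x + d *\<^sub>C x"
    by (simp add: scaleC_prod_def scaleC_add_left)
  show "c *\<^sub>C d *\<^sub>C x = (c * d) *\<^sub>C x"
    by (simp add: scaleC_prod_def scaleC_scaleC)
  show "r *\<^sub>R x = complex_of_real r *\<^sub>C x"
    by (simp add: scaleC_prod_def scaleR_prod_def scaleR_scaleC)
  show "cinner x y = cnj (cinner y x)"
    by (simp add: cinner_prod_def flip: cinner_commute)
  show "cinner (x + y) z = cinner x z + cinner y z"
    by (simp add: cinner_prod_def cinner_add_left)
  show "cinner (c *\<^sub>C x) y = c * cinner x y"
    by (simp add: cinner_prod_def scaleC_prod_def cinner_scaleC_left distrib_left)
  show "inner x y = Re (cinner x y)"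
    by (simp add: cinner_prod_def inner_prod_def inner_eq_Re_cinner)
qed

end

global_interpretation complex_vector: vector_space "scaleC :: complex \<Rightarrow> 'a \<Rightarrow> 'a::complex_inner"
proof
  fix c d :: complex and x y :: 'a
  show "c *\<^sub>C (x + y) = c *\<^sub>C x + c *\<^sub>C y" by (rule scaleC_add_right)
  show "(c + d) *\<^sub>C x = c *\<^sub>C x + d *\<^sub>C x" by (rule scaleC_add_left)
  show "c *\<^sub>C d *\<^sub>C x = (c * d) *\<^sub>C x" by (rule scaleC_scaleC)
  show "1 *\<^sub>C x = x" using scaleR_scaleC [of 1 x] by simp
qed

abbreviation clinear :: "('a::complex_inner \<Rightarrow> 'b::complex_inner) \<Rightarrow> bool"
  where "clinear \<equiv> Vector_Spaces.linear scaleC scaleC"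

text \<open>\<^term>\<open>complex_vector.dim\<close> is 0 on infinite-dimensional spaces, so finiteness of a
  dimension is stated separately.\<close>

definition finite_cdim :: "'a::complex_inner set \<Rightarrow> bool"
  where "finite_cdim S \<longleftrightarrow> (\<exists>B. finite B \<and> S \<subseteq> complex_vector.span B)"

definition corthogonal :: "'a::complex_inner set \<Rightarrow> 'a set"
  where "corthogonal S = {y. \<forall>x\<in>S. cinner x y = 0}"

lemma cinner_minus_left: "cinner (- x) y = - cinner x (y::'a::complex_inner)"
proof -
  have "cinner (0::'a) y = 0" using cinner_add_left[of 0 0 y] by simp
  then show ?thesis using cinner_add_left[of x "-x" y] by (simp add: eq_neg_iff_add_eq_0 add.commute)
qed

lemma cinner_minus_right: "cinner x (- y) = - cinner x (y::'a::complex_inner)"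
  by (metis cinner_commute cinner_minus_left complex_cnj_minus)

lemma cinner_zero_left: "cinner (0::'a::complex_inner) y = 0" using cinner_add_left[of 0 0 y] by simp

lemma cinner_zero_right: "cinner y (0::'a::complex_inner) = 0"
  by (metis cinner_commute cinner_zero_left complex_cnj_zero)

lemma cinner_eqI:
  assumes "\<And>u. cinner u x = cinner u (y::'a::complex_inner)" shows "x = y"
proof -
  have "inner (x-y) x = inner (x-y) y" using assms[of "x-y"]
    by (simp add: inner_eq_Re_cinner)
  then have "inner (x-y) (x-y) = 0" by (simp add: inner_diff_right)
  then show ?thesis by simp
qed


section \<open>Unbounded operators\<close>

text \<open>An operator is represented by its graph; its domain and range are \<^const>\<open>Domain\<close> and
  \<^const>\<open>Range\<close>, extension is inclusion, \<open>S T\<close> (first \<open>T\<close>, then \<open>S\<close>) is \<open>T O S\<close>, and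
  closedness is \<^const>\<open>closed\<close>. A total function \<open>f\<close> enters as \<open>graph_of f\<close>.\<close>

type_synonym ('a, 'b) oper = "('a \<times> 'b) set"

definition linear_operator :: "('a::complex_inner, 'b::complex_inner) oper \<Rightarrow> bool"
  where "linear_operator T \<longleftrightarrow> complex_vector.subspace T \<and> single_valued T"

definition graph_of :: "('a \<Rightarrow> 'b) \<Rightarrow> ('a, 'b) oper"
  where "graph_of f = {(x, f x) | x. True}"

definition op_apply :: "('a, 'b) oper \<Rightarrow> 'a \<Rightarrow> 'b"
  where "op_apply T x = (THE y. (x, y) \<in> T)"

definition op_ker :: "('a, 'b::zero) oper \<Rightarrow> 'a set"
  where "op_ker T = {x. (x, 0) \<in> T}"

definition op_plus :: "('a, 'b::plus) oper \<Rightarrow> ('a, 'b) oper \<Rightarrow> ('a, 'b) oper" (infixl \<open>+\<^sub>o\<close> 65)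
  where "S +\<^sub>o T = {(x, y + z) | x y z. (x, y) \<in> S \<and> (x, z) \<in> T}"

definition op_uminus :: "('a, 'b::uminus) oper \<Rightarrow> ('a, 'b) oper"
  where "op_uminus T = {(x, - y) | x y. (x, y) \<in> T}"

definition op_shift :: "('a::complex_inner, 'a) oper \<Rightarrow> complex \<Rightarrow> ('a, 'a) oper" (infixl \<open>-\<^sub>o\<close> 65)
  where "T -\<^sub>o z = T +\<^sub>o graph_of (\<lambda>x. - (z *\<^sub>C x))"

text \<open>\<open>offdiag S T\<close> is the operator matrix with rows \<open>(0, S)\<close> and \<open>(T, 0)\<close>.\<close>

definition offdiag :: "('b, 'c) oper \<Rightarrow> ('a, 'd) oper \<Rightarrow> ('a \<times> 'b, 'c \<times> 'd) oper"
  where "offdiag S T = {((x, y), (s, t)) | x y s t. (y, s) \<in> S \<and> (x, t) \<in> T}"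

definition adjoint_op :: "('a::complex_inner, 'b::complex_inner) oper \<Rightarrow> ('b, 'a) oper"
  where "adjoint_op T = {(v, w). \<forall>(x, y)\<in>T. cinner y v = cinner x w}"

text \<open>With \<open>N = offdiag (- A) A\<close> this is the formula \<open>N\<^sup>* = offdiag A\<^sup>* (- A\<^sup>*)\<close> on \<open>dom A\<^sup>* \<times> dom A\<^sup>*\<close>.\<close>

lemma adjoint_offdiag_uminus:
  fixes A :: "('a::complex_inner, 'a) oper"
  assumes "linear_operator A"
  shows "adjoint_op (offdiag (op_uminus A) A) = offdiag (adjoint_op A) (op_uminus (adjoint_op A))"
proof -
  have 0: "(0, 0) \<in> A"
    using assms complex_vector.subspace_0 [of A] by (simp add: linear_operator_def zero_prod_def)
  have 1: "(v, w) \<in> adjoint_op A \<longleftrightarrow> (\<forall>x y. (x, y) \<in> A \<longrightarrow> cinner y v = cinner x w)" for v w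
    by (auto simp: adjoint_op_def)
  have 2: "(v, w) \<in> op_uminus R \<longleftrightarrow> (v, - w) \<in> R" for v w and R :: "('a, 'a) oper"
    unfolding op_uminus_def by (auto intro: exI [of _ "- w"])
  have 3: "((a, b), (c, d)) \<in> offdiag R S \<longleftrightarrow> (b, c) \<in> R \<and> (a, d) \<in> S"
    for a b c d and R S :: "('a, 'a) oper"
    by (auto simp: offdiag_def)
  have "((a, b), (c, d)) \<in> adjoint_op (offdiag (op_uminus A) A) \<longleftrightarrow>
      (b, c) \<in> adjoint_op A \<and> (a, - d) \<in> adjoint_op A" (is "?L \<longleftrightarrow> ?R") for a b c d
  proof -
    have L: "?L \<longleftrightarrow> (\<forall>x y s t. (y, - s) \<in> A \<longrightarrow> (x, t) \<in> A \<longrightarrow>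
        cinner s a + cinner t b = cinner x c + cinner y d)"
      by (simp add: adjoint_op_def Ball_def 2 3 cinner_prod_def) blast
    show ?thesis
    proof
      assume ?L
      note * = this[unfolded L, rule_format]
      have "(b, c) \<in> adjoint_op A"
        unfolding 1
      proof (intro allI impI)
        fix x t assume "(x, t) \<in> A"
        then show "cinner t b = cinner x c"
          using *[of 0 0 x t] 0 by (simp add: cinner_zero_left)
      qed
      moreover have "(a, - d) \<in> adjoint_op A"
        unfolding 1
      proof (intro allI impI)
        fix y s assume "(y, s) \<in> A"
        then show "cinner s a = cinner y (- d)"
          using *[of y "- s" 0 0] 0
          by (simp add: cinner_zero_left cinner_minus_left cinner_minus_right)
            (metis add.inverse_inverse)
      qed
      ultimately show ?R ..
    next
      assume R: ?R
      show ?L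
        unfolding L
      proof (intro allI impI)
        fix x y s t assume "(y, - s) \<in> A" "(x, t) \<in> A"
        then have "cinner (- s) a = cinner y (- d)" "cinner t b = cinner x c"
          using R unfolding 1 by blast+
        then show "cinner s a + cinner t b = cinner x c + cinner y d"
          by (simp add: cinner_minus_left cinner_minus_right)
      qed
    qed
  qed
  then show ?thesis
    by (simp add: set_eq_iff split_paired_All 2 3)
qed

definition densely_defined :: "('a::complex_inner, 'b) oper \<Rightarrow> bool"
  where "densely_defined T \<longleftrightarrow> closure (Domain T) = UNIV"

definition symmetric_op :: "('a::complex_inner, 'a) oper \<Rightarrow> bool"
  where "symmetric_op T \<longleftrightarrow> (\<forall>(u, u')\<in>T. \<forall>(v, v')\<in>T. cinner u' v = cinner u v')"

definition self_adjoint_op :: "('a::complex_inner, 'a) oper \<Rightarrow> bool"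
  where "self_adjoint_op T \<longleftrightarrow> linear_operator T \<and> densely_defined T \<and> adjoint_op T = T"

definition fredholm :: "('a::complex_inner, 'b::complex_inner) oper \<Rightarrow> bool"
  where "fredholm T \<longleftrightarrow> linear_operator T \<and> closed T \<and> finite_cdim (op_ker T) \<and>
    closed (Range T) \<and> (\<exists>B. finite B \<and> complex_vector.span (Range T \<union> B) = UNIV)"

definition ess_spectrum :: "('a::complex_inner, 'a) oper \<Rightarrow> complex set"
  where "ess_spectrum T = {z. \<not> fredholm (T -\<^sub>o z)}"

text \<open>The norm of the graph scalar product \<open>\<langle>u, v\<rangle> + \<langle>T u, T v\<rangle>\<close> on the domain of \<open>T\<close>, and
  the norm on the product of two copies of that space (\<^const>\<open>norm\<close> of a pair is the
  Euclidean combination).\<close>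

definition graph_norm :: "('a::complex_inner, 'b::complex_inner) oper \<Rightarrow> 'a \<Rightarrow> real"
  where "graph_norm T u = norm (u, op_apply T u)"

definition graph_norm2 :: "('a::complex_inner, 'b::complex_inner) oper \<Rightarrow> 'a \<times> 'a \<Rightarrow> real"
  where "graph_norm2 T p = norm (graph_norm T (fst p), graph_norm T (snd p))"


section \<open>Regularity of families\<close>

definition C1_on :: "(real \<Rightarrow> 'a::real_normed_vector) \<Rightarrow> real set \<Rightarrow> bool"
  where "C1_on f I \<longleftrightarrow> (\<exists>f'. (\<forall>t\<in>I. (f has_vector_derivative f' t) (at t within I)) \<and>
    continuous_on I f')"

definition C2_on :: "(real \<Rightarrow> 'a::real_normed_vector) \<Rightarrow> real set \<Rightarrow> bool"
  where "C2_on f I \<longleftrightarrow> (\<exists>f'. (\<forall>t\<in>I. (f has_vector_derivative f' t) (at t within I)) \<and>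
    C1_on f' I)"

text \<open>Bounded operators on a subspace \<open>S\<close> with its own norm \<open>\<nu>\<close> (such as the domain of an
  operator with the graph norm) have no type of their own; they are functions whose values
  outside \<open>S\<close> are irrelevant, and \<open>norm_on S \<nu>\<close> is their operator norm. Because a supremum of an
  unbounded set of reals carries no information, boundedness is always required separately.\<close>

definition bounded_clinear_on ::
    "'a::complex_inner set \<Rightarrow> ('a \<Rightarrow> real) \<Rightarrow> ('a \<Rightarrow> 'b::complex_inner) \<Rightarrow> bool"
  where "bounded_clinear_on S \<nu> f \<longleftrightarrow>
    (\<forall>x\<in>S. \<forall>y\<in>S. f (x + y) = f x + f y) \<and> (\<forall>c. \<forall>x\<in>S. f (c *\<^sub>C x) = c *\<^sub>C f x) \<and>
    (\<exists>K. \<forall>x\<in>S. norm (f x) \<le> K * \<nu> x)"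

definition norm_on :: "'a set \<Rightarrow> ('a \<Rightarrow> real) \<Rightarrow> ('a \<Rightarrow> 'b::real_normed_vector) \<Rightarrow> real"
  where "norm_on S \<nu> f = (SUP x\<in>{x\<in>S. \<nu> x \<le> 1}. norm (f x))"

definition has_op_derivative :: "'a::complex_inner set \<Rightarrow> ('a \<Rightarrow> real) \<Rightarrow>
    (real \<Rightarrow> 'a \<Rightarrow> 'b::complex_inner) \<Rightarrow> ('a \<Rightarrow> 'b) \<Rightarrow> real \<Rightarrow> real set \<Rightarrow> bool"
  where "has_op_derivative S \<nu> F D t I \<longleftrightarrow>
    (\<forall>s\<in>I. bounded_clinear_on S \<nu> (F s)) \<and> bounded_clinear_on S \<nu> D \<and>
    ((\<lambda>s. norm_on S \<nu> (\<lambda>x. (F s x - F t x) /\<^sub>R (s - t) - D x)) \<longlongrightarrow> 0) (at t within I)"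

definition op_derivative :: "'a::complex_inner set \<Rightarrow> ('a \<Rightarrow> real) \<Rightarrow>
    (real \<Rightarrow> 'a \<Rightarrow> 'b::complex_inner) \<Rightarrow> real \<Rightarrow> real set \<Rightarrow> 'a \<Rightarrow> 'b"
  where "op_derivative S \<nu> F t I = (SOME D. has_op_derivative S \<nu> F D t I)"

definition op_continuous_on :: "'a::complex_inner set \<Rightarrow> ('a \<Rightarrow> real) \<Rightarrow>
    (real \<Rightarrow> 'a \<Rightarrow> 'b::complex_inner) \<Rightarrow> real set \<Rightarrow> bool"
  where "op_continuous_on S \<nu> F I \<longleftrightarrow> (\<forall>s\<in>I. bounded_clinear_on S \<nu> (F s)) \<and>
    (\<forall>t\<in>I. ((\<lambda>s. norm_on S \<nu> (\<lambda>x. F s x - F t x)) \<longlongrightarrow> 0) (at t within I))"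

definition op_C1_on :: "'a::complex_inner set \<Rightarrow> ('a \<Rightarrow> real) \<Rightarrow>
    (real \<Rightarrow> 'a \<Rightarrow> 'b::complex_inner) \<Rightarrow> real set \<Rightarrow> bool"
  where "op_C1_on S \<nu> F I \<longleftrightarrow> (\<exists>F'. (\<forall>t\<in>I. has_op_derivative S \<nu> F (F' t) t I) \<and>
    op_continuous_on S \<nu> F' I)"

definition op_C2_on :: "'a::complex_inner set \<Rightarrow> ('a \<Rightarrow> real) \<Rightarrow>
    (real \<Rightarrow> 'a \<Rightarrow> 'b::complex_inner) \<Rightarrow> real set \<Rightarrow> bool"
  where "op_C2_on S \<nu> F I \<longleftrightarrow> (\<exists>F'. (\<forall>t\<in>I. has_op_derivative S \<nu> F (F' t) t I) \<and>
    op_C1_on S \<nu> F' I)"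


section \<open>Bounded operators on a Hilbert space\<close>

definition bounded_self_adjoint :: "('a::complex_inner \<Rightarrow>\<^sub>L 'a) \<Rightarrow> bool"
  where "bounded_self_adjoint F \<longleftrightarrow> clinear (blinfun_apply F) \<and>
    (\<forall>x y. cinner (blinfun_apply F x) y = cinner x (blinfun_apply F y))"

definition orthogonal_projection :: "('a::complex_inner \<Rightarrow>\<^sub>L 'a) \<Rightarrow> bool"
  where "orthogonal_projection P \<longleftrightarrow> bounded_self_adjoint P \<and> P o\<^sub>L P = P"

text \<open>The operator matrix with rows \<open>(0, S)\<close> and \<open>(T, 0)\<close>, as a bounded operator.\<close>

definition blinfun_offdiag :: "('b::real_normed_vector \<Rightarrow>\<^sub>L 'c::real_normed_vector) \<Rightarrow>
    ('a::real_normed_vector \<Rightarrow>\<^sub>L 'd::real_normed_vector) \<Rightarrow> ('a \<times> 'b) \<Rightarrow>\<^sub>L ('c \<times> 'd)"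
  where "blinfun_offdiag S T =
    Blinfun (\<lambda>p. (blinfun_apply S (snd p), blinfun_apply T (fst p)))"

lemma blinfun_apply_offdiag:
  "blinfun_apply (blinfun_offdiag S T) p = (blinfun_apply S (snd p), blinfun_apply T (fst p))"
  unfolding blinfun_offdiag_def
  by (subst bounded_linear_Blinfun_apply)
    (auto intro!: bounded_linear_Pair blinfun.bounded_linear_right
      bounded_linear_compose [OF blinfun.bounded_linear_right bounded_linear_fst]
      bounded_linear_compose [OF blinfun.bounded_linear_right bounded_linear_snd])

lemma adjoint_offdiag_bounded:
  fixes F G :: "'a::complex_inner \<Rightarrow>\<^sub>L 'a"
  assumes "bounded_self_adjoint F" "bounded_self_adjoint G"
  shows "adjoint_op (graph_of (blinfun_apply (blinfun_offdiag (- G) F))) = graph_of (blinfun_apply (blinfun_offdiag F (- G)))"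
proof (rule set_eqI, clarify)
  fix a b c d :: 'a
  have s: "cinner (F x) y = cinner x (F y)" "cinner (G x) y = cinner x (G y)" for x y :: 'a
    using assms by (auto simp: bounded_self_adjoint_def)
  have "((a,b),(c,d)) \<in> adjoint_op (graph_of (blinfun_apply (blinfun_offdiag (- G) F))) \<longleftrightarrow>
    (\<forall>u. cinner u (F b, - G a) = cinner u (c,d))"
    unfolding adjoint_op_def graph_of_def
    by (simp add: blinfun_apply_offdiag cinner_prod_def s cinner_minus_left cinner_minus_right blinfun.minus_left add.commute)
  also have "\<dots> \<longleftrightarrow> (F b, - G a) = (c,d)" using cinner_eqI by metis
  also have "\<dots> \<longleftrightarrow> ((a,b),(c,d)) \<in> graph_of (blinfun_apply (blinfun_offdiag F (- G)))"
    by (auto simp: graph_of_def blinfun_apply_offdiag blinfun.minus_left)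
  finally show "((a,b),(c,d)) \<in> adjoint_op (graph_of (blinfun_apply (blinfun_offdiag (- G) F))) \<longleftrightarrow> ((a,b),(c,d)) \<in> graph_of (blinfun_apply (blinfun_offdiag F (- G)))" .
qed


section \<open>Symplectic forms and crossing forms\<close>

definition symp_J :: "'k \<times> 'k \<Rightarrow> 'k \<times> 'k::complex_inner"
  where "symp_J = (\<lambda>(x, y). (y, - x))"

definition symp_omega :: "'k::complex_inner \<times> 'k \<Rightarrow> 'k \<times> 'k \<Rightarrow> complex"
  where "symp_omega f g = cinner (symp_J f) g"

definition symp_Omega ::
    "('k::complex_inner \<times> 'k) \<times> ('k \<times> 'k) \<Rightarrow> ('k \<times> 'k) \<times> ('k \<times> 'k) \<Rightarrow> complex"
  where "symp_Omega f g = cinner (map_prod symp_J (\<lambda>x. - symp_J x) f) g"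

type_synonym 'k double = "(('k \<times> 'k) \<times> ('k \<times> 'k)) \<times> (('k \<times> 'k) \<times> ('k \<times> 'k))"

definition symp_Omega2 :: "'k::complex_inner double \<Rightarrow> 'k double \<Rightarrow> complex"
  where "symp_Omega2 f g = symp_Omega (fst f) (fst g) - symp_Omega (snd f) (snd g)"

definition lagrangian :: "('k::complex_inner \<times> 'k) set \<Rightarrow> bool"
  where "lagrangian L \<longleftrightarrow> complex_vector.subspace L \<and> L = {f. \<forall>g\<in>L. symp_omega f g = 0}"

definition diagonal_plane :: "'k double set"
  where "diagonal_plane = {(q, q) | q. True}"

text \<open>\<open>C1_graph_path \<Upsilon> s\<^sub>0 M\<close>: for \<open>s\<close> near \<open>s\<^sub>0\<close> the subspace \<open>\<Upsilon> s\<close> is the graph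
  of \<open>M s\<close>, acting from \<open>\<Upsilon> s\<^sub>0\<close> to its orthogonal complement, where \<open>M\<close> is \<open>C\<^sup>1\<close> and vanishes
  at \<open>s\<^sub>0\<close>. These conditions determine \<open>M s\<close> on \<open>\<Upsilon> s\<^sub>0\<close> for \<open>s\<close> near \<open>s\<^sub>0\<close>.\<close>

definition C1_graph_path :: "(real \<Rightarrow> 'a::complex_inner set) \<Rightarrow> real \<Rightarrow> (real \<Rightarrow> 'a \<Rightarrow> 'a) \<Rightarrow> bool"
  where "C1_graph_path \<Upsilon> s\<^sub>0 M \<longleftrightarrow>
    (\<exists>\<epsilon>>0. op_C1_on (\<Upsilon> s\<^sub>0) norm M (ball s\<^sub>0 \<epsilon>) \<and>
      (\<forall>s\<in>ball s\<^sub>0 \<epsilon>. M s ` \<Upsilon> s\<^sub>0 \<subseteq> corthogonal (\<Upsilon> s\<^sub>0) \<and>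
        \<Upsilon> s = {\<q> + M s \<q> | \<q>. \<q> \<in> \<Upsilon> s\<^sub>0})) \<and>
    (\<forall>\<q>\<in>\<Upsilon> s\<^sub>0. M s\<^sub>0 \<q> = 0)"

text \<open>\<open>has_crossing_form \<D> \<Upsilon> s\<^sub>0 \<q> \<p> m\<close>: at \<open>s\<^sub>0\<close> the crossing form of the path \<open>\<Upsilon>\<close> with
  respect to the reference plane \<open>\<D>\<close> is well-defined and takes the value \<open>m\<close> at \<open>(\<q>, \<p>)\<close>.\<close>

definition has_crossing_form ::
    "'k::complex_inner double set \<Rightarrow> (real \<Rightarrow> 'k double set) \<Rightarrow> real \<Rightarrow>
      'k double \<Rightarrow> 'k double \<Rightarrow> complex \<Rightarrow> bool"
  where "has_crossing_form \<D> \<Upsilon> s\<^sub>0 \<q> \<p> m \<longleftrightarrow>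
    \<q> \<in> \<Upsilon> s\<^sub>0 \<inter> \<D> \<and> \<p> \<in> \<Upsilon> s\<^sub>0 \<inter> \<D> \<and> (\<exists>M. C1_graph_path \<Upsilon> s\<^sub>0 M) \<and>
    (\<forall>M. C1_graph_path \<Upsilon> s\<^sub>0 M \<longrightarrow>
      ((\<lambda>s. symp_Omega2 \<q> (M s \<p>)) has_vector_derivative m) (at s\<^sub>0))"

end

theory Submission
  imports Defs
begin

text \<open>Both crossing forms are values of one formula. Composing with the swap \<open>\<tau>\<close> turns the operator
  \<open>(N\<^sup>* + V\<^sup>* - \<mu>) \<tau>\<close> into \<open>E + R\<close>, where \<open>E = diag(A\<^sup>*, - A\<^sup>*)\<close> is the adjoint of the closed symmetric
  operator \<open>D = \<tau> N = diag(A, - A)\<close> and \<open>R = \<tau> V - \<mu> \<tau>\<close> is bounded and self-adjoint. In this form the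
  traces satisfy Green's identity \<open>\<langle>E x, y\<rangle> - \<langle>x, E y\<rangle> = \<Omega>(T x, T y)\<close>, and both \<open>t\<close> and \<open>\<mu>\<close> enter
  only through a \<open>C\<^sup>1\<close> family of data \<open>(R\<^sub>s, T\<^sub>s, P\<^sub>s, Q\<^sub>s)\<close>.

  Suppose that bounded operators \<open>B\<^sub>s\<close>, \<open>C\<^sup>1\<close> in \<open>s\<close>, map \<open>\<Upsilon>\<close> at \<open>s\<^sub>0\<close> onto \<open>\<Upsilon>\<close> at \<open>s\<close> and fix \<open>\<Upsilon>\<close> at
  \<open>s\<^sub>0\<close> pointwise. Then the graph operators \<open>M\<^sub>s\<close> exist, and \<open>M' q\<close> is \<open>B' q\<close> minus its component along
  \<open>\<Upsilon>\<close>. As \<open>\<Upsilon>\<close> is isotropic, that component is invisible to the symplectic form, and the crossing form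
  is \<open>\<Omega>(q, B' q)\<close> for any such \<open>B\<close> (\<open>has_crossing_form_of_parametrization\<close>). On the factor \<open>ran P \<times> ran Q\<close>
  one takes \<open>B = P\<^sub>s \<oplus> Q\<^sub>s\<close>. On the boundary values of the kernel of \<open>E + R\<^sub>s\<close> one takes
  \<open>B = T\<^sub>s Z\<^sub>s T\<^sup>-\<^sup>1\<close>, where \<open>Z\<^sub>s\<close> transports the kernel at \<open>s\<^sub>0\<close> to the one at \<open>s\<close> and \<open>T\<^sup>-\<^sup>1\<close> is the inverse
  of the trace on the kernel at \<open>s\<^sub>0\<close>.

  All of this rests on \<open>E + R\<close> being onto at \<open>s\<^sub>0\<close> (\<open>adjoint_plus_surjective\<close>). The self-adjoint restriction
  belonging to \<open>\<N> + V - \<mu>\<close> has closed range, and its one-dimensional kernel is the complement of that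
  range. By unique continuation \<open>D + R = (E + R)\<^sup>*\<close> is injective, so \<open>E + R\<close> has dense range, which
  must then contain the one missing direction. A closed surjective operator has a bounded right inverse
  \<open>S\<close> (\<open>bounded_right_inverse_of_adjoint\<close>, from the Baire category theorem), which yields \<open>Z\<^sub>s\<close> by
  inverting \<open>(E + R\<^sub>s) S\<close> near \<open>s\<^sub>0\<close>, and which makes the trace bounded below on the kernel by Green's
  identity.

  The formula follows by differentiating \<open>(E + R\<^sub>s) Z\<^sub>s u = 0\<close>: the vector \<open>z = Z' u\<close> satisfies
  \<open>(E + R) z = - R' u\<close>, so Green's identity gives \<open>\<Omega>(T u, T z) = \<langle>u, R' u\<rangle>\<close>. The remaining part of \<open>B'\<close>
  contributes the terms with \<open>T'\<close>, \<open>P'\<close> and \<open>Q'\<close>. Here \<open>R' = \<tau> V'\<close> for the path in \<open>t\<close> and \<open>R' = - \<tau>\<close> for the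
  path in \<open>\<mu>\<close>.

  Bounded operators are handled as real-linear ones. Orthogonality to a complex subspace
  is the same for the real and the complex inner product, so projections and graph operators between complex
  subspaces come out complex-linear where this is needed.\<close>


section \<open>Closed subspaces of real Hilbert spaces\<close>

lemma parallelogram_law:
  fixes x y :: "'a::real_inner"
  shows "(norm (x + y))\<^sup>2 + (norm (x - y))\<^sup>2 = 2 * (norm x)\<^sup>2 + 2 * (norm y)\<^sup>2"
  by (simp add: power2_norm_eq_inner inner_simps inner_commute)

text \<open>By the parallelogram law a minimizing sequence is a Cauchy sequence, since midpoints of its members
  are again at distance at least \<open>d\<close>.\<close>

lemma closest_point_in_subspace:
  fixes S :: "'a::{real_inner,complete_space} set"
  assumes S: "subspace S" "closed S"
  shows "\<exists>p\<in>S. \<forall>y\<in>S. norm (x - p) \<le> norm (x - y)"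
proof -
  define d where "d = (INF y\<in>S. norm (x - y))"
  have ne: "S \<noteq> {}" using S(1) subspace_0 by blast
  have bdd: "bdd_below ((\<lambda>y. norm (x - y)) ` S)" by (rule bdd_belowI2[of _ 0]) simp
  have d_le: "d \<le> norm (x - y)" if "y \<in> S" for y
    unfolding d_def using bdd that by (rule cINF_lower)
  have d0: "0 \<le> d" unfolding d_def using ne by (rule cINF_greatest) simp
  have "\<exists>y\<in>S. norm (x - y) < d + inverse (real (Suc n))" for n
  proof -
    have "d < d + inverse (real (Suc n))" by simp
    then show ?thesis unfolding d_def using cINF_less_iff[OF ne bdd] by blast
  qed
  then obtain f where fS: "\<And>n. f n \<in> S"
    and f: "\<And>n. norm (x - f n) < d + inverse (real (Suc n))" by metis
  have sq: "(norm (f m - f n))\<^sup>2 \<le> 2 * ((norm (x - f m))\<^sup>2 - d\<^sup>2) + 2 * ((norm (x - f n))\<^sup>2 - d\<^sup>2)" for m n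
  proof -
    have "(1/2) *\<^sub>R (f m + f n) \<in> S" using S(1) fS by (simp add: subspace_add subspace_scale)
    then have "d \<le> norm (x - (1/2) *\<^sub>R (f m + f n))" by (rule d_le)
    also have "x - (1/2) *\<^sub>R (f m + f n) = (1/2) *\<^sub>R ((x - f m) + (x - f n))"
      by (simp add: algebra_simps flip: scaleR_add_left)
    finally have "2 * d \<le> norm ((x - f m) + (x - f n))" by simp
    then have "(2 * d)\<^sup>2 \<le> (norm ((x - f m) + (x - f n)))\<^sup>2"
      using d0 by (intro power_mono) auto
    then show ?thesis
      using parallelogram_law[of "x - f m" "x - f n"] by (simp add: norm_minus_commute)
  qed
  have lim: "(\<lambda>n. norm (x - f n)) \<longlonglongrightarrow> d"
  proof (rule tendsto_sandwich[of "\<lambda>n. d" _ _ "\<lambda>n. d + inverse (real (Suc n))"])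
    show "(\<lambda>n. d + inverse (real (Suc n))) \<longlonglongrightarrow> d"
      using tendsto_add[OF tendsto_const LIMSEQ_inverse_real_of_nat, of d] by simp
    show "\<forall>\<^sub>F n in sequentially. norm (x - f n) \<le> d + inverse (real (Suc n))"
      using f by (simp add: less_imp_le)
  qed (use d_le fS in auto)
  then have lim2: "(\<lambda>n. 2 * ((norm (x - f n))\<^sup>2 - d\<^sup>2)) \<longlonglongrightarrow> 0"
    using tendsto_mult[OF tendsto_const tendsto_diff[OF tendsto_power[OF lim] tendsto_const], of 2 2 "d\<^sup>2"]
    by simp
  have "Cauchy f"
  proof (rule metric_CauchyI)
    fix e :: real assume e: "0 < e"
    then have "\<forall>\<^sub>F n in sequentially. 2 * ((norm (x - f n))\<^sup>2 - d\<^sup>2) < e\<^sup>2 / 2"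
      by (intro order_tendstoD(2)[OF lim2]) simp
    then obtain N where N: "\<And>n. n \<ge> N \<Longrightarrow> 2 * ((norm (x - f n))\<^sup>2 - d\<^sup>2) < e\<^sup>2 / 2"
      by (auto simp: eventually_sequentially)
    have "dist (f m) (f n) < e" if "m \<ge> N" "n \<ge> N" for m n
    proof -
      have "(norm (f m - f n))\<^sup>2 < e\<^sup>2" using sq[of m n] N[OF that(1)] N[OF that(2)] by simp
      then show ?thesis using e by (simp add: dist_norm power_less_imp_less_base)
    qed
    then show "\<exists>M. \<forall>m\<ge>M. \<forall>n\<ge>M. dist (f m) (f n) < e" by blast
  qed
  then obtain p where p: "f \<longlonglongrightarrow> p" using Cauchy_convergent convergent_def by blast
  have "p \<in> S" using S(2) fS p closed_sequentially by blast
  moreover have "(\<lambda>n. norm (x - f n)) \<longlonglongrightarrow> norm (x - p)" using p by (intro tendsto_intros)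
  then have "norm (x - p) = d" using lim LIMSEQ_unique by blast
  ultimately show ?thesis using d_le by auto
qed

lemma orthogonal_decomposition_exists:
  fixes S :: "'a::{real_inner,complete_space} set"
  assumes S: "subspace S" "closed S"
  shows "\<exists>p\<in>S. x - p \<in> orthogonal_comp S"
proof -
  obtain p where p: "p \<in> S" and min: "\<And>y. y \<in> S \<Longrightarrow> norm (x - p) \<le> norm (x - y)"
    using closest_point_in_subspace[OF S] by blast
  have "inner y (x - p) = 0" if y: "y \<in> S" for y
  proof (cases "y = 0")
    case False
    define c where "c = inner y (x - p) / inner y y"
    have "p + c *\<^sub>R y \<in> S" using S(1) p y by (simp add: subspace_add subspace_scale)
    then have "(norm (x - p))\<^sup>2 \<le> (norm (x - p - c *\<^sub>R y))\<^sup>2"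
      using min[of "p + c *\<^sub>R y"] by (intro power_mono) (auto simp: diff_diff_eq)
    also have "\<dots> = (norm (x - p))\<^sup>2 - (2 * c * inner y (x - p) - c * c * inner y y)"
      by (simp add: power2_norm_eq_inner inner_simps inner_commute algebra_simps)
    also have "2 * c * inner y (x - p) - c * c * inner y y = (inner y (x - p))\<^sup>2 / inner y y"
      using False by (simp add: c_def power2_eq_square)
    finally have "(inner y (x - p))\<^sup>2 / inner y y \<le> 0" by simp
    then show ?thesis using False
      by (metis divide_le_0_iff inner_eq_zero_iff inner_ge_zero less_eq_real_def not_less
          power2_less_eq_zero_iff zero_eq_power2 zero_le_power2)
  qed simp
  then show ?thesis using p by (auto simp: orthogonal_comp_def orthogonal_def)
qed

definition proj_onto :: "'a::{real_inner,complete_space} set \<Rightarrow> 'a \<Rightarrow>\<^sub>L 'a"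
  where "proj_onto S = Blinfun (\<lambda>x. SOME p. p \<in> S \<and> x - p \<in> orthogonal_comp S)"

lemma orthogonal_comp_trivial_Int: "x \<in> S \<Longrightarrow> x \<in> orthogonal_comp S \<Longrightarrow> x = 0"
  by (auto simp: orthogonal_comp_def orthogonal_def)

lemma
  fixes S :: "'a::{real_inner,complete_space} set"
  assumes S: "subspace S" "closed S"
  shows proj_onto_mem: "blinfun_apply (proj_onto S) x \<in> S"
    and proj_onto_diff: "x - blinfun_apply (proj_onto S) x \<in> orthogonal_comp S"
    and norm_proj_onto_apply: "norm (blinfun_apply (proj_onto S) x) \<le> norm x"
proof -
  define f where "f x = (SOME p. p \<in> S \<and> x - p \<in> orthogonal_comp S)" for x
  have f: "f x \<in> S \<and> x - f x \<in> orthogonal_comp S" for x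
    unfolding f_def by (rule someI_ex) (use orthogonal_decomposition_exists[OF S, of x] in blast)
  have unique: "p = f x" if "p \<in> S" "x - p \<in> orthogonal_comp S" for x p
  proof -
    have "p - f x \<in> S" using S(1) that f by (simp add: subspace_diff)
    moreover have "(x - f x) - (x - p) \<in> orthogonal_comp S"
      using that f subspace_orthogonal_comp subspace_diff by blast
    then have "p - f x \<in> orthogonal_comp S" by simp
    ultimately have "p - f x = 0" by (rule orthogonal_comp_trivial_Int)
    then show ?thesis by simp
  qed
  have add: "f (x + y) = f x + f y" for x y
  proof (rule unique[symmetric])
    show "f x + f y \<in> S" using S(1) f by (simp add: subspace_add)
    have "(x - f x) + (y - f y) \<in> orthogonal_comp S" using f subspace_orthogonal_comp subspace_add by blast
    then show "x + y - (f x + f y) \<in> orthogonal_comp S" by (simp add: algebra_simps)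
  qed
  have scale: "f (c *\<^sub>R x) = c *\<^sub>R f x" for c x
  proof (rule unique[symmetric])
    show "c *\<^sub>R f x \<in> S" using S(1) f by (simp add: subspace_scale)
    have "c *\<^sub>R (x - f x) \<in> orthogonal_comp S" using f subspace_orthogonal_comp subspace_scale by blast
    then show "c *\<^sub>R x - c *\<^sub>R f x \<in> orthogonal_comp S" by (simp add: algebra_simps)
  qed
  have norm: "norm (f x) \<le> norm x" for x
  proof -
    have "inner (f x) (x - f x) = 0" using f by (auto simp: orthogonal_comp_def orthogonal_def)
    then have "(norm x)\<^sup>2 = (norm (f x))\<^sup>2 + (norm (x - f x))\<^sup>2"
      by (simp add: power2_norm_eq_inner inner_simps inner_commute)
    then have "(norm (f x))\<^sup>2 \<le> (norm x)\<^sup>2" by simp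
    then show ?thesis by (simp add: power2_le_iff_abs_le)
  qed
  have "bounded_linear f"
    by (rule bounded_linear_intro[of _ 1]) (auto simp: add scale norm)
  then have *: "blinfun_apply (proj_onto S) = f"
    unfolding proj_onto_def f_def by (rule bounded_linear_Blinfun_apply)
  show "blinfun_apply (proj_onto S) x \<in> S" "x - blinfun_apply (proj_onto S) x \<in> orthogonal_comp S"
    "norm (blinfun_apply (proj_onto S) x) \<le> norm x"
    using f norm by (auto simp: *)
qed

lemma proj_onto_eqI:
  fixes S :: "'a::{real_inner,complete_space} set"
  assumes S: "subspace S" "closed S" and "p \<in> S" "x - p \<in> orthogonal_comp S"
  shows "blinfun_apply (proj_onto S) x = p"
proof -
  let ?f = "blinfun_apply (proj_onto S) x"
  have "(x - ?f) - (x - p) \<in> orthogonal_comp S"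
    using proj_onto_diff[OF S] assms(4) subspace_orthogonal_comp subspace_diff by blast
  then have "p - ?f \<in> orthogonal_comp S" by simp
  moreover have "p - ?f \<in> S" using S(1) assms(3) proj_onto_mem[OF S] by (simp add: subspace_diff)
  ultimately show ?thesis using orthogonal_comp_trivial_Int[of "p - ?f" S] by simp
qed

lemma proj_onto_ident:
  fixes S :: "'a::{real_inner,complete_space} set"
  assumes "subspace S" "closed S" "x \<in> S"
  shows "blinfun_apply (proj_onto S) x = x"
  using assms by (intro proj_onto_eqI) (auto simp: orthogonal_comp_def orthogonal_def)

lemma orthogonal_comp_orthogonal_comp:
  fixes S :: "'a::{real_inner,complete_space} set"
  assumes S: "subspace S" "closed S"
  shows "orthogonal_comp (orthogonal_comp S) = S"
proof
  show "orthogonal_comp (orthogonal_comp S) \<subseteq> S"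
  proof
    fix x assume x: "x \<in> orthogonal_comp (orthogonal_comp S)"
    let ?p = "blinfun_apply (proj_onto S) x"
    have 1: "x - ?p \<in> orthogonal_comp S" "?p \<in> S" using proj_onto_diff[OF S] proj_onto_mem[OF S] by auto
    then have "inner (x - ?p) x = 0" "inner ?p (x - ?p) = 0"
      using x by (auto simp: orthogonal_comp_def orthogonal_def)
    then have "inner (x - ?p) (x - ?p) = 0" by (simp add: inner_simps inner_commute)
    then show "x \<in> S" using 1 by simp
  qed
qed (auto simp: orthogonal_comp_def orthogonal_def inner_commute)

section \<open>Uniform boundedness\<close>

text \<open>The closed sets of those \<open>h\<close> for which \<open>n\<close> bounds \<open>\<bar>\<langle>x, h\<rangle>\<bar>\<close> on \<open>B\<close> cover the space, so one of them
  contains a ball.\<close>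

lemma weakly_bounded_imp_bounded:
  fixes B :: "'a::{real_inner,complete_space} set"
  assumes wb: "\<And>h. \<exists>c. \<forall>x\<in>B. \<bar>inner x h\<bar> \<le> c"
  shows "bounded B"
proof -
  define F where "F n = {h. \<forall>x\<in>B. \<bar>inner x h\<bar> \<le> real n}" for n :: nat
  have "F n = (\<Inter>x\<in>B. {h. \<bar>inner x h\<bar> \<le> real n})" for n by (auto simp: F_def)
  then have clF: "closed (F n)" for n
    by (auto intro!: closed_INT closed_Collect_le continuous_intros)
  have UF: "(\<Union>n. F n) = UNIV"
  proof (rule set_eqI, simp add: F_def)
    fix h
    obtain c where c: "\<forall>x\<in>B. \<bar>inner x h\<bar> \<le> c" using wb by blast
    obtain n where "c \<le> real n" using real_arch_simple by blast
    then show "\<exists>n. \<forall>x\<in>B. \<bar>inner x h\<bar> \<le> real n" using c by (meson order_trans)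
  qed
  have "\<exists>n. interior (F n) \<noteq> {}"
  proof (rule ccontr)
    assume "\<not> ?thesis"
    then have "euclidean interior_of (\<Union>(range F)) = {}"
      by (intro Baire_category_alt)
        (auto simp: completely_metrizable_space_euclidean interior_of_eq_empty_alt clF)
    then show False using UF by simp
  qed
  then obtain n h r where r: "0 < r" "ball h r \<subseteq> F n"
    by (metis all_not_in_conv mem_interior)
  have "norm x \<le> 4 * real n / r" if x: "x \<in> B" for x
  proof (cases "x = 0")
    case False
    let ?k = "h + (r / (2 * norm x)) *\<^sub>R x"
    have "?k \<in> ball h r" "h \<in> ball h r" using r False by (auto simp: dist_norm)
    then have "?k \<in> F n" "h \<in> F n" using r(2) by blast+
    then have "\<bar>inner x ?k\<bar> \<le> real n" "\<bar>inner x h\<bar> \<le> real n" using x by (auto simp: F_def)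
    moreover have "inner x ?k = inner x h + r / 2 * norm x"
      using False by (simp add: inner_simps dot_square_norm power2_eq_square)
    ultimately have "r / 2 * norm x \<le> 2 * real n" by linarith
    then show ?thesis using r by (simp add: field_simps)
  qed (use r in simp)
  then show ?thesis unfolding bounded_iff by blast
qed


section \<open>Surjective adjoints have bounded right inverses\<close>

lemma complex_subspace_imp_subspace:
  fixes S :: "'a::complex_inner set"
  assumes "complex_vector.subspace S" shows "subspace S"
  using assms
  by (auto simp: subspace_def complex_vector.subspace_def scaleR_scaleC)

lemma cinner_scaleC_right: "cinner x (c *\<^sub>C y) = cnj c * cinner x (y::'a::complex_inner)"
  by (metis cinner_commute cinner_scaleC_left complex_cnj_mult)

lemma cinner_eq_inner: "cinner x y = Complex (inner x y) (inner x (\<i> *\<^sub>C (y::'a::complex_inner)))"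
  by (simp add: complex_eq_iff inner_eq_Re_cinner cinner_scaleC_right)

text \<open>On a complex subspace, vanishing of the real part of the inner product with all vectors
  forces vanishing of the imaginary part, because the subspace is stable under \<open>\<i>\<close>.\<close>

lemma corthogonal_eq_orthogonal_comp:
  fixes S :: "'a::complex_inner set"
  assumes "complex_vector.subspace S"
  shows "corthogonal S = orthogonal_comp S"
proof -
  have "cinner x y = 0" if x: "x \<in> S" and y: "\<And>x. x \<in> S \<Longrightarrow> inner x y = 0" for x y
  proof -
    have "inner x y = 0" "inner (\<i> *\<^sub>C x) y = 0"
      using y assms x by (auto simp: complex_vector.subspace_scale)
    then show ?thesis
      by (simp add: complex_eq_iff inner_eq_Re_cinner cinner_scaleC_left)
  qed
  then show ?thesis by (auto simp: corthogonal_def orthogonal_comp_def orthogonal_def inner_eq_Re_cinner)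
qed

text \<open>The graph of the adjoint is the orthogonal complement of the graph, rotated by a right angle.
  This is how adjoints inherit all their properties from orthogonal complements.\<close>

lemma adjoint_op_iff_orthogonal_comp:
  assumes "complex_vector.subspace D"
  shows "(v, w) \<in> adjoint_op D \<longleftrightarrow> (w, - v) \<in> orthogonal_comp D"
  unfolding corthogonal_eq_orthogonal_comp[OF assms, symmetric]
  by (auto simp: adjoint_op_def corthogonal_def cinner_prod_def cinner_minus_right)

lemma adjoint_op_iff_inner:
  assumes "complex_vector.subspace D"
  shows "(v, w) \<in> adjoint_op D \<longleftrightarrow> (\<forall>(x, y)\<in>D. inner y v = inner x w)"
  by (auto simp: adjoint_op_iff_orthogonal_comp[OF assms] orthogonal_comp_def orthogonal_def)

lemma closed_orthogonal_comp: "closed (orthogonal_comp S)"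
proof -
  have "orthogonal_comp S = (\<Inter>x\<in>S. {y. inner x y = 0})" by (auto simp: orthogonal_comp_def orthogonal_def)
  then show ?thesis by (auto intro!: closed_INT closed_Collect_eq continuous_intros)
qed

lemma subspace_adjoint_op:
  assumes "complex_vector.subspace D"
  shows "subspace (adjoint_op D)"
  by (auto simp: subspace_def zero_prod_def adjoint_op_iff_inner[OF assms] inner_simps split: prod.splits)

lemma closed_adjoint_op:
  assumes "complex_vector.subspace D"
  shows "closed (adjoint_op D)"
proof -
  have "adjoint_op D = (\<lambda>p. (snd p, - fst p)) -` orthogonal_comp D"
    using adjoint_op_iff_orthogonal_comp[OF assms] by auto
  also have "closed \<dots>"
    by (intro closed_vimage closed_orthogonal_comp continuous_intros)
  finally show ?thesis .
qed

text \<open>A closed operator is recovered from its adjoint, since a closed subspace is its own double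
  orthogonal complement.\<close>

lemma adjoint_op_adjoint_mem:
  fixes D :: "('a::{complex_inner,complete_space}, 'b::{complex_inner,complete_space}) oper"
  assumes D: "complex_vector.subspace D" "closed D"
    and vw: "\<And>x y. (x, y) \<in> adjoint_op D \<Longrightarrow> inner y v = inner x w"
  shows "(v, w) \<in> D"
proof -
  have "(v, w) \<in> orthogonal_comp (orthogonal_comp D)"
    unfolding orthogonal_comp_def[of "orthogonal_comp D"] orthogonal_def
  proof clarify
    fix p q assume "(p, q) \<in> orthogonal_comp D"
    then have "(- q, p) \<in> adjoint_op D" using adjoint_op_iff_orthogonal_comp[OF D(1)] by simp
    from vw[OF this] show "inner (p, q) (v, w) = 0" by simp
  qed
  then show ?thesis using orthogonal_comp_orthogonal_comp complex_subspace_imp_subspace D by blast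
qed

text \<open>If the adjoint is onto, testing against its values shows that the vectors \<open>x\<close> with
  \<open>(x, y) \<in> D\<close> and \<open>y\<close> in the unit ball are weakly bounded.\<close>

lemma bounded_below_if_adjoint_surj:
  fixes D :: "('a::{complex_inner,complete_space}, 'b::{complex_inner,complete_space}) oper"
  assumes D: "complex_vector.subspace D" and surj: "Range (adjoint_op D) = UNIV"
  shows "\<exists>C>0. \<forall>(x, y)\<in>D. norm x \<le> C * norm y"
proof -
  note D' = complex_subspace_imp_subspace[OF D]
  have "bounded {x. \<exists>y. (x, y) \<in> D \<and> norm y \<le> 1}"
  proof (rule weakly_bounded_imp_bounded)
    fix h
    obtain v where v: "(v, h) \<in> adjoint_op D" using surj by blast
    have "\<bar>inner x h\<bar> \<le> norm v" if "(x, y) \<in> D" "norm y \<le> 1" for x y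
    proof -
      have "\<bar>inner x h\<bar> = \<bar>inner y v\<bar>" using v that(1) adjoint_op_iff_inner[OF D] by fastforce
      also have "\<dots> \<le> norm y * norm v" by (rule Cauchy_Schwarz_ineq2)
      also have "\<dots> \<le> 1 * norm v" using that(2) by (rule mult_right_mono) simp
      finally show ?thesis by simp
    qed
    then show "\<exists>c. \<forall>x\<in>{x. \<exists>y. (x, y) \<in> D \<and> norm y \<le> 1}. \<bar>inner x h\<bar> \<le> c" by blast
  qed
  then obtain C where C: "C > 0" "\<And>x y. (x, y) \<in> D \<Longrightarrow> norm y \<le> 1 \<Longrightarrow> norm x \<le> C"
    unfolding bounded_pos by blast
  have "norm x \<le> C * norm y" if xy: "(x, y) \<in> D" for x y
  proof (cases "y = 0")
    case True
    have "norm x \<le> e" if "e > 0" for e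
    proof -
      have "((C / e) *\<^sub>R x, (C / e) *\<^sub>R y) \<in> D" using subspace_scale[OF D' xy, of "C / e"] by simp
      then have "norm ((C / e) *\<^sub>R x) \<le> C" using C(2) True by fastforce
      then show ?thesis using C(1) that by (simp add: field_simps)
    qed
    then have "norm x \<le> 0" by (rule field_le_epsilon[where y=0, simplified])
    then show ?thesis using True by simp
  next
    case False
    have "((1 / norm y) *\<^sub>R x, (1 / norm y) *\<^sub>R y) \<in> D"
      using subspace_scale[OF D' xy, of "1 / norm y"] by simp
    then have "norm ((1 / norm y) *\<^sub>R x) \<le> C" by (rule C(2)) (use False in simp)
    then show ?thesis using False by (simp add: field_simps)
  qed
  then show ?thesis using C(1) by blast
qed

lemma closed_Range_bounded_below:
  fixes D :: "('a::{complex_inner,complete_space}, 'b::{complex_inner,complete_space}) oper"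
  assumes D: "subspace D" "closed D" and "C > 0"
    and below: "\<And>x y. (x, y) \<in> D \<Longrightarrow> norm x \<le> C * norm y"
  shows "closed (Range D)"
proof -
  have "complete (snd ` D)"
  proof (rule complete_isometric_image)
    show "0 < 1 / (C + 1)" using \<open>C > 0\<close> by simp
    show "\<forall>p\<in>D. 1 / (C + 1) * norm p \<le> norm (snd p)"
    proof clarify
      fix x y assume "(x, y) \<in> D"
      then have "norm (x, y) \<le> C * norm y + norm y"
        using below norm_Pair_le[of x y] by fastforce
      then show "1 / (C + 1) * norm (x, y) \<le> norm (snd (x, y))"
        using \<open>C > 0\<close> by (simp add: field_simps)
    qed
  qed (use D complete_eq_closed bounded_linear_snd in auto)
  then show ?thesis by (simp add: complete_imp_closed Range_snd)
qed

text \<open>The minimal-norm solution \<open>x\<close> of \<open>D\<^sup>* x = h\<close> is orthogonal to the kernel of \<open>D\<^sup>*\<close>, hence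
  of the form \<open>D v\<close>, and \<open>\<langle>x, x\<rangle> = \<langle>D v, x\<rangle> = \<langle>v, h\<rangle>\<close> bounds it by \<open>h\<close>.\<close>

lemma bounded_right_inverse_of_adjoint:
  fixes D :: "('a::{complex_inner,complete_space}, 'b::{complex_inner,complete_space}) oper"
  assumes D: "complex_vector.subspace D" "closed D" and surj: "Range (adjoint_op D) = UNIV"
  shows "\<exists>S :: 'a \<Rightarrow>\<^sub>L 'b. \<forall>h. (blinfun_apply S h, h) \<in> adjoint_op D"
proof -
  note D' = complex_subspace_imp_subspace[OF D(1)]
  note adj = adjoint_op_iff_inner[OF D(1)]
  note subE = subspace_adjoint_op[OF D(1)]
  obtain C where C: "C > 0" "\<And>x y. (x, y) \<in> D \<Longrightarrow> norm x \<le> C * norm y"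
    using bounded_below_if_adjoint_surj[OF D(1) surj] by blast
  define Y where "Y = Range D"
  have subY: "subspace Y" using D' by (auto simp: Y_def Range_snd intro: linear_subspace_image linear_snd)
  have clY: "closed Y" unfolding Y_def using closed_Range_bounded_below[OF D' D(2) C] .
  have ker: "x \<in> orthogonal_comp Y \<longleftrightarrow> (x, 0) \<in> adjoint_op D" for x
    by (auto simp: Y_def orthogonal_comp_def orthogonal_def adj)
  have ex: "\<exists>x. (x, h) \<in> adjoint_op D \<and> x \<in> Y" for h
  proof -
    obtain v where v: "(v, h) \<in> adjoint_op D" using surj by blast
    let ?p = "blinfun_apply (proj_onto Y) v"
    have "(v - ?p, 0) \<in> adjoint_op D" using proj_onto_diff[OF subY clY] ker by simp
    then have "(?p, h) \<in> adjoint_op D" using subspace_diff[OF subE v] by fastforce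
    then show ?thesis using proj_onto_mem[OF subY clY] by blast
  qed
  have uni: "x = x'" if "(x, h) \<in> adjoint_op D" "x \<in> Y" "(x', h) \<in> adjoint_op D" "x' \<in> Y" for x x' h
  proof -
    have "x - x' \<in> orthogonal_comp Y" using subspace_diff[OF subE that(1,3)] ker by simp
    then show ?thesis using orthogonal_comp_trivial_Int[of "x - x'" Y] that subY by (simp add: subspace_diff)
  qed
  obtain f where f: "\<And>h. (f h, h) \<in> adjoint_op D" "\<And>h. f h \<in> Y" using ex by metis
  have "bounded_linear f"
  proof (rule bounded_linear_intro)
    show "f (x + y) = f x + f y" for x y
      by (rule uni[of _ "x + y"]) (use f subY subspace_add[OF subE f(1)[of x] f(1)[of y]] in \<open>auto simp: subspace_add\<close>)
    show "f (c *\<^sub>R x) = c *\<^sub>R f x" for c x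
      by (rule uni[of _ "c *\<^sub>R x"]) (use f subY subspace_scale[OF subE f(1)[of x], of c] in \<open>auto simp: subspace_scale\<close>)
    show "norm (f h) \<le> norm h * C" for h
    proof -
      obtain v where v: "(v, f h) \<in> D" using f(2) by (auto simp: Y_def)
      have "inner (f h) (f h) = inner v h" using f(1)[of h] v by (auto simp: adj)
      also have "\<dots> \<le> norm v * norm h" by (rule norm_cauchy_schwarz)
      also have "\<dots> \<le> (C * norm (f h)) * norm h" using C(2)[OF v] by (rule mult_right_mono) simp
      finally have "norm (f h) * norm (f h) \<le> norm (f h) * (norm h * C)"
        by (simp add: dot_square_norm power2_eq_square mult_ac)
      then show ?thesis using C(1)
        by (cases "f h = 0") (auto simp: mult_le_cancel_left)
    qed
  qed
  then have "blinfun_apply (Blinfun f) = f" by (rule bounded_linear_Blinfun_apply)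
  then show ?thesis using f(1) by metis
qed


section \<open>Continuously differentiable paths of bounded operators\<close>

lemma has_vector_derivative_iff_quotient:
  "(f has_vector_derivative D) (at t within I) \<longleftrightarrow>
    ((\<lambda>s. (f s - f t) /\<^sub>R (s - t)) \<longlongrightarrow> D) (at t within I)"
proof -
  have *: "norm (f s - f t - (s - t) *\<^sub>R D) / norm (s - t) = norm ((f s - f t) /\<^sub>R (s - t) - D)"
    if "s \<noteq> t" for s
  proof -
    have "(f s - f t) /\<^sub>R (s - t) - D = (f s - f t - (s - t) *\<^sub>R D) /\<^sub>R (s - t)"
      using that by (simp add: scaleR_diff_right)
    then show ?thesis by (simp add: divide_inverse_commute)
  qed
  have "(f has_vector_derivative D) (at t within I) \<longleftrightarrow>
    ((\<lambda>s. norm (f s - f t - (s - t) *\<^sub>R D) / norm (s - t)) \<longlongrightarrow> 0) (at t within I)"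
    by (simp add: has_vector_derivative_def has_derivative_iff_norm bounded_linear_scaleR_left)
  also have "\<dots> \<longleftrightarrow> ((\<lambda>s. norm ((f s - f t) /\<^sub>R (s - t) - D)) \<longlongrightarrow> 0) (at t within I)"
    by (rule Lim_cong_within) (use * in auto)
  also have "\<dots> \<longleftrightarrow> ((\<lambda>s. (f s - f t) /\<^sub>R (s - t)) \<longlongrightarrow> D) (at t within I)"
    by (simp add: tendsto_norm_zero_iff LIM_zero_iff)
  finally show ?thesis .
qed

lemma C1_on_subset: "C1_on f I \<Longrightarrow> J \<subseteq> I \<Longrightarrow> C1_on f J"
  unfolding C1_on_def by (meson continuous_on_subset has_vector_derivative_within_subset subsetD)

lemma C1_on_const: "C1_on (\<lambda>s. c) I"
  unfolding C1_on_def by (auto intro!: exI[of _ "\<lambda>s. 0"])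

lemma C1_onE:
  assumes "C1_on f I"
  obtains f' where "\<And>t. t \<in> I \<Longrightarrow> (f has_vector_derivative f' t) (at t within I)" "continuous_on I f'"
  using assms unfolding C1_on_def by blast

lemma C1_onI:
  assumes "\<And>t. t \<in> I \<Longrightarrow> (f has_vector_derivative f' t) (at t within I)" "continuous_on I f'"
  shows "C1_on f I"
  using assms unfolding C1_on_def by blast

lemma C1_on_add:
  assumes "C1_on f I" "C1_on g I" shows "C1_on (\<lambda>s. f s + g s) I"
proof -
  obtain f' and g' where f: "\<And>t. t \<in> I \<Longrightarrow> (f has_vector_derivative f' t) (at t within I)" "continuous_on I f'"
    and g: "\<And>t. t \<in> I \<Longrightarrow> (g has_vector_derivative g' t) (at t within I)" "continuous_on I g'"
    using assms by (metis C1_onE)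
  show ?thesis
    by (rule C1_onI[of _ _ "\<lambda>t. f' t + g' t"])
      (use f g in \<open>auto intro: has_vector_derivative_add continuous_on_add\<close>)
qed

lemma C1_on_diff:
  assumes "C1_on f I" "C1_on g I" shows "C1_on (\<lambda>s. f s - g s) I"
proof -
  obtain f' and g' where f: "\<And>t. t \<in> I \<Longrightarrow> (f has_vector_derivative f' t) (at t within I)" "continuous_on I f'"
    and g: "\<And>t. t \<in> I \<Longrightarrow> (g has_vector_derivative g' t) (at t within I)" "continuous_on I g'"
    using assms by (metis C1_onE)
  show ?thesis
    by (rule C1_onI[of _ _ "\<lambda>t. f' t - g' t"])
      (use f g in \<open>auto intro: has_vector_derivative_diff continuous_on_diff\<close>)
qed

lemma C1_on_imp_continuous_on: "C1_on f I \<Longrightarrow> continuous_on I f"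
  unfolding C1_on_def by (meson continuous_on_vector_derivative)

lemma C1_on_blinfun_compose:
  assumes "C1_on X I" "C1_on Y I"
  shows "C1_on (\<lambda>s. X s o\<^sub>L Y s) I"
proof -
  obtain X' and Y' where X: "\<And>t. t \<in> I \<Longrightarrow> (X has_vector_derivative X' t) (at t within I)" "continuous_on I X'"
    and Y: "\<And>t. t \<in> I \<Longrightarrow> (Y has_vector_derivative Y' t) (at t within I)" "continuous_on I Y'"
    using assms unfolding C1_on_def by blast
  have "((\<lambda>s. X s o\<^sub>L Y s) has_vector_derivative ((X t o\<^sub>L Y' t) + (X' t o\<^sub>L Y t))) (at t within I)"
    if "t \<in> I" for t
    using bounded_bilinear.has_vector_derivative[OF bounded_bilinear_blinfun_compose X(1)[OF that] Y(1)[OF that]] .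
  moreover have "continuous_on I (\<lambda>t. (X t o\<^sub>L Y' t) + (X' t o\<^sub>L Y t))"
    using X(2) Y(2) assms[THEN C1_on_imp_continuous_on]
    by (intro continuous_on_add bounded_bilinear.continuous_on[OF bounded_bilinear_blinfun_compose])
  ultimately show ?thesis by (rule C1_onI)
qed

lemma C2_on_imp_C1_on: "C2_on f I \<Longrightarrow> C1_on f I"
  unfolding C2_on_def using C1_on_imp_continuous_on unfolding C1_on_def[of f] by blast

text \<open>Solving \<open>X x = y\<close> is finding a fixed point of the contraction \<open>x \<mapsto> y + x - X x\<close>.\<close>

lemma blinfun_inverse_near_id:
  fixes X :: "'a::{real_normed_vector,complete_space} \<Rightarrow>\<^sub>L 'a"
  assumes X: "norm (X - id_blinfun) \<le> 1 / 2"
  shows "\<exists>Y. X o\<^sub>L Y = id_blinfun \<and> Y o\<^sub>L X = id_blinfun \<and> norm Y \<le> 2"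
proof -
  have half: "norm (X x - x) \<le> 1 / 2 * norm x" for x
    using norm_blinfun[of "X - id_blinfun" x] mult_right_mono[OF X norm_ge_zero[of x]]
    by (simp add: blinfun.diff_left)
  have "\<exists>!x. X x = y" for y
  proof -
    have "dist (y + x - X x) (y + x' - X x') \<le> 1 / 2 * dist x x'" for x x'
    proof -
      have "dist (y + x - X x) (y + x' - X x') = norm (X (x - x') - (x - x'))"
        by (simp add: dist_norm blinfun.diff_right norm_minus_commute algebra_simps)
      then show ?thesis using half[of "x - x'"] by (simp add: dist_norm)
    qed
    then have "\<exists>!x. y + x - X x = x" by (intro banach_fix_type[of "1/2"]) auto
    moreover have "y + x - X x = x \<longleftrightarrow> X x = y" for x by (auto simp: algebra_simps)
    ultimately show ?thesis by simp
  qed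
  then obtain f where f: "\<And>y. X (f y) = y" and uni: "\<And>x y. X x = y \<Longrightarrow> x = f y" by metis
  have bnd: "norm (f y) \<le> 2 * norm y" for y
  proof -
    have "norm (f y) \<le> norm (X (f y)) + norm (X (f y) - f y)"
      using norm_triangle_sub[of "f y" "X (f y)"] by (simp add: norm_minus_commute)
    then show ?thesis using half[of "f y"] f by simp
  qed
  have "bounded_linear f"
    by (rule bounded_linear_intro[of _ 2])
      (auto intro!: uni[symmetric] simp: blinfun.add_right blinfun.scaleR_right f bnd[unfolded mult.commute[of 2]])
  then have Y: "blinfun_apply (Blinfun f) = f" by (rule bounded_linear_Blinfun_apply)
  show ?thesis
  proof (intro exI[of _ "Blinfun f"] conjI blinfun_eqI)
    show "norm (Blinfun f) \<le> 2" by (rule norm_blinfun_bound) (auto simp: Y bnd)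
  qed (use f uni in \<open>auto simp: Y\<close>)
qed

text \<open>From \<open>Y\<^sub>s - Y\<^sub>t = Y\<^sub>s (X\<^sub>t - X\<^sub>s) Y\<^sub>t\<close> for \<open>Y = X\<^sup>-\<^sup>1\<close> one reads off first the continuity of
  \<open>Y\<close> and then \<open>Y' = - Y X' Y\<close>.\<close>

lemma C1_on_blinfun_inverse:
  fixes X :: "real \<Rightarrow> 'a::{real_normed_vector,complete_space} \<Rightarrow>\<^sub>L 'a"
  assumes X: "C1_on X (ball s\<^sub>0 \<epsilon>)" "0 < \<epsilon>" "X s\<^sub>0 = id_blinfun"
  shows "\<exists>\<delta> Y. 0 < \<delta> \<and> \<delta> \<le> \<epsilon> \<and> C1_on Y (ball s\<^sub>0 \<delta>) \<and>
    (\<forall>s\<in>ball s\<^sub>0 \<delta>. X s o\<^sub>L Y s = id_blinfun \<and> Y s o\<^sub>L X s = id_blinfun)"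
proof -
  have "continuous_on (ball s\<^sub>0 \<epsilon>) X" using X(1) by (rule C1_on_imp_continuous_on)
  then have "(X \<longlongrightarrow> X s\<^sub>0) (at s\<^sub>0)"
    using X(2) by (auto simp: continuous_on_eq_continuous_at continuous_at)
  then have "\<forall>\<^sub>F s in at s\<^sub>0. dist (X s) (X s\<^sub>0) < 1 / 2" by (rule tendstoD) simp
  then obtain d where d: "0 < d" "\<And>s. s \<noteq> s\<^sub>0 \<Longrightarrow> dist s s\<^sub>0 < d \<Longrightarrow> dist (X s) (X s\<^sub>0) < 1 / 2"
    by (auto simp: eventually_at)
  define \<delta> where "\<delta> = min d \<epsilon>"
  let ?B = "ball s\<^sub>0 \<delta>"
  have \<delta>: "0 < \<delta>" "\<delta> \<le> \<epsilon>" using d X(2) by (auto simp: \<delta>_def)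
  have "norm (X s - id_blinfun) \<le> 1 / 2" if "s \<in> ?B" for s
    using d(2)[of s] that X(3)
    by (cases "s = s\<^sub>0") (auto simp: \<delta>_def dist_norm abs_minus_commute)
  then have "\<forall>s\<in>?B. \<exists>Y. X s o\<^sub>L Y = id_blinfun \<and> Y o\<^sub>L X s = id_blinfun \<and> norm Y \<le> 2"
    using blinfun_inverse_near_id by blast
  then obtain Y where Y: "\<And>s. s \<in> ?B \<Longrightarrow> X s o\<^sub>L Y s = id_blinfun"
      "\<And>s. s \<in> ?B \<Longrightarrow> Y s o\<^sub>L X s = id_blinfun" and Y2: "\<And>s. s \<in> ?B \<Longrightarrow> norm (Y s) \<le> 2"
    by metis
  have C1: "C1_on X ?B" using X(1) by (rule C1_on_subset) (use \<delta> in auto)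
  then obtain X' where X': "\<And>t. t \<in> ?B \<Longrightarrow> (X has_vector_derivative X' t) (at t within ?B)"
      and cX': "continuous_on ?B X'"
    unfolding C1_on_def by blast
  have cX: "continuous_on ?B X" using C1 by (rule C1_on_imp_continuous_on)
  have diff: "Y s - Y t = - (Y s o\<^sub>L (X s - X t) o\<^sub>L Y t)" if "s \<in> ?B" "t \<in> ?B" for s t
  proof (rule blinfun_eqI)
    fix y
    have "Y s (X s z) = z" "X t (Y t y) = y" for z
      using Y that by (metis blinfun_apply_blinfun_compose blinfun_apply_id_blinfun)+
    then show "blinfun_apply (Y s - Y t) y = blinfun_apply (- (Y s o\<^sub>L (X s - X t) o\<^sub>L Y t)) y"
      by (simp add: blinfun.diff_left blinfun.minus_left blinfun.diff_right)
  qed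
  have cY: "continuous_on ?B Y"
    unfolding continuous_on_def
  proof
    fix t assume t: "t \<in> ?B"
    have "((\<lambda>s. Y s - Y t) \<longlongrightarrow> 0) (at t within ?B)"
    proof (rule Lim_null_comparison)
      show "\<forall>\<^sub>F s in at t within ?B. norm (Y s - Y t) \<le> 4 * norm (X s - X t)"
        unfolding eventually_at_filter
      proof (intro always_eventually allI impI)
        fix s assume s: "s \<in> ?B"
        have "norm (Y s - Y t) \<le> norm (Y s) * norm (X s - X t) * norm (Y t)"
          unfolding diff[OF s t] norm_minus_cancel
          by (rule order_trans[OF norm_blinfun_compose mult_right_mono[OF norm_blinfun_compose]]) simp
        also have "\<dots> \<le> 2 * norm (X s - X t) * 2"
          using Y2 s t by (intro mult_mono mult_right_mono) auto
        finally show "norm (Y s - Y t) \<le> 4 * norm (X s - X t)" by simp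
      qed
      have "((\<lambda>s. norm (X s - X t)) \<longlongrightarrow> 0) (at t within ?B)"
        using cX t by (simp add: continuous_on_def tendsto_norm_zero_iff LIM_zero_iff)
      then show "((\<lambda>s. 4 * norm (X s - X t)) \<longlongrightarrow> 0) (at t within ?B)"
        by (rule tendsto_mult_right_zero)
    qed
    then show "(Y \<longlongrightarrow> Y t) (at t within ?B)" by (simp add: LIM_zero_iff)
  qed
  have "(Y has_vector_derivative - (Y t o\<^sub>L X' t o\<^sub>L Y t)) (at t within ?B)" if t: "t \<in> ?B" for t
    unfolding has_vector_derivative_iff_quotient
  proof (rule Lim_transform_within[where d = 1])
    show "((\<lambda>s. - (Y s o\<^sub>L ((X s - X t) /\<^sub>R (s - t)) o\<^sub>L Y t)) \<longlongrightarrow> - (Y t o\<^sub>L X' t o\<^sub>L Y t)) (at t within ?B)"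
      using X'[OF t] cY t unfolding has_vector_derivative_iff_quotient continuous_on_def
      by (intro tendsto_minus bounded_bilinear.tendsto[OF bounded_bilinear_blinfun_compose] tendsto_const) auto
    show "- (Y s o\<^sub>L ((X s - X t) /\<^sub>R (s - t)) o\<^sub>L Y t) = (Y s - Y t) /\<^sub>R (s - t)" if "s \<in> ?B" for s
      unfolding diff[OF that t] by (rule blinfun_eqI) (simp add: blinfun.bilinear_simps)
  qed simp
  moreover have "continuous_on ?B (\<lambda>t. - (Y t o\<^sub>L X' t o\<^sub>L Y t))"
    using cY cX' by (intro continuous_on_minus bounded_bilinear.continuous_on[OF bounded_bilinear_blinfun_compose])
  ultimately have "C1_on Y ?B" by (rule C1_onI)
  then show ?thesis using Y \<delta> by blast
qed


section \<open>Families of operators with their own norm\<close>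

lemma scaleC_scaleR: "c *\<^sub>C (r *\<^sub>R x) = r *\<^sub>R (c *\<^sub>C (x::'a::complex_inner))"
  by (simp add: scaleR_scaleC scaleC_scaleC mult.commute)

lemma norm_scaleC: "norm (c *\<^sub>C (x::'a::complex_inner)) = cmod c * norm x"
proof -
  have "cinner x x = complex_of_real ((norm x)\<^sup>2)"
    using cinner_commute[of x x]
    by (simp add: complex_eq_iff flip: inner_eq_Re_cinner) (simp add: power2_norm_eq_inner)
  then have "(norm (c *\<^sub>C x))\<^sup>2 = (cmod c * norm x)\<^sup>2"
    by (simp add: power2_norm_eq_inner[of "c *\<^sub>C x"] inner_eq_Re_cinner cinner_scaleC_left cinner_scaleC_right
        mult.assoc[symmetric] complex_norm_square[symmetric] power_mult_distrib cmod_power2 flip: power2_eq_square del: of_real_power)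
  then show ?thesis by (simp add: power2_eq_iff_nonneg)
qed

lemma bounded_linear_scaleC: "bounded_linear (\<lambda>x::'a::complex_inner. c *\<^sub>C x)"
  by (rule bounded_linear_intro[of _ "cmod c"])
    (auto simp: scaleC_add_right scaleC_scaleR norm_scaleC mult.commute)

lemma bounded_clinear_on_diff:
  assumes "bounded_clinear_on S \<nu> f" "bounded_clinear_on S \<nu> g"
  shows "bounded_clinear_on S \<nu> (\<lambda>x. f x - g x)"
proof -
  obtain K L where KL: "\<forall>x\<in>S. norm (f x) \<le> K * \<nu> x" "\<forall>x\<in>S. norm (g x) \<le> L * \<nu> x"
    using assms unfolding bounded_clinear_on_def by blast
  have "norm (f x - g x) \<le> (K + L) * \<nu> x" if "x \<in> S" for x
    using KL that norm_triangle_ineq4[of "f x" "g x"] by (fastforce simp: distrib_right)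
  then show ?thesis using assms unfolding bounded_clinear_on_def
    by (auto simp: complex_vector.scale_right_diff_distrib)
qed

lemma bounded_clinear_on_scaleR:
  assumes "bounded_clinear_on S \<nu> f"
  shows "bounded_clinear_on S \<nu> (\<lambda>x. r *\<^sub>R f x)"
proof -
  obtain K where K: "\<forall>x\<in>S. norm (f x) \<le> K * \<nu> x"
    using assms unfolding bounded_clinear_on_def by blast
  have "norm (r *\<^sub>R f x) \<le> (\<bar>r\<bar> * K) * \<nu> x" if "x \<in> S" for x
    using mult_left_mono[of "norm (f x)" "K * \<nu> x" "\<bar>r\<bar>"] K that by (simp add: mult.assoc)
  then show ?thesis using assms unfolding bounded_clinear_on_def
    by (auto simp: scaleC_scaleR scaleR_add_right)
qed

lemma bounded_clinear_on_scaleR_arg: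
  "bounded_clinear_on S \<nu> f \<Longrightarrow> x \<in> S \<Longrightarrow> f (r *\<^sub>R x) = r *\<^sub>R f x"
  by (simp add: bounded_clinear_on_def scaleR_scaleC)

text \<open>A linear map \<open>\<iota>\<close> into \<open>S\<close> that is contractive for \<open>\<nu>\<close> allows to pull \<open>f\<close> back to \<open>f \<circ> \<iota>\<close>. This turns
  regularity with respect to the operator norm on \<open>S\<close> into regularity of a path in a normed space of
  bounded operators.\<close>

context
  fixes S :: "'a::complex_inner set" and \<nu> :: "'a \<Rightarrow> real"
    and \<iota> :: "'c::real_normed_vector \<Rightarrow> 'a"
  assumes \<iota>: "linear \<iota>" "\<And>c. \<iota> c \<in> S" "\<And>c. \<nu> (\<iota> c) \<le> norm c" and \<nu>: "\<And>x. 0 \<le> \<nu> x"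
begin

lemma bounded_linear_lift:
  assumes "bounded_clinear_on S \<nu> f" shows "bounded_linear (f \<circ> \<iota>)"
proof -
  obtain K where K: "\<forall>x\<in>S. norm (f x) \<le> K * \<nu> x"
    using assms unfolding bounded_clinear_on_def by blast
  have "norm (f (\<iota> c)) \<le> norm c * \<bar>K\<bar>" for c
  proof -
    have "norm (f (\<iota> c)) \<le> K * \<nu> (\<iota> c)" using K \<iota>(2) by blast
    also have "\<dots> \<le> \<bar>K\<bar> * norm c" using \<iota>(3) \<nu> by (intro mult_mono) auto
    finally show ?thesis by (simp add: mult.commute)
  qed
  moreover have "f (\<iota> (x + y)) = f (\<iota> x) + f (\<iota> y)" for x y
    using assms \<iota>(2) by (simp add: linear_add[OF \<iota>(1)] bounded_clinear_on_def)
  moreover have "f (\<iota> (r *\<^sub>R x)) = r *\<^sub>R f (\<iota> x)" for r x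
    using bounded_clinear_on_scaleR_arg[OF assms] \<iota>(2) by (simp add: linear_scale[OF \<iota>(1)])
  ultimately show ?thesis by (intro bounded_linear_intro[of _ "\<bar>K\<bar>"]) auto
qed

lemma norm_lift_le:
  assumes f: "bounded_clinear_on S \<nu> f"
  shows "norm (Blinfun (f \<circ> \<iota>)) \<le> norm_on S \<nu> f"
proof -
  have app: "blinfun_apply (Blinfun (f \<circ> \<iota>)) = f \<circ> \<iota>"
    using bounded_linear_lift[OF f] by (rule bounded_linear_Blinfun_apply)
  obtain K where K: "\<forall>x\<in>S. norm (f x) \<le> K * \<nu> x"
    using f unfolding bounded_clinear_on_def by blast
  have le: "norm (f x) \<le> norm_on S \<nu> f" if "x \<in> S" "\<nu> x \<le> 1" for x
    unfolding norm_on_def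
  proof (rule cSUP_upper)
    show "bdd_above ((\<lambda>x. norm (f x)) ` {x \<in> S. \<nu> x \<le> 1})"
    proof (rule bdd_aboveI2)
      fix x assume x: "x \<in> {x \<in> S. \<nu> x \<le> 1}"
      then have "norm (f x) \<le> K * \<nu> x" using K by blast
      also have "\<dots> \<le> \<bar>K\<bar> * 1" using x \<nu> by (intro mult_mono) auto
      finally show "norm (f x) \<le> \<bar>K\<bar>" by simp
    qed
  qed (use that in auto)
  have "\<nu> (\<iota> 0) \<le> 0" using \<iota>(3)[of 0] by simp
  then have "0 \<le> norm_on S \<nu> f" using order_trans[OF norm_ge_zero le[of "\<iota> 0"]] \<iota>(2) by simp
  then show ?thesis
  proof (rule norm_blinfun_bound)
    fix c
    show "norm (blinfun_apply (Blinfun (f \<circ> \<iota>)) c) \<le> norm_on S \<nu> f * norm c"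
    proof (cases "c = 0")
      case False
      have "\<nu> (\<iota> (inverse (norm c) *\<^sub>R c)) \<le> 1" using \<iota>(3)[of "inverse (norm c) *\<^sub>R c"] False by simp
      then have "norm (f (\<iota> (inverse (norm c) *\<^sub>R c))) \<le> norm_on S \<nu> f" using le \<iota>(2) by blast
      moreover have "f (\<iota> (inverse (norm c) *\<^sub>R c)) = inverse (norm c) *\<^sub>R f (\<iota> c)"
        using bounded_clinear_on_scaleR_arg[OF f] \<iota>(2) by (simp add: linear_scale[OF \<iota>(1)])
      ultimately show ?thesis using False by (simp add: app field_simps)
    qed simp
  qed
qed

lemma has_vector_derivative_lift:
  assumes F: "has_op_derivative S \<nu> F D t I" and t: "t \<in> I"
  shows "((\<lambda>s. Blinfun (F s \<circ> \<iota>)) has_vector_derivative Blinfun (D \<circ> \<iota>)) (at t within I)"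
proof -
  note F' = F[unfolded has_op_derivative_def]
  have app: "blinfun_apply (Blinfun (f \<circ> \<iota>)) = f \<circ> \<iota>" if "bounded_clinear_on S \<nu> f" for f :: "'a \<Rightarrow> 'b"
    using bounded_linear_lift[OF that] by (rule bounded_linear_Blinfun_apply)
  let ?g = "\<lambda>s x. (F s x - F t x) /\<^sub>R (s - t) - D x"
  have g: "bounded_clinear_on S \<nu> (?g s)" if "s \<in> I" for s
    using F' that t by (intro bounded_clinear_on_diff bounded_clinear_on_scaleR) auto
  have "((\<lambda>s. (Blinfun (F s \<circ> \<iota>) - Blinfun (F t \<circ> \<iota>)) /\<^sub>R (s - t) - Blinfun (D \<circ> \<iota>)) \<longlongrightarrow> 0) (at t within I)"
  proof (rule Lim_null_comparison)
    show "\<forall>\<^sub>F s in at t within I. norm ((Blinfun (F s \<circ> \<iota>) - Blinfun (F t \<circ> \<iota>)) /\<^sub>R (s - t) - Blinfun (D \<circ> \<iota>))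
        \<le> norm_on S \<nu> (?g s)"
      unfolding eventually_at_filter
    proof (intro always_eventually allI impI)
      fix s assume s: "s \<in> I"
      have "(Blinfun (F s \<circ> \<iota>) - Blinfun (F t \<circ> \<iota>)) /\<^sub>R (s - t) - Blinfun (D \<circ> \<iota>) = Blinfun (?g s \<circ> \<iota>)"
        by (rule blinfun_eqI)
          (use F' s t g[OF s] in \<open>simp add: app blinfun.diff_left blinfun.scaleR_left\<close>)
      then show "norm ((Blinfun (F s \<circ> \<iota>) - Blinfun (F t \<circ> \<iota>)) /\<^sub>R (s - t) - Blinfun (D \<circ> \<iota>))
          \<le> norm_on S \<nu> (?g s)"
        using norm_lift_le[OF g[OF s]] by simp
    qed
  qed (use F' in blast)
  then show ?thesis by (simp add: has_vector_derivative_iff_quotient LIM_zero_iff)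
qed

lemma continuous_on_lift:
  assumes F: "op_continuous_on S \<nu> F I"
  shows "continuous_on I (\<lambda>s. Blinfun (F s \<circ> \<iota>))"
  unfolding continuous_on_def
proof
  fix t assume t: "t \<in> I"
  note F' = F[unfolded op_continuous_on_def]
  have app: "blinfun_apply (Blinfun (f \<circ> \<iota>)) = f \<circ> \<iota>" if "bounded_clinear_on S \<nu> f" for f :: "'a \<Rightarrow> 'b"
    using bounded_linear_lift[OF that] by (rule bounded_linear_Blinfun_apply)
  have g: "bounded_clinear_on S \<nu> (\<lambda>x. F s x - F t x)" if "s \<in> I" for s
    using F' that t by (intro bounded_clinear_on_diff) auto
  have "((\<lambda>s. Blinfun (F s \<circ> \<iota>) - Blinfun (F t \<circ> \<iota>)) \<longlongrightarrow> 0) (at t within I)"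
  proof (rule Lim_null_comparison)
    show "\<forall>\<^sub>F s in at t within I. norm (Blinfun (F s \<circ> \<iota>) - Blinfun (F t \<circ> \<iota>)) \<le> norm_on S \<nu> (\<lambda>x. F s x - F t x)"
      unfolding eventually_at_filter
    proof (intro always_eventually allI impI)
      fix s assume s: "s \<in> I"
      have "Blinfun (F s \<circ> \<iota>) - Blinfun (F t \<circ> \<iota>) = Blinfun ((\<lambda>x. F s x - F t x) \<circ> \<iota>)"
        by (rule blinfun_eqI) (use F' s t g[OF s] in \<open>simp add: app blinfun.diff_left\<close>)
      then show "norm (Blinfun (F s \<circ> \<iota>) - Blinfun (F t \<circ> \<iota>)) \<le> norm_on S \<nu> (\<lambda>x. F s x - F t x)"
        using norm_lift_le[OF g[OF s]] by simp
    qed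
  qed (use F' t in blast)
  then show "((\<lambda>s. Blinfun (F s \<circ> \<iota>)) \<longlongrightarrow> Blinfun (F t \<circ> \<iota>)) (at t within I)"
    by (simp add: LIM_zero_iff)
qed

lemma C1_on_lift:
  assumes "op_C1_on S \<nu> F I"
  shows "C1_on (\<lambda>s. Blinfun (F s \<circ> \<iota>)) I"
proof -
  obtain F' where F': "\<And>t. t \<in> I \<Longrightarrow> has_op_derivative S \<nu> F (F' t) t I" "op_continuous_on S \<nu> F' I"
    using assms unfolding op_C1_on_def by blast
  show ?thesis
    by (rule C1_onI[OF has_vector_derivative_lift[OF F'(1)] continuous_on_lift[OF F'(2)]])
qed

end

lemma norm_on_norm_le:
  assumes "0 \<in> S"
  shows "0 \<le> norm_on S norm (blinfun_apply f)" "norm_on S norm (blinfun_apply f) \<le> norm f"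
proof -
  have le: "norm (blinfun_apply f x) \<le> norm f" if "norm x \<le> 1" for x
    using order_trans[OF norm_blinfun mult_left_mono[OF that norm_ge_zero]] by simp
  show "norm_on S norm (blinfun_apply f) \<le> norm f"
    unfolding norm_on_def by (rule cSUP_least) (use assms le in auto)
  have "norm (blinfun_apply f 0) \<le> norm_on S norm (blinfun_apply f)"
    unfolding norm_on_def by (rule cSUP_upper) (use assms le in \<open>auto intro!: bdd_aboveI2\<close>)
  then show "0 \<le> norm_on S norm (blinfun_apply f)" by simp
qed

text \<open>In the converse direction, a \<open>C\<^sup>1\<close> path of bounded real-linear operators that are
  complex-linear on \<open>S\<close> has derivatives that are complex-linear on \<open>S\<close>, being limits of such.\<close>

lemma op_C1_on_blinfun:
  fixes M :: "real \<Rightarrow> 'a::complex_inner \<Rightarrow>\<^sub>L 'b::complex_inner"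
  assumes M: "C1_on M I" and I: "open I" and S: "complex_vector.subspace S"
    and lin: "\<And>s c x. s \<in> I \<Longrightarrow> x \<in> S \<Longrightarrow> M s (c *\<^sub>C x) = c *\<^sub>C M s x"
  shows "op_C1_on S norm (\<lambda>s. blinfun_apply (M s)) I"
proof -
  obtain M' where M': "\<And>t. t \<in> I \<Longrightarrow> (M has_vector_derivative M' t) (at t within I)" "continuous_on I M'"
    using M unfolding C1_on_def by blast
  have S0: "0 \<in> S" using S by (rule complex_vector.subspace_0)
  have lin': "M' t (c *\<^sub>C x) = c *\<^sub>C M' t x" if t: "t \<in> I" and x: "x \<in> S" for t c x
  proof -
    have d: "((\<lambda>s. M s y) has_vector_derivative M' t y) (at t)" for y
      using bounded_linear.has_vector_derivative[OF blinfun.bounded_linear_left M'(1)[OF t]]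
      by (simp add: at_within_open[OF t I])
    have "((\<lambda>s. c *\<^sub>C M s x) has_vector_derivative c *\<^sub>C M' t x) (at t)"
      using bounded_linear.has_vector_derivative[OF bounded_linear_scaleC d] .
    then have "((\<lambda>s. M s (c *\<^sub>C x)) has_vector_derivative c *\<^sub>C M' t x) (at t)"
      by (rule has_vector_derivative_transform_within_open[OF _ I t]) (simp add: lin x)
    then show ?thesis using d vector_derivative_unique_at by blast
  qed
  have bc: "bounded_clinear_on S norm (blinfun_apply f)" if "\<And>c x. x \<in> S \<Longrightarrow> f (c *\<^sub>C x) = c *\<^sub>C f x"
    for f :: "'a \<Rightarrow>\<^sub>L 'b"
    using that norm_blinfun[of f] by (auto simp: bounded_clinear_on_def blinfun.add_right)
  have null: "((\<lambda>s. norm_on S norm (blinfun_apply (f s))) \<longlongrightarrow> 0) G" if "(f \<longlongrightarrow> 0) G"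
    for f :: "real \<Rightarrow> 'a \<Rightarrow>\<^sub>L 'b" and G
    by (rule Lim_null_comparison[OF _ tendsto_norm_zero[OF that]])
      (simp add: abs_of_nonneg norm_on_norm_le[OF S0])
  have "has_op_derivative S norm (\<lambda>s. blinfun_apply (M s)) (blinfun_apply (M' t)) t I" if t: "t \<in> I" for t
  proof -
    have "((\<lambda>s. norm_on S norm (blinfun_apply ((M s - M t) /\<^sub>R (s - t) - M' t))) \<longlongrightarrow> 0) (at t within I)"
      by (rule null) (use M'(1)[OF t] in \<open>simp add: has_vector_derivative_iff_quotient LIM_zero_iff\<close>)
    moreover have "blinfun_apply ((M s - M t) /\<^sub>R (s - t) - M' t) =
        (\<lambda>x. (M s x - M t x) /\<^sub>R (s - t) - M' t x)" for s
      by (simp add: fun_eq_iff blinfun.bilinear_simps)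
    ultimately show ?thesis
      using lin lin' t unfolding has_op_derivative_def by (auto intro!: bc)
  qed
  moreover have "op_continuous_on S norm (\<lambda>s. blinfun_apply (M' s)) I"
    unfolding op_continuous_on_def
  proof (intro conjI ballI)
    fix t assume t: "t \<in> I"
    show "bounded_clinear_on S norm (blinfun_apply (M' t))" using lin' t by (auto intro: bc)
    have "((\<lambda>s. norm_on S norm (blinfun_apply (M' s - M' t))) \<longlongrightarrow> 0) (at t within I)"
      by (rule null) (use M'(2) t in \<open>simp add: continuous_on_def LIM_zero_iff\<close>)
    moreover have "blinfun_apply (M' s - M' t) = (\<lambda>x. M' s x - M' t x)" for s
      by (simp add: fun_eq_iff blinfun.diff_left)
    ultimately show "((\<lambda>s. norm_on S norm (\<lambda>x. M' s x - M' t x)) \<longlongrightarrow> 0) (at t within I)"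
      by simp
  qed
  ultimately show ?thesis unfolding op_C1_on_def by (intro exI[of _ "\<lambda>t. blinfun_apply (M' t)"]) auto
qed


section \<open>Graph representation and crossing forms of parametrized paths\<close>

lemma graph_decomposition_unique:
  assumes "subspace U" "q \<in> U" "q' \<in> U" "m \<in> orthogonal_comp U" "m' \<in> orthogonal_comp U" "q + m = q' + m'"
  shows "q = q'" "m = m'"
proof -
  have "q - q' \<in> U" using assms by (simp add: subspace_diff)
  moreover have "q - q' = m' - m" using assms(6) by (simp add: algebra_simps)
  then have "q - q' \<in> orthogonal_comp U" using assms subspace_diff[OF subspace_orthogonal_comp] by metis
  ultimately have "q - q' = 0" by (rule orthogonal_comp_trivial_Int)
  then show "q = q'" by simp
  then show "m = m'" using assms(6) by simp
qed

text \<open>If \<open>B\<^sub>s\<close> maps \<open>U\<close> onto \<open>\<Upsilon>\<^sub>s\<close>, then near \<open>s\<^sub>0\<close> the operator \<open>\<Pi> B\<^sub>s\<close>, with \<open>\<Pi>\<close> the orthogonal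
  projection onto \<open>U\<close>, is invertible on \<open>U\<close>, and \<open>M\<^sub>s = (1 - \<Pi>) B\<^sub>s (\<Pi> B\<^sub>s)\<^sup>-\<^sup>1\<close>. Extending \<open>\<Pi> B\<^sub>s\<close>
  by the identity on the orthogonal complement allows to invert on the whole space. The
  derivative of \<open>M\<^sub>s q\<close> and that of \<open>B\<^sub>s q\<close> differ by an element of \<open>U\<close> only.\<close>

lemma C1_graph_of_parametrization:
  fixes B :: "real \<Rightarrow> 'a::{real_inner,complete_space} \<Rightarrow>\<^sub>L 'a"
  assumes U: "subspace U" "closed U" and \<epsilon>: "0 < \<epsilon>" and B: "C1_on B (ball s\<^sub>0 \<epsilon>)"
    and B': "(B has_vector_derivative B') (at s\<^sub>0)"
    and id: "\<And>q. q \<in> U \<Longrightarrow> B s\<^sub>0 q = q"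
  obtains \<delta> and M :: "real \<Rightarrow> 'a \<Rightarrow>\<^sub>L 'a" where "0 < \<delta>" "\<delta> \<le> \<epsilon>" "C1_on M (ball s\<^sub>0 \<delta>)"
    "\<And>s q. M s q \<in> orthogonal_comp U"
    "\<And>s. s \<in> ball s\<^sub>0 \<delta> \<Longrightarrow> blinfun_apply (B s) ` U = {q + M s q | q. q \<in> U}"
    "\<And>q. q \<in> U \<Longrightarrow> M s\<^sub>0 q = 0"
    "\<And>q. q \<in> U \<Longrightarrow>
      \<exists>p\<in>U. ((\<lambda>s. M s q) has_vector_derivative B' q - p) (at s\<^sub>0)"
proof -
  define Pr where "Pr = proj_onto U"
  note Pr_mem = proj_onto_mem[OF U, folded Pr_def]
  note Pr_diff = proj_onto_diff[OF U, folded Pr_def]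
  note Pr_id = proj_onto_ident[OF U, folded Pr_def]
  define X where "X s = id_blinfun - Pr + (Pr o\<^sub>L B s o\<^sub>L Pr)" for s
  have X_apply: "X s x = x - Pr x + Pr (B s (Pr x))" for s x
    by (simp add: X_def blinfun.bilinear_simps)
  have "C1_on X (ball s\<^sub>0 \<epsilon>)"
    unfolding X_def by (intro C1_on_add C1_on_blinfun_compose C1_on_const B)
  moreover have "X s\<^sub>0 = id_blinfun"
    by (rule blinfun_eqI) (simp add: X_apply id Pr_mem Pr_id)
  ultimately obtain \<delta> Y where \<delta>: "0 < \<delta>" "\<delta> \<le> \<epsilon>" and Y: "C1_on Y (ball s\<^sub>0 \<delta>)"
    and inv: "\<And>s. s \<in> ball s\<^sub>0 \<delta> \<Longrightarrow> X s o\<^sub>L Y s = id_blinfun" "\<And>s. s \<in> ball s\<^sub>0 \<delta> \<Longrightarrow> Y s o\<^sub>L X s = id_blinfun"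
    using C1_on_blinfun_inverse[of X, OF _ \<epsilon>] by blast
  have XY: "X s (Y s x) = x" "Y s (X s x) = x" if "s \<in> ball s\<^sub>0 \<delta>" for s x
    using inv(1)[OF that, THEN arg_cong, of "\<lambda>Z. blinfun_apply Z x"]
      inv(2)[OF that, THEN arg_cong, of "\<lambda>Z. blinfun_apply Z x"] by simp_all
  have U_iff: "x \<in> U" if "X s x \<in> U" for s x
  proof -
    have "x - Pr x = X s x - Pr (B s (Pr x))" by (simp add: X_apply)
    then have "x - Pr x \<in> U" using that U(1) Pr_mem by (metis subspace_diff)
    then have "x - Pr x = 0" using Pr_diff orthogonal_comp_trivial_Int by blast
    then show ?thesis using Pr_mem[of x] by simp
  qed
  define M where "M s = (id_blinfun - Pr) o\<^sub>L B s o\<^sub>L Pr o\<^sub>L Y s" for s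
  have M_apply: "M s q = B s (Pr (Y s q)) - Pr (B s (Pr (Y s q)))" for s q
    by (simp add: M_def blinfun.bilinear_simps)
  show ?thesis
  proof
    show "0 < \<delta>" "\<delta> \<le> \<epsilon>" by (fact \<delta>)+
    have B\<delta>: "C1_on B (ball s\<^sub>0 \<delta>)" using B by (rule C1_on_subset) (use \<delta> in auto)
    show "C1_on M (ball s\<^sub>0 \<delta>)"
      unfolding M_def by (intro C1_on_blinfun_compose C1_on_const B\<delta> Y)
    show "M s q \<in> orthogonal_comp U" for s q unfolding M_apply by (rule Pr_diff)
    show "blinfun_apply (B s) ` U = {q + M s q | q. q \<in> U}" if s: "s \<in> ball s\<^sub>0 \<delta>" for s
    proof safe
      fix x assume x: "x \<in> U"
      let ?q = "Pr (B s x)"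
      have "X s x = ?q" using x by (simp add: X_apply Pr_id)
      then have "Y s ?q = x" using XY(2)[OF s, of x] by simp
      then have "B s x = ?q + M s ?q" using x by (simp add: M_apply Pr_id)
      then show "\<exists>q. B s x = q + M s q \<and> q \<in> U" using Pr_mem by blast
    next
      fix q assume q: "q \<in> U"
      have x: "Y s q \<in> U" using U_iff[of s "Y s q"] XY(1)[OF s] q by simp
      have "Pr (B s (Y s q)) = q" using XY(1)[OF s, of q] x by (simp add: X_apply Pr_id)
      then have "q + M s q = B s (Y s q)" using x by (simp add: M_apply Pr_id)
      then show "q + M s q \<in> blinfun_apply (B s) ` U" using x by simp
    qed
    have Y0: "Y s\<^sub>0 q = q" for q
      using XY(1)[of s\<^sub>0 q] \<delta> \<open>X s\<^sub>0 = id_blinfun\<close> by simp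
    show "M s\<^sub>0 q = 0" if "q \<in> U" for q
      using that by (simp add: M_apply Y0 Pr_id id)
    fix q assume q: "q \<in> U"
    obtain Y' where "\<And>t. t \<in> ball s\<^sub>0 \<delta> \<Longrightarrow> (Y has_vector_derivative Y' t) (at t within ball s\<^sub>0 \<delta>)"
      using Y unfolding C1_on_def by blast
    then have Y': "(Y has_vector_derivative Y' s\<^sub>0) (at s\<^sub>0)"
      using at_within_open[of s\<^sub>0 "ball s\<^sub>0 \<delta>"] \<delta>(1) by (metis centre_in_ball open_ball)
    have "((\<lambda>s. M s q) has_vector_derivative
        (id_blinfun - Pr) (B s\<^sub>0 (Pr (Y' s\<^sub>0 q)) + B' (Pr (Y s\<^sub>0 q)))) (at s\<^sub>0)"
      unfolding M_def blinfun_apply_blinfun_compose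
      by (intro bounded_linear.has_vector_derivative[OF blinfun.bounded_linear_right]
          bounded_bilinear.has_vector_derivative[OF bounded_bilinear_blinfun_apply B']
          bounded_linear.has_vector_derivative[OF blinfun.bounded_linear_left Y'])
    also have "(id_blinfun - Pr) (B s\<^sub>0 (Pr (Y' s\<^sub>0 q)) + B' (Pr (Y s\<^sub>0 q))) = B' q - Pr (B' q)"
      using q by (simp add: Y0 Pr_id Pr_mem id blinfun.bilinear_simps)
    finally show "\<exists>p\<in>U. ((\<lambda>s. M s q) has_vector_derivative B' q - p) (at s\<^sub>0)"
      using Pr_mem by blast
  qed
qed

lemma cinner_add_right: "cinner x (y + z) = cinner x y + cinner x (z::'a::complex_inner)"
  by (metis cinner_commute cinner_add_left complex_cnj_add)

lemma bounded_bilinear_cinner: "bounded_bilinear (cinner :: 'a::complex_inner \<Rightarrow> 'a \<Rightarrow> complex)"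
proof
  fix x y :: 'a and r
  show "cinner x (r *\<^sub>R y) = r *\<^sub>R cinner x y" "cinner (r *\<^sub>R x) y = r *\<^sub>R cinner x y"
    by (simp_all add: scaleR_scaleC cinner_scaleC_right cinner_scaleC_left scaleR_conv_of_real)
  have "cmod (cinner x y) \<le> norm x * norm y * 2" for x y :: 'a
  proof -
    have "cmod (cinner x y) \<le> \<bar>inner x y\<bar> + \<bar>inner x (\<i> *\<^sub>C y)\<bar>"
      using cmod_le[of "cinner x y"] by (simp add: cinner_eq_inner)
    also have "\<dots> \<le> norm x * norm y + norm x * norm (\<i> *\<^sub>C y)"
      by (intro add_mono Cauchy_Schwarz_ineq2)
    finally show ?thesis by (simp add: norm_scaleC)
  qed
  then show "\<exists>K. \<forall>x y :: 'a. cmod (cinner x y) \<le> norm x * norm y * K" by blast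
qed (rule cinner_add_left cinner_add_right)+

lemmas bounded_linear_cinner_right = bounded_bilinear.bounded_linear_right[OF bounded_bilinear_cinner]

lemma bounded_linear_symp_Omega2: "bounded_linear (symp_Omega2 f)"
  unfolding symp_Omega2_def symp_Omega_def
  by (intro bounded_linear_sub bounded_linear_compose[OF bounded_linear_cinner_right]
      bounded_linear_fst bounded_linear_snd)

text \<open>Isotropy of \<open>\<Upsilon> s\<^sub>0\<close> removes the component along \<open>\<Upsilon> s\<^sub>0\<close> by which the derivatives of the graph
  operator and of the parametrization differ, so any parametrization computes the crossing form.\<close>

lemma has_crossing_form_of_parametrization:
  fixes \<Upsilon> :: "real \<Rightarrow> 'k::{complex_inner,complete_space} double set"
  assumes \<epsilon>: "0 < \<epsilon>" and B: "C1_on B (ball s\<^sub>0 \<epsilon>)" "(B has_vector_derivative B') (at s\<^sub>0)"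
    and sub: "\<And>s. s \<in> ball s\<^sub>0 \<epsilon> \<Longrightarrow> complex_vector.subspace (\<Upsilon> s)" and cl: "closed (\<Upsilon> s\<^sub>0)"
    and par: "\<And>s. s \<in> ball s\<^sub>0 \<epsilon> \<Longrightarrow> \<Upsilon> s = blinfun_apply (B s) ` \<Upsilon> s\<^sub>0"
    and id: "\<And>q. q \<in> \<Upsilon> s\<^sub>0 \<Longrightarrow> B s\<^sub>0 q = q"
    and iso: "\<And>p q. p \<in> \<Upsilon> s\<^sub>0 \<Longrightarrow> q \<in> \<Upsilon> s\<^sub>0 \<Longrightarrow> symp_Omega2 q p = 0"
    and qp: "q \<in> \<Upsilon> s\<^sub>0 \<inter> \<D>" "p \<in> \<Upsilon> s\<^sub>0 \<inter> \<D>"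
  shows "has_crossing_form \<D> \<Upsilon> s\<^sub>0 q p (symp_Omega2 q (B' p))"
proof -
  define U where "U = \<Upsilon> s\<^sub>0"
  have csub: "complex_vector.subspace U" using sub[of s\<^sub>0] \<epsilon> by (simp add: U_def)
  note U = complex_subspace_imp_subspace[OF csub]
  note corth = corthogonal_eq_orthogonal_comp[OF csub]
  obtain \<delta> and M :: "real \<Rightarrow> 'k double \<Rightarrow>\<^sub>L 'k double" where \<delta>: "0 < \<delta>" "\<delta> \<le> \<epsilon>" and M: "C1_on M (ball s\<^sub>0 \<delta>)"
    and perp: "\<And>s q. M s q \<in> orthogonal_comp U"
    and graph: "\<And>s. s \<in> ball s\<^sub>0 \<delta> \<Longrightarrow> blinfun_apply (B s) ` U = {q + M s q | q. q \<in> U}"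
    and M0: "\<And>q. q \<in> U \<Longrightarrow> M s\<^sub>0 q = 0"
    and M': "\<And>q. q \<in> U \<Longrightarrow> \<exists>p\<in>U. ((\<lambda>s. M s q) has_vector_derivative B' q - p) (at s\<^sub>0)"
  proof (rule C1_graph_of_parametrization[OF U cl[folded U_def] \<epsilon> B])
    show "B s\<^sub>0 q = q" if "q \<in> U" for q using id that by (simp add: U_def)
  qed (rule that)
  have \<Upsilon>: "\<Upsilon> s = {q + M s q | q. q \<in> U}" if "s \<in> ball s\<^sub>0 \<delta>" for s
    using graph[OF that] par[of s] that \<delta> by (simp add: U_def)
  \<comment> \<open>\<open>M s\<close> is determined by the complex subspace \<open>\<Upsilon> s\<close>, hence commutes with complex scalars\<close>
  have lin: "M s (c *\<^sub>C x) = c *\<^sub>C M s x" if s: "s \<in> ball s\<^sub>0 \<delta>" and x: "x \<in> U" for s c x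
  proof -
    have "x + M s x \<in> \<Upsilon> s" using \<Upsilon>[OF s] x by blast
    then have "c *\<^sub>C (x + M s x) \<in> \<Upsilon> s"
      using sub[of s] s \<delta> by (intro complex_vector.subspace_scale) auto
    then obtain y where y: "y \<in> U" "c *\<^sub>C x + c *\<^sub>C M s x = y + M s y"
      using \<Upsilon>[OF s] by (auto simp: scaleC_add_right)
    have cx: "c *\<^sub>C x \<in> U" using csub x by (rule complex_vector.subspace_scale)
    have "M s x \<in> corthogonal U" using perp corth by simp
    then have "c *\<^sub>C M s x \<in> orthogonal_comp U"
      unfolding corth[symmetric] by (simp add: corthogonal_def cinner_scaleC_right)
    from graph_decomposition_unique[OF U cx y(1) this perp y(2)] show ?thesis by simp
  qed
  have graph_M: "C1_graph_path \<Upsilon> s\<^sub>0 (\<lambda>s. blinfun_apply (M s))"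
    unfolding C1_graph_path_def U_def[symmetric]
  proof (intro conjI exI[of _ \<delta>] ballI)
    show "op_C1_on U norm (\<lambda>s. blinfun_apply (M s)) (ball s\<^sub>0 \<delta>)"
      using M open_ball csub lin by (rule op_C1_on_blinfun)
    show "blinfun_apply (M s) ` U \<subseteq> corthogonal U" for s unfolding corth using perp by blast
    show "\<Upsilon> s = {q + M s q | q. q \<in> U}" if "s \<in> ball s\<^sub>0 \<delta>" for s by (rule \<Upsilon>[OF that])
    show "0 < \<delta>" by (fact \<delta>)
    show "M s\<^sub>0 q = 0" if "q \<in> U" for q by (rule M0[OF that])
  qed
  have "p \<in> U" using qp by (simp add: U_def)
  from M'[OF this] obtain r where r: "r \<in> U" "((\<lambda>s. M s p) has_vector_derivative B' p - r) (at s\<^sub>0)"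
    by (rule bexE)
  have "((\<lambda>s. symp_Omega2 q (M' s p)) has_vector_derivative symp_Omega2 q (B' p)) (at s\<^sub>0)"
    if M': "C1_graph_path \<Upsilon> s\<^sub>0 M'" for M'
  proof -
    have "\<exists>\<eta>>0. op_C1_on U norm M' (ball s\<^sub>0 \<eta>) \<and> (\<forall>s\<in>ball s\<^sub>0 \<eta>. M' s ` U \<subseteq> orthogonal_comp U \<and>
        \<Upsilon> s = {q + M' s q | q. q \<in> U})"
      using M' unfolding C1_graph_path_def U_def[symmetric] corth by (rule conjunct1)
    then obtain \<eta> where \<eta>0: "0 < \<eta>" and "\<forall>s\<in>ball s\<^sub>0 \<eta>. M' s ` U \<subseteq> orthogonal_comp U \<and>
        \<Upsilon> s = {q + M' s q | q. q \<in> U}"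
      by (elim exE conjE) (rule that)
    then have \<eta>: "M' s ` U \<subseteq> orthogonal_comp U" "\<Upsilon> s = {q + M' s q | q. q \<in> U}" if "s \<in> ball s\<^sub>0 \<eta>" for s
      using that by simp_all
    have eq: "M s p = M' s p" if "s \<in> ball s\<^sub>0 (min \<delta> \<eta>)" for s
    proof -
      have p: "p \<in> U" and s: "s \<in> ball s\<^sub>0 \<delta>" "s \<in> ball s\<^sub>0 \<eta>" using qp that by (auto simp: U_def)
      have "p + M' s p \<in> \<Upsilon> s" using \<eta>(2)[OF s(2)] p by blast
      then obtain y where y: "y \<in> U" "p + M' s p = y + M s y" using \<Upsilon>[OF s(1)] by auto
      have "M' s p \<in> orthogonal_comp U" using \<eta>(1)[OF s(2)] p by blast
      from graph_decomposition_unique[OF U p y(1) this perp y(2)] show ?thesis by simp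
    qed
    have "((\<lambda>s. symp_Omega2 q (M s p)) has_vector_derivative symp_Omega2 q (B' p - r)) (at s\<^sub>0)"
      by (rule bounded_linear.has_vector_derivative[OF bounded_linear_symp_Omega2 r(2)])
    then have "((\<lambda>s. symp_Omega2 q (M' s p)) has_vector_derivative symp_Omega2 q (B' p - r)) (at s\<^sub>0)"
      by (rule has_vector_derivative_transform_within_open[of _ _ _ "ball s\<^sub>0 (min \<delta> \<eta>)"])
        (use \<delta> \<eta>0 eq in auto)
    moreover have "symp_Omega2 q (B' p - r) = symp_Omega2 q (B' p) - symp_Omega2 q r"
      by (rule linear_diff[OF bounded_linear.linear[OF bounded_linear_symp_Omega2]])
    moreover have "symp_Omega2 q r = 0" using iso r(1) qp(1) by (simp add: U_def)
    ultimately show ?thesis by simp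
  qed
  then show ?thesis unfolding has_crossing_form_def
    by (intro conjI qp exI[of _ "\<lambda>s. blinfun_apply (M s)"] graph_M allI impI)
qed


section \<open>Paths of kernels and of ranges of projections\<close>

text \<open>With \<open>Y\<^sub>s = (\<Lambda>\<^sub>s S)\<^sup>-\<^sup>1\<close>, the operator \<open>Z\<^sub>s = 1 - S Y\<^sub>s \<Lambda>\<^sub>s\<close> is the projection onto the kernel
  of \<open>\<Lambda>\<^sub>s\<close> along the range of \<open>S\<close>. It restricts to a bijection from the kernel of \<open>\<Lambda>\<close> at \<open>s\<^sub>0\<close>, with
  inverse \<open>1 - S \<Lambda>\<close> for the \<open>\<Lambda>\<close> at \<open>s\<^sub>0\<close>.\<close>

lemma kernel_path_parametrization:
  fixes \<Lambda> :: "real \<Rightarrow> 'x::real_normed_vector \<Rightarrow>\<^sub>L 'y::{real_normed_vector,complete_space}"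
  assumes \<epsilon>: "0 < \<epsilon>" and \<Lambda>: "C1_on \<Lambda> (ball s\<^sub>0 \<epsilon>)" and E: "subspace E"
    and S: "\<And>y. blinfun_apply S y \<in> E" "\<And>y. \<Lambda> s\<^sub>0 (S y) = y"
  obtains \<delta> and Z :: "real \<Rightarrow> 'x \<Rightarrow>\<^sub>L 'x" where "0 < \<delta>" "\<delta> \<le> \<epsilon>" "C1_on Z (ball s\<^sub>0 \<delta>)"
    "\<And>g. \<Lambda> s\<^sub>0 g = 0 \<Longrightarrow> Z s\<^sub>0 g = g"
    "\<And>s. s \<in> ball s\<^sub>0 \<delta> \<Longrightarrow> blinfun_apply (Z s) ` {g \<in> E. \<Lambda> s\<^sub>0 g = 0} = {g \<in> E. \<Lambda> s g = 0}"
proof -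
  have "C1_on (\<lambda>s. \<Lambda> s o\<^sub>L S) (ball s\<^sub>0 \<epsilon>)" by (intro C1_on_blinfun_compose C1_on_const \<Lambda>)
  moreover have "\<Lambda> s\<^sub>0 o\<^sub>L S = id_blinfun" by (rule blinfun_eqI) (simp add: S)
  ultimately obtain \<delta> Y where \<delta>: "0 < \<delta>" "\<delta> \<le> \<epsilon>" and Y: "C1_on Y (ball s\<^sub>0 \<delta>)"
    and inv: "\<And>s. s \<in> ball s\<^sub>0 \<delta> \<Longrightarrow> \<Lambda> s o\<^sub>L S o\<^sub>L Y s = id_blinfun"
      "\<And>s. s \<in> ball s\<^sub>0 \<delta> \<Longrightarrow> Y s o\<^sub>L (\<Lambda> s o\<^sub>L S) = id_blinfun"
    using C1_on_blinfun_inverse[of "\<lambda>s. \<Lambda> s o\<^sub>L S", OF _ \<epsilon>] by blast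
  have LY: "\<Lambda> s (S (Y s x)) = x" and YL: "Y s (\<Lambda> s (S x)) = x" if "s \<in> ball s\<^sub>0 \<delta>" for s x
    using inv(1)[OF that, THEN arg_cong, of "\<lambda>Z. blinfun_apply Z x"]
      inv(2)[OF that, THEN arg_cong, of "\<lambda>Z. blinfun_apply Z x"] by simp_all
  define Z where "Z s = id_blinfun - (S o\<^sub>L Y s o\<^sub>L \<Lambda> s)" for s
  have Z_apply: "Z s g = g - S (Y s (\<Lambda> s g))" for s g by (simp add: Z_def blinfun.bilinear_simps)
  show ?thesis
  proof
    show "0 < \<delta>" "\<delta> \<le> \<epsilon>" by (fact \<delta>)+
    have \<Lambda>\<delta>: "C1_on \<Lambda> (ball s\<^sub>0 \<delta>)" using \<Lambda> by (rule C1_on_subset) (use \<delta> in auto)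
    show "C1_on Z (ball s\<^sub>0 \<delta>)"
      unfolding Z_def by (intro C1_on_diff C1_on_blinfun_compose C1_on_const \<Lambda>\<delta> Y)
    show "Z s\<^sub>0 g = g" if "\<Lambda> s\<^sub>0 g = 0" for g using that by (simp add: Z_apply)
    show "blinfun_apply (Z s) ` {g \<in> E. \<Lambda> s\<^sub>0 g = 0} = {g \<in> E. \<Lambda> s g = 0}" if s: "s \<in> ball s\<^sub>0 \<delta>" for s
    proof (intro equalityI subsetI)
      fix g assume "g \<in> blinfun_apply (Z s) ` {g \<in> E. \<Lambda> s\<^sub>0 g = 0}"
      then obtain g' where g': "g' \<in> E" "g = Z s g'" by blast
      have "g \<in> E" using g' S(1) E by (simp add: Z_apply subspace_diff)
      moreover have "\<Lambda> s g = 0" using g' LY[OF s] by (simp add: Z_apply blinfun.bilinear_simps)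
      ultimately show "g \<in> {g \<in> E. \<Lambda> s g = 0}" by simp
    next
      fix g assume g: "g \<in> {g \<in> E. \<Lambda> s g = 0}"
      let ?h = "g - S (\<Lambda> s\<^sub>0 g)"
      have "?h \<in> {g \<in> E. \<Lambda> s\<^sub>0 g = 0}" using g S E by (simp add: subspace_diff blinfun.bilinear_simps)
      moreover have "Z s ?h = g" using g YL[OF s] by (simp add: Z_apply blinfun.bilinear_simps)
      ultimately show "g \<in> blinfun_apply (Z s) ` {g \<in> E. \<Lambda> s\<^sub>0 g = 0}" by (metis image_eqI)
    qed
  qed
qed

text \<open>Kato's transformation function \<open>U = P\<^sub>s P\<^sub>0 + (1 - P\<^sub>s) (1 - P\<^sub>0)\<close> satisfies \<open>U P\<^sub>0 = P\<^sub>s U\<close> and is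
  invertible when it is close to the identity.\<close>

lemma range_projection_locally:
  fixes P :: "real \<Rightarrow> 'a::{real_normed_vector,complete_space} \<Rightarrow>\<^sub>L 'a"
  assumes \<epsilon>: "0 < \<epsilon>" and P: "continuous_on (ball s\<^sub>0 \<epsilon>) P"
    and idem: "\<And>s. s \<in> ball s\<^sub>0 \<epsilon> \<Longrightarrow> P s o\<^sub>L P s = P s"
  obtains \<delta> where "0 < \<delta>" "\<delta> \<le> \<epsilon>"
    "\<And>s. s \<in> ball s\<^sub>0 \<delta> \<Longrightarrow> blinfun_apply (P s) ` range (blinfun_apply (P s\<^sub>0)) = range (blinfun_apply (P s))"
proof -
  define U where "U s = (P s o\<^sub>L P s\<^sub>0) + ((id_blinfun - P s) o\<^sub>L (id_blinfun - P s\<^sub>0))" for s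
  have idem': "P s (P s x) = P s x" if "s \<in> ball s\<^sub>0 \<epsilon>" for s x
    using idem[OF that] by (metis blinfun_apply_blinfun_compose)
  have "U s\<^sub>0 = id_blinfun"
    by (rule blinfun_eqI) (use idem'[of s\<^sub>0] \<epsilon> in \<open>simp add: U_def blinfun.bilinear_simps\<close>)
  have "continuous_on (ball s\<^sub>0 \<epsilon>) U"
    unfolding U_def
    by (intro continuous_on_add continuous_on_diff continuous_on_const P
        bounded_bilinear.continuous_on[OF bounded_bilinear_blinfun_compose])
  then have "(U \<longlongrightarrow> U s\<^sub>0) (at s\<^sub>0)"
    using \<epsilon> by (auto simp: continuous_on_eq_continuous_at continuous_at)
  then have "\<forall>\<^sub>F s in at s\<^sub>0. dist (U s) (U s\<^sub>0) < 1 / 2" by (rule tendstoD) simp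
  then obtain d where d: "0 < d" "\<And>s. s \<noteq> s\<^sub>0 \<Longrightarrow> dist s s\<^sub>0 < d \<Longrightarrow> dist (U s) (U s\<^sub>0) < 1 / 2"
    by (auto simp: eventually_at)
  show ?thesis
  proof
    show "0 < min d \<epsilon>" "min d \<epsilon> \<le> \<epsilon>" using d \<epsilon> by auto
    fix s assume s: "s \<in> ball s\<^sub>0 (min d \<epsilon>)"
    have s\<epsilon>: "s \<in> ball s\<^sub>0 \<epsilon>" using s by simp
    have "norm (U s - id_blinfun) \<le> 1 / 2"
      using d(2)[of s] s \<open>U s\<^sub>0 = id_blinfun\<close>
      by (cases "s = s\<^sub>0") (auto simp: dist_norm abs_minus_commute)
    then obtain W where "U s o\<^sub>L W = id_blinfun" using blinfun_inverse_near_id by blast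
    then have W: "U s (W x) = x" for x by (metis blinfun_apply_blinfun_compose id_blinfun.rep_eq)
    have comm: "P s (U s x) = P s (P s\<^sub>0 x)" for x
      using idem'[OF s\<epsilon>] by (simp add: U_def blinfun.bilinear_simps)
    show "blinfun_apply (P s) ` range (blinfun_apply (P s\<^sub>0)) = range (blinfun_apply (P s))"
    proof (intro equalityI subsetI)
      fix y assume "y \<in> range (blinfun_apply (P s))"
      then obtain x where "y = P s x" by blast
      then have "y = P s (P s\<^sub>0 (W x))" using comm[of "W x"] W by simp
      then show "y \<in> blinfun_apply (P s) ` range (blinfun_apply (P s\<^sub>0))" by blast
    qed auto
  qed
qed


section \<open>Block operators\<close>

definition blinfun_inl :: "'a::real_normed_vector \<Rightarrow>\<^sub>L ('a \<times> 'b::real_normed_vector)"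
  where "blinfun_inl = Blinfun (\<lambda>x. (x, 0))"

definition blinfun_inr :: "'b::real_normed_vector \<Rightarrow>\<^sub>L ('a::real_normed_vector \<times> 'b)"
  where "blinfun_inr = Blinfun (\<lambda>x. (0, x))"

lemma blinfun_apply_inl [simp]: "blinfun_inl x = (x, 0)"
  unfolding blinfun_inl_def
  by (subst bounded_linear_Blinfun_apply)
    (intro bounded_linear_Pair bounded_linear_ident bounded_linear_zero refl)+

lemma blinfun_apply_inr [simp]: "blinfun_inr x = (0, x)"
  unfolding blinfun_inr_def
  by (subst bounded_linear_Blinfun_apply)
    (intro bounded_linear_Pair bounded_linear_ident bounded_linear_zero refl)+

definition blinfun_prod :: "('a::real_normed_vector \<Rightarrow>\<^sub>L 'b::real_normed_vector) \<Rightarrow>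
    ('c::real_normed_vector \<Rightarrow>\<^sub>L 'd::real_normed_vector) \<Rightarrow> ('a \<times> 'c) \<Rightarrow>\<^sub>L ('b \<times> 'd)"
  where "blinfun_prod f g =
    (blinfun_inl o\<^sub>L f o\<^sub>L fst_blinfun) + (blinfun_inr o\<^sub>L g o\<^sub>L snd_blinfun)"

lemma blinfun_apply_prod: "blinfun_apply (blinfun_prod f g) = map_prod (blinfun_apply f) (blinfun_apply g)"
  by (rule ext) (simp add: blinfun_prod_def blinfun.add_left map_prod_def split_beta)

lemma C1_on_blinfun_prod:
  "C1_on f I \<Longrightarrow> C1_on g I \<Longrightarrow> C1_on (\<lambda>s. blinfun_prod (f s) (g s)) I"
  unfolding blinfun_prod_def by (intro C1_on_add C1_on_blinfun_compose C1_on_const)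

lemma has_vector_derivative_blinfun_prod:
  assumes "(f has_vector_derivative f') F" "(g has_vector_derivative g') F"
  shows "((\<lambda>s. blinfun_prod (f s) (g s)) has_vector_derivative blinfun_prod f' g') F"
  unfolding blinfun_prod_def
  by (intro has_vector_derivative_add
      bounded_linear.has_vector_derivative[OF bounded_bilinear.bounded_linear_left[OF bounded_bilinear_blinfun_compose]]
      bounded_linear.has_vector_derivative[OF bounded_bilinear.bounded_linear_right[OF bounded_bilinear_blinfun_compose]]
      assms)


section \<open>The path of boundary values of kernels\<close>

lemma op_plus_graph_of_iff:
  "(x, y) \<in> T +\<^sub>o graph_of f \<longleftrightarrow> (x, y - f x) \<in> (T :: ('a, 'b::ab_group_add) oper)"
  unfolding op_plus_def graph_of_def by force

lemma adjoint_op_plus_graph_of: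
  fixes D :: "('a::complex_inner, 'a) oper"
  assumes "\<And>x y. cinner (f x) y = cinner x (f y)"
  shows "adjoint_op (D +\<^sub>o graph_of f) = adjoint_op D +\<^sub>o graph_of f"
proof -
  have "cinner (y + f x) v = cinner x w \<longleftrightarrow> cinner y v = cinner x (w - f v)" for x y v w
    using cinner_add_right[of x "w - f v" "f v"] by (simp add: cinner_add_left assms)
  moreover have "(v, w) \<in> adjoint_op (D +\<^sub>o graph_of f) \<longleftrightarrow>
      (\<forall>(x, y)\<in>D. cinner (y + f x) v = cinner x w)" for v w
    unfolding adjoint_op_def op_plus_def graph_of_def by blast
  ultimately have "(v, w) \<in> adjoint_op (D +\<^sub>o graph_of f) \<longleftrightarrow> (v, w) \<in> adjoint_op D +\<^sub>o graph_of f" for v w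
    unfolding op_plus_graph_of_iff by (simp add: adjoint_op_def)
  then show ?thesis by auto
qed

lemma complex_subspace_adjoint_op: "complex_vector.subspace (adjoint_op D)"
proof -
  have mem: "p \<in> adjoint_op D \<longleftrightarrow> (\<forall>q\<in>D. cinner (snd q) (fst p) = cinner (fst q) (snd p))" for p
    by (auto simp: adjoint_op_def split_beta)
  show ?thesis
    unfolding complex_vector.subspace_def
    by (simp add: mem scaleC_prod_def cinner_zero_right cinner_add_right cinner_scaleC_right)
qed

lemma derivative_mem_closed_subspace:
  assumes E: "subspace E" "closed E" and f: "(f has_vector_derivative d) (at s\<^sub>0)"
    and \<delta>: "0 < \<delta>" "\<And>s. s \<in> ball s\<^sub>0 \<delta> \<Longrightarrow> f s \<in> E"
  shows "d \<in> E"
proof (rule Lim_in_closed_set[OF E(2)])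
  show "((\<lambda>s. (f s - f s\<^sub>0) /\<^sub>R (s - s\<^sub>0)) \<longlongrightarrow> d) (at s\<^sub>0)"
    using f by (simp add: has_vector_derivative_iff_quotient)
  show "\<forall>\<^sub>F s in at s\<^sub>0. (f s - f s\<^sub>0) /\<^sub>R (s - s\<^sub>0) \<in> E"
    unfolding eventually_at
    by (intro exI[of _ \<delta>])
      (use \<delta> E(1) in \<open>auto simp: dist_commute intro!: subspace_scale subspace_diff\<close>)
qed simp

lemma bounded_left_inverse_on:
  fixes T :: "'x::real_normed_vector \<Rightarrow>\<^sub>L 'k::{real_inner,complete_space}"
  assumes L: "subspace L" and cl: "closed (blinfun_apply T ` L)"
    and below: "\<And>g. g \<in> L \<Longrightarrow> norm g \<le> C * norm (T g)"
  obtains J :: "'k \<Rightarrow>\<^sub>L 'x" where "\<And>g. g \<in> L \<Longrightarrow> J (T g) = g"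
proof -
  let ?K = "blinfun_apply T ` L"
  have K: "subspace ?K"
    by (intro linear_subspace_image L bounded_linear.linear blinfun.bounded_linear_right)
  have inj: "g = h" if "g \<in> L" "h \<in> L" "T g = T h" for g h
    using below[of "g - h"] that L by (simp add: subspace_diff blinfun.diff_right)
  have "\<exists>g. g \<in> L \<and> T g = proj_onto ?K k" for k
    using proj_onto_mem[OF K cl, of k] by (metis imageE)
  then obtain f where f: "\<And>k. f k \<in> L" "\<And>k. T (f k) = proj_onto ?K k" by metis
  have "bounded_linear f"
  proof (rule bounded_linear_intro)
    show "f (x + y) = f x + f y" for x y
      by (rule inj) (use f L in \<open>auto simp: subspace_add blinfun.add_right\<close>)
    show "f (c *\<^sub>R x) = c *\<^sub>R f x" for c x
      by (rule inj) (use f L in \<open>auto simp: subspace_scale blinfun.scaleR_right\<close>)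
    show "norm (f k) \<le> norm k * \<bar>C\<bar>" for k
    proof -
      have "norm (f k) \<le> C * norm (T (f k))" using below f by blast
      also have "\<dots> \<le> \<bar>C\<bar> * norm k"
        unfolding f using norm_proj_onto_apply[OF K cl] by (intro mult_mono) auto
      finally show ?thesis by (simp add: mult.commute)
    qed
  qed
  then have J: "blinfun_apply (Blinfun f) = f" by (rule bounded_linear_Blinfun_apply)
  have "f (T g) = g" if "g \<in> L" for g
    by (rule inj) (use that f proj_onto_ident[OF K cl] in auto)
  then show ?thesis by (intro that[of "Blinfun f"]) (simp add: J)
qed

lemma C1_on_has_vector_derivative_at:
  assumes "C1_on f (ball s\<^sub>0 \<epsilon>)" "0 < \<epsilon>"
  obtains d where "(f has_vector_derivative d) (at s\<^sub>0)"
proof -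
  obtain f' where "\<And>t. t \<in> ball s\<^sub>0 \<epsilon> \<Longrightarrow> (f has_vector_derivative f' t) (at t within ball s\<^sub>0 \<epsilon>)"
    using assms(1) unfolding C1_on_def by blast
  then have "(f has_vector_derivative f' s\<^sub>0) (at s\<^sub>0)"
    using at_within_open[of s\<^sub>0 "ball s\<^sub>0 \<epsilon>"] assms(2) by (metis centre_in_ball open_ball)
  then show ?thesis by (rule that)
qed

text \<open>Elements of the maximal operator \<open>E = D\<^sup>*\<close> are pairs \<open>g = (x, E x)\<close>, so that \<open>T\<close> acts on the
  domain with its graph norm and the kernel of \<open>E + R\<close> is given by \<open>snd g + R (fst g) = 0\<close>.
  Green's identity with \<open>(E + R) v = x\<close> reads \<open>\<parallel>x\<parallel>\<^sup>2 = - w (T x) (T v)\<close> for \<open>x\<close> in the kernel. Hence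
  surjectivity of \<open>E + R\<close> makes the trace bounded below on the kernel.\<close>

lemma boundary_values_path:
  fixes D :: "('h::{complex_inner,complete_space}, 'h) oper"
    and R :: "real \<Rightarrow> 'h \<Rightarrow>\<^sub>L 'h" and T :: "real \<Rightarrow> ('h \<times> 'h) \<Rightarrow>\<^sub>L 'k::{real_inner,complete_space}"
    and w :: "'k \<Rightarrow> 'k \<Rightarrow> real"
  defines "L \<equiv> \<lambda>s. {g \<in> adjoint_op D. snd g + R s (fst g) = 0}"
  assumes D: "complex_vector.subspace D" "closed D"
    and \<epsilon>: "0 < \<epsilon>"
    and R: "C1_on R (ball s\<^sub>0 \<epsilon>)" "(R has_vector_derivative R') (at s\<^sub>0)"
    and T: "C1_on T (ball s\<^sub>0 \<epsilon>)" "(T has_vector_derivative T') (at s\<^sub>0)"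
    and sa: "bounded_self_adjoint (R s\<^sub>0)"
    and surj: "\<And>h. \<exists>g\<in>adjoint_op D. snd g + R s\<^sub>0 (fst g) = h"
    and green: "\<And>g g'. g \<in> adjoint_op D \<Longrightarrow> g' \<in> adjoint_op D \<Longrightarrow>
      inner (snd g) (fst g') - inner (fst g) (snd g') = w (T s\<^sub>0 g) (T s\<^sub>0 g')"
    and w: "\<And>f f'. \<bar>w f f'\<bar> \<le> norm f * norm f'"
  obtains \<delta> and B :: "real \<Rightarrow> 'k \<Rightarrow>\<^sub>L 'k" and B' where "0 < \<delta>" "\<delta> \<le> \<epsilon>" "C1_on B (ball s\<^sub>0 \<delta>)"
    "(B has_vector_derivative B') (at s\<^sub>0)" "closed (blinfun_apply (T s\<^sub>0) ` L s\<^sub>0)"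
    "\<And>s. s \<in> ball s\<^sub>0 \<delta> \<Longrightarrow> blinfun_apply (T s) ` L s = blinfun_apply (B s) ` blinfun_apply (T s\<^sub>0) ` L s\<^sub>0"
    "\<And>g. g \<in> L s\<^sub>0 \<Longrightarrow> B s\<^sub>0 (T s\<^sub>0 g) = T s\<^sub>0 g"
    "\<And>g. g \<in> L s\<^sub>0 \<Longrightarrow> \<exists>z\<in>adjoint_op D. B' (T s\<^sub>0 g) = T' g + T s\<^sub>0 z \<and>
      snd z + R s\<^sub>0 (fst z) + R' (fst g) = 0"
proof -
  define E where "E = adjoint_op D"
  have subE: "subspace E" unfolding E_def using D(1) by (rule subspace_adjoint_op)
  have clE: "closed E" unfolding E_def using D(1) by (rule closed_adjoint_op)
  have csa: "cinner (R s\<^sub>0 x) y = cinner x (R s\<^sub>0 y)" for x y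
    using sa by (simp add: bounded_self_adjoint_def)
  have rsa: "inner (R s\<^sub>0 x) y = inner x (R s\<^sub>0 y)" for x y
    by (simp add: inner_eq_Re_cinner csa)
  define \<Lambda> where "\<Lambda> s = snd_blinfun + (R s o\<^sub>L fst_blinfun)" for s
  have \<Lambda>_apply: "\<Lambda> s g = snd g + R s (fst g)" for s g by (simp add: \<Lambda>_def blinfun.add_left)
  have L_eq: "L s = {g \<in> E. \<Lambda> s g = 0}" for s by (simp add: L_def E_def \<Lambda>_apply)
  have \<Lambda>: "C1_on \<Lambda> (ball s\<^sub>0 \<epsilon>)"
    unfolding \<Lambda>_def by (intro C1_on_add C1_on_blinfun_compose C1_on_const R)

  \<comment> \<open>\<open>E + R\<close> at \<open>s\<^sub>0\<close> is the adjoint of \<open>D + R\<close>, so it has a bounded right inverse \<open>S\<^sub>1\<close>\<close>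
  define Dr where "Dr = D +\<^sub>o graph_of (blinfun_apply (R s\<^sub>0))"
  have Dr_iff: "p \<in> Dr \<longleftrightarrow> (fst p, snd p - R s\<^sub>0 (fst p)) \<in> D" for p
    using op_plus_graph_of_iff[of "fst p" "snd p" D] by (simp add: Dr_def)
  have adj: "(v, h) \<in> adjoint_op Dr \<longleftrightarrow> (v, h - R s\<^sub>0 v) \<in> E" for v h
    unfolding Dr_def E_def by (simp add: adjoint_op_plus_graph_of csa op_plus_graph_of_iff)
  have "R s\<^sub>0 (c *\<^sub>C x) = c *\<^sub>C R s\<^sub>0 x" for c x
    using sa by (auto simp: bounded_self_adjoint_def Vector_Spaces.linear_iff)
  then have eq: "(fst (c *\<^sub>C p), snd (c *\<^sub>C p) - R s\<^sub>0 (fst (c *\<^sub>C p))) = c *\<^sub>C (fst p, snd p - R s\<^sub>0 (fst p))" for c p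
    by (simp add: scaleC_prod_def complex_vector.scale_right_diff_distrib)
  have "complex_vector.subspace Dr"
  proof (rule complex_vector.subspaceI)
    show "0 \<in> Dr" using complex_vector.subspace_0[OF D(1)] by (simp add: Dr_iff zero_prod_def)
    show "p + q \<in> Dr" if "p \<in> Dr" "q \<in> Dr" for p q
      using complex_vector.subspace_add[OF D(1), OF that[unfolded Dr_iff]]
      by (simp add: Dr_iff blinfun.add_right add_diff_add)
    show "c *\<^sub>C p \<in> Dr" if "p \<in> Dr" for c p
      unfolding Dr_iff eq using that[unfolded Dr_iff] by (rule complex_vector.subspace_scale[OF D(1)])
  qed
  moreover have "closed Dr"
  proof -
    have "Dr = (\<lambda>p. (fst p, snd p - R s\<^sub>0 (fst p))) -` D" using Dr_iff by auto
    also have "closed \<dots>" by (intro closed_vimage D continuous_intros)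
    finally show ?thesis .
  qed
  moreover have "h \<in> Range (adjoint_op Dr)" for h
  proof -
    obtain g where "g \<in> E" "snd g + R s\<^sub>0 (fst g) = h" using surj E_def by blast
    then have "(fst g, h) \<in> adjoint_op Dr" by (auto simp: adj)
    then show ?thesis by blast
  qed
  then have "Range (adjoint_op Dr) = UNIV" by blast
  ultimately obtain S\<^sub>1 :: "'h \<Rightarrow>\<^sub>L 'h" where S\<^sub>1: "\<And>h. (S\<^sub>1 h, h - R s\<^sub>0 (S\<^sub>1 h)) \<in> E"
    using bounded_right_inverse_of_adjoint[of Dr] unfolding adj by (elim meta_impE) auto
  \<comment> \<open>the same right inverse with values in the graph of \<open>E\<close>\<close>
  define S where "S = (blinfun_inl o\<^sub>L S\<^sub>1) + (blinfun_inr o\<^sub>L (id_blinfun - (R s\<^sub>0 o\<^sub>L S\<^sub>1)))"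
  have S_apply: "S h = (S\<^sub>1 h, h - R s\<^sub>0 (S\<^sub>1 h))" for h by (simp add: S_def blinfun.bilinear_simps)
  have S: "S h \<in> E" "\<Lambda> s\<^sub>0 (S h) = h" for h using S\<^sub>1 by (simp_all add: S_apply \<Lambda>_apply)

  obtain \<delta> and Z :: "real \<Rightarrow> ('h \<times> 'h) \<Rightarrow>\<^sub>L ('h \<times> 'h)" where \<delta>: "0 < \<delta>" "\<delta> \<le> \<epsilon>" and Z: "C1_on Z (ball s\<^sub>0 \<delta>)"
    and Z0: "\<And>g. \<Lambda> s\<^sub>0 g = 0 \<Longrightarrow> Z s\<^sub>0 g = g"
    and "\<And>s. s \<in> ball s\<^sub>0 \<delta> \<Longrightarrow>
      blinfun_apply (Z s) ` {g \<in> E. \<Lambda> s\<^sub>0 g = 0} = {g \<in> E. \<Lambda> s g = 0}"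
    by (rule kernel_path_parametrization[OF \<epsilon> \<Lambda> subE S]) (rule that)

  then have Z_img: "blinfun_apply (Z s) ` L s\<^sub>0 = L s" if "s \<in> ball s\<^sub>0 \<delta>" for s
    using that by (simp add: L_eq)
  have subL: "subspace (L s\<^sub>0)"
    using subE by (auto simp: L_eq subspace_def blinfun.bilinear_simps)
  have "L s\<^sub>0 = E \<inter> {g. \<Lambda> s\<^sub>0 g = 0}" by (auto simp: L_eq)
  also have "closed \<dots>" by (intro closed_Int clE closed_Collect_eq continuous_intros)
  finally have clL: "closed (L s\<^sub>0)" .
  \<comment> \<open>the summand 1 only makes the constant positive\<close>
  define C where "C = (1 + norm (R s\<^sub>0)) * (norm (T s\<^sub>0) * norm S) + 1"
  have C: "0 < C" unfolding C_def by (intro add_nonneg_pos mult_nonneg_nonneg add_nonneg_nonneg) auto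
  have below: "norm g \<le> C * norm (T s\<^sub>0 g)" if g: "g \<in> L s\<^sub>0" for g
  proof -
    let ?x = "fst g" and ?c = "norm (T s\<^sub>0) * norm S"
    have gE: "g \<in> E" and sg: "snd g = - R s\<^sub>0 ?x"
      using g by (auto simp: L_eq \<Lambda>_apply eq_neg_iff_add_eq_0)
    have "w (T s\<^sub>0 g) (T s\<^sub>0 (S ?x)) = - inner ?x ?x"
      using green[of g "S ?x"] gE S(1) by (simp add: E_def S_apply sg rsa inner_simps)
    then have "norm ?x * norm ?x \<le> norm (T s\<^sub>0 g) * norm (T s\<^sub>0 (S ?x))"
      using w[of "T s\<^sub>0 g" "T s\<^sub>0 (S ?x)"] by (simp add: dot_square_norm power2_eq_square)
    also have "\<dots> \<le> norm (T s\<^sub>0 g) * (norm (T s\<^sub>0) * (norm S * norm ?x))"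
      by (intro mult_left_mono order_trans[OF norm_blinfun] norm_blinfun) auto
    finally have "norm ?x * norm ?x \<le> norm ?x * (?c * norm (T s\<^sub>0 g))" by (simp add: mult_ac)
    then have x: "norm ?x \<le> ?c * norm (T s\<^sub>0 g)"
      by (cases "?x = 0") (auto simp: mult_le_cancel_left)
    have "norm g \<le> norm ?x + norm (snd g)" using norm_Pair_le[of ?x "snd g"] by simp
    also have "\<dots> \<le> (1 + norm (R s\<^sub>0)) * norm ?x"
      using norm_blinfun[of "R s\<^sub>0" ?x] by (simp add: sg distrib_right)
    also have "\<dots> \<le> (1 + norm (R s\<^sub>0)) * (?c * norm (T s\<^sub>0 g))" by (intro mult_left_mono x) auto
    also have "\<dots> \<le> C * norm (T s\<^sub>0 g)" by (simp add: C_def algebra_simps)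
    finally show ?thesis .
  qed
  have "complete (blinfun_apply (T s\<^sub>0) ` L s\<^sub>0)"
  proof (rule complete_isometric_image[of "1 / C"])
    show "\<forall>g\<in>L s\<^sub>0. 1 / C * norm g \<le> norm (T s\<^sub>0 g)"
      using below C by (simp add: field_simps)
  qed (use C subL clL blinfun.bounded_linear_right complete_eq_closed in auto)
  then have clK: "closed (blinfun_apply (T s\<^sub>0) ` L s\<^sub>0)" by (rule complete_imp_closed)
  obtain J :: "'k \<Rightarrow>\<^sub>L ('h \<times> 'h)" where J: "\<And>g. g \<in> L s\<^sub>0 \<Longrightarrow> J (T s\<^sub>0 g) = g"
    by (rule bounded_left_inverse_on[OF subL clK below], assumption) (rule that)

  define B where "B s = T s o\<^sub>L (Z s o\<^sub>L J)" for s
  obtain Z' where Z': "(Z has_vector_derivative Z') (at s\<^sub>0)"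
    using C1_on_has_vector_derivative_at[OF Z \<delta>(1)] .
  define B' where "B' = (T s\<^sub>0 o\<^sub>L (Z' o\<^sub>L J)) + (T' o\<^sub>L (Z s\<^sub>0 o\<^sub>L J))"
  show ?thesis
  proof (rule that[of \<delta> B B'])
    show "0 < \<delta>" "\<delta> \<le> \<epsilon>" by (fact \<delta>)+
    have "C1_on T (ball s\<^sub>0 \<delta>)" using T(1) by (rule C1_on_subset) (use \<delta> in auto)
    then show "C1_on B (ball s\<^sub>0 \<delta>)"
      unfolding B_def by (intro C1_on_blinfun_compose C1_on_const Z)
    show "(B has_vector_derivative B') (at s\<^sub>0)"
      unfolding B_def B'_def
      by (intro bounded_bilinear.has_vector_derivative[OF bounded_bilinear_blinfun_compose T(2)]
          bounded_linear.has_vector_derivative[OF bounded_bilinear.bounded_linear_left[OF bounded_bilinear_blinfun_compose] Z'])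
    show "closed (blinfun_apply (T s\<^sub>0) ` L s\<^sub>0)" by (fact clK)
    show "blinfun_apply (T s) ` L s = blinfun_apply (B s) ` blinfun_apply (T s\<^sub>0) ` L s\<^sub>0"
      if "s \<in> ball s\<^sub>0 \<delta>" for s
      unfolding Z_img[OF that, symmetric] image_image
      by (rule image_cong) (simp_all add: B_def J)
    fix g assume g: "g \<in> L s\<^sub>0"
    have Zg: "Z s\<^sub>0 g = g" using g Z0 by (simp add: L_eq)
    show "B s\<^sub>0 (T s\<^sub>0 g) = T s\<^sub>0 g" by (simp add: B_def J g Zg)
    let ?z = "Z' g"
    have near: "Z s g \<in> E" "\<Lambda> s (Z s g) = 0" if "s \<in> ball s\<^sub>0 \<delta>" for s
      using Z_img[OF that] g unfolding L_eq by blast+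
    have dZ: "((\<lambda>s. Z s g) has_vector_derivative ?z) (at s\<^sub>0)"
      by (rule bounded_linear.has_vector_derivative[OF blinfun.bounded_linear_left Z'])
    have "?z \<in> E" using subE clE dZ \<delta>(1) near(1) by (rule derivative_mem_closed_subspace)
    moreover have "B' (T s\<^sub>0 g) = T' g + T s\<^sub>0 ?z"
      by (simp add: B'_def J g Zg blinfun.add_left)
    moreover have "snd ?z + R s\<^sub>0 (fst ?z) + R' (fst g) = 0"
    proof -
      have "((\<lambda>s. snd (Z s g) + R s (fst (Z s g))) has_vector_derivative
          snd ?z + (R s\<^sub>0 (fst ?z) + R' (fst (Z s\<^sub>0 g)))) (at s\<^sub>0)"
        by (intro has_vector_derivative_add
            bounded_bilinear.has_vector_derivative[OF bounded_bilinear_blinfun_apply R(2)]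
            bounded_linear.has_vector_derivative[OF bounded_linear_snd dZ]
            bounded_linear.has_vector_derivative[OF bounded_linear_fst dZ])
      moreover have "((\<lambda>s. snd (Z s g) + R s (fst (Z s g))) has_vector_derivative 0) (at s\<^sub>0)"
        by (rule has_vector_derivative_transform_within_open[of "\<lambda>s. 0" _ _ "ball s\<^sub>0 \<delta>"])
          (use \<delta> near(2) in \<open>auto simp: \<Lambda>_apply\<close>)
      ultimately have "snd ?z + (R s\<^sub>0 (fst ?z) + R' (fst (Z s\<^sub>0 g))) = 0"
        by (rule vector_derivative_unique_at)
      then show ?thesis by (simp add: Zg add.assoc)
    qed
    ultimately show "\<exists>z\<in>adjoint_op D. B' (T s\<^sub>0 g) = T' g + T s\<^sub>0 z \<and>
      snd z + R s\<^sub>0 (fst z) + R' (fst g) = 0" unfolding E_def by blast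
  qed
qed


section \<open>The crossing form of a path of boundary value problems\<close>

lemma cinner_Pair_left: "cinner (a, b) g = cinner a (fst g) + cinner b (snd g)"
  by (simp add: cinner_prod_def)

lemma symp_omega_eq: "symp_omega f g = cinner (snd f) (fst g) - cinner (fst f) (snd g)"
  by (simp add: symp_omega_def symp_J_def split_beta cinner_prod_def cinner_minus_left)

lemma symp_Omega_eq: "symp_Omega f g = symp_omega (fst f) (fst g) - symp_omega (snd f) (snd g)"
  by (simp add: symp_Omega_def symp_omega_def cinner_Pair_left cinner_minus_left map_prod_def split_beta)

lemma symp_Omega_add_right: "symp_Omega f (g + h) = symp_Omega f g + symp_Omega f h"
  by (simp add: symp_Omega_eq symp_omega_eq cinner_add_right)

lemma bounded_bilinear_symp_omega:
  "bounded_bilinear (symp_omega :: ('k::complex_inner \<times> 'k) \<Rightarrow> 'k \<times> 'k \<Rightarrow> complex)"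
proof -
  have "bounded_linear (symp_J :: 'k \<times> 'k \<Rightarrow> 'k \<times> 'k)"
    unfolding symp_J_def split_beta
    by (intro bounded_linear_Pair bounded_linear_minus bounded_linear_fst bounded_linear_snd)
  then show ?thesis
    unfolding symp_omega_def
    by (rule bounded_bilinear.comp1[OF bounded_bilinear_cinner])
qed

lemma abs_Re_symp_Omega_le: "\<bar>Re (symp_Omega f g)\<bar> \<le> norm f * norm g"
proof -
  have "norm (map_prod symp_J (\<lambda>x. - symp_J x) f) = norm f"
    by (simp add: norm_prod_def symp_J_def map_prod_def split_beta add.commute)
  then show ?thesis
    using Cauchy_Schwarz_ineq2[of "map_prod symp_J (\<lambda>x. - symp_J x) f" g]
    by (simp add: symp_Omega_def inner_eq_Re_cinner)
qed

lemma lagrangian_isotropic: "lagrangian M \<Longrightarrow> x \<in> M \<Longrightarrow> y \<in> M \<Longrightarrow> symp_omega x y = 0"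
  unfolding lagrangian_def by blast

text \<open>This comes from differentiating \<open>\<omega>(P\<^sub>s f, P\<^sub>s f) = 0\<close>. Skew-symmetry of \<open>\<omega>\<close> alone gives it only up
  to complex conjugation.\<close>

lemma symp_omega_derivative_lagrangian:
  fixes P :: "real \<Rightarrow> ('k::complex_inner \<times> 'k) \<Rightarrow>\<^sub>L ('k \<times> 'k)"
  assumes P: "(P has_vector_derivative P') (at s\<^sub>0)" and \<epsilon>: "0 < \<epsilon>"
    and lag: "\<And>s. s \<in> ball s\<^sub>0 \<epsilon> \<Longrightarrow> lagrangian (range (blinfun_apply (P s)))"
    and f: "P s\<^sub>0 f = f"
  shows "symp_omega f (P' f) = - symp_omega (P' f) f"
proof -
  have d: "((\<lambda>s. P s f) has_vector_derivative P' f) (at s\<^sub>0)"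
    by (rule bounded_linear.has_vector_derivative[OF blinfun.bounded_linear_left P])
  have "((\<lambda>s. symp_omega (P s f) (P s f)) has_vector_derivative
      symp_omega (P s\<^sub>0 f) (P' f) + symp_omega (P' f) (P s\<^sub>0 f)) (at s\<^sub>0)"
    by (rule bounded_bilinear.has_vector_derivative[OF bounded_bilinear_symp_omega d d])
  moreover have "((\<lambda>s. symp_omega (P s f) (P s f)) has_vector_derivative 0) (at s\<^sub>0)"
  proof (rule has_vector_derivative_transform_within_open[of "\<lambda>s. 0" _ _ "ball s\<^sub>0 \<epsilon>"])
    fix s assume "s \<in> ball s\<^sub>0 \<epsilon>"
    from lagrangian_isotropic[OF lag[OF this] rangeI rangeI]
    show "0 = symp_omega (P s f) (P s f)" by (rule sym)
  qed (use \<epsilon> in auto)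
  ultimately have "symp_omega (P s\<^sub>0 f) (P' f) + symp_omega (P' f) (P s\<^sub>0 f) = 0"
    by (rule vector_derivative_unique_at)
  then show ?thesis by (simp add: f eq_neg_iff_add_eq_0)
qed

lemma cinner_derivative_self_adjoint:
  fixes R :: "real \<Rightarrow> 'h::complex_inner \<Rightarrow>\<^sub>L 'h"
  assumes R: "(R has_vector_derivative R') (at s\<^sub>0)" and \<epsilon>: "0 < \<epsilon>"
    and sa: "\<And>s. s \<in> ball s\<^sub>0 \<epsilon> \<Longrightarrow> bounded_self_adjoint (R s)"
  shows "cinner x (R' y) = cinner (R' x) y"
proof -
  have d: "((\<lambda>s. R s z) has_vector_derivative R' z) (at s\<^sub>0)" for z
    by (rule bounded_linear.has_vector_derivative[OF blinfun.bounded_linear_left R])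
  have "((\<lambda>s. cinner x (R s y)) has_vector_derivative cinner x (R' y)) (at s\<^sub>0)"
    by (rule bounded_linear.has_vector_derivative[OF bounded_linear_cinner_right d])
  moreover have "((\<lambda>s. cinner (R s x) y) has_vector_derivative cinner (R' x) y) (at s\<^sub>0)"
    by (rule bounded_linear.has_vector_derivative[OF bounded_bilinear.bounded_linear_left[OF bounded_bilinear_cinner] d])
  then have "((\<lambda>s. cinner x (R s y)) has_vector_derivative cinner (R' x) y) (at s\<^sub>0)"
    by (rule has_vector_derivative_transform_within_open[of _ _ _ "ball s\<^sub>0 \<epsilon>"])
      (use \<epsilon> sa in \<open>auto simp: bounded_self_adjoint_def\<close>)
  ultimately show ?thesis by (rule vector_derivative_unique_at)
qed

lemma blinfun_scaleC:
  "bounded_self_adjoint F \<Longrightarrow> blinfun_apply F (c *\<^sub>C x) = c *\<^sub>C blinfun_apply F x"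
  by (auto simp: bounded_self_adjoint_def Vector_Spaces.linear_iff)

lemma
  assumes "orthogonal_projection P"
  shows orthogonal_projection_idem: "P (P x) = P x"
    and range_orthogonal_projection: "range (blinfun_apply P) = {x. P x = x}"
proof -
  have "P o\<^sub>L P = P" using assms by (simp add: orthogonal_projection_def)
  from arg_cong[OF this, of "\<lambda>X. blinfun_apply X y" for y]
  show idem: "P (P x) = P x" for x by simp
  show "range (blinfun_apply P) = {x. P x = x}"
  proof (intro equalityI subsetI)
    fix x assume "x \<in> {x. P x = x}"
    then have "x = P x" by simp
    then show "x \<in> range (blinfun_apply P)" by (rule range_eqI)
  qed (auto simp: idem)
qed

text \<open>The kernel parametrization contributes \<open>\<Omega>(T g, T' g + T z)\<close> with \<open>(E + R) z = - R' g\<close>, and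
  Green's identity evaluates \<open>\<Omega>(T g, T z)\<close> to \<open>\<langle>R' g, g\<rangle>\<close>. The second component of the doubled form enters
  with a minus sign, which the Lagrangian property turns into the order of arguments of the \<open>P'\<close>, \<open>Q'\<close> term.
  On the graph of \<open>D\<^sup>*\<close>, where \<open>T s\<close> represents the trace, it is complex-linear; off the graph it is an
  arbitrary bounded real-linear extension.\<close>

lemma crossing_form_of_boundary_path:
  fixes D :: "('h::{complex_inner,complete_space}, 'h) oper"
    and R :: "real \<Rightarrow> 'h \<Rightarrow>\<^sub>L 'h"
    and T :: "real \<Rightarrow> ('h \<times> 'h) \<Rightarrow>\<^sub>L (('k::{complex_inner,complete_space} \<times> 'k) \<times> ('k \<times> 'k))"
    and P Q :: "real \<Rightarrow> ('k \<times> 'k) \<Rightarrow>\<^sub>L ('k \<times> 'k)"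
  defines "L \<equiv> \<lambda>s. {g \<in> adjoint_op D. snd g + R s (fst g) = 0}"
  assumes D: "complex_vector.subspace D" "closed D"
    and \<epsilon>: "0 < \<epsilon>"
    and \<Upsilon>: "\<And>s. s \<in> ball s\<^sub>0 \<epsilon> \<Longrightarrow>
      \<Upsilon> s = blinfun_apply (T s) ` L s \<times> (range (blinfun_apply (P s)) \<times> range (blinfun_apply (Q s)))"
    and R: "C1_on R (ball s\<^sub>0 \<epsilon>)" "(R has_vector_derivative R') (at s\<^sub>0)"
    and T: "C1_on T (ball s\<^sub>0 \<epsilon>)" "(T has_vector_derivative T') (at s\<^sub>0)"
    and P: "C1_on P (ball s\<^sub>0 \<epsilon>)" "(P has_vector_derivative P') (at s\<^sub>0)"
    and Q: "C1_on Q (ball s\<^sub>0 \<epsilon>)" "(Q has_vector_derivative Q') (at s\<^sub>0)"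
    and sa: "\<And>s. s \<in> ball s\<^sub>0 \<epsilon> \<Longrightarrow> bounded_self_adjoint (R s)"
    and T_lin: "\<And>s g c. s \<in> ball s\<^sub>0 \<epsilon> \<Longrightarrow> g \<in> adjoint_op D \<Longrightarrow> T s (c *\<^sub>C g) = c *\<^sub>C T s g"
    and proj_P: "\<And>s. s \<in> ball s\<^sub>0 \<epsilon> \<Longrightarrow> orthogonal_projection (P s)"
      "\<And>s. s \<in> ball s\<^sub>0 \<epsilon> \<Longrightarrow> lagrangian (range (blinfun_apply (P s)))"
    and proj_Q: "\<And>s. s \<in> ball s\<^sub>0 \<epsilon> \<Longrightarrow> orthogonal_projection (Q s)"
      "\<And>s. s \<in> ball s\<^sub>0 \<epsilon> \<Longrightarrow> lagrangian (range (blinfun_apply (Q s)))"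
    and surj: "\<And>h. \<exists>g\<in>adjoint_op D. snd g + R s\<^sub>0 (fst g) = h"
    and green: "\<And>g g'. g \<in> adjoint_op D \<Longrightarrow> g' \<in> adjoint_op D \<Longrightarrow>
      cinner (snd g) (fst g') - cinner (fst g) (snd g') = symp_Omega (T s\<^sub>0 g) (T s\<^sub>0 g')"
    and g: "g \<in> L s\<^sub>0" "T s\<^sub>0 g \<in> range (blinfun_apply (P s\<^sub>0)) \<times> range (blinfun_apply (Q s\<^sub>0))"
  shows "has_crossing_form diagonal_plane \<Upsilon> s\<^sub>0 (T s\<^sub>0 g, T s\<^sub>0 g) (T s\<^sub>0 g, T s\<^sub>0 g)
    (cinner (R' (fst g)) (fst g)
      + symp_Omega (map_prod (blinfun_apply P') (blinfun_apply Q') (T s\<^sub>0 g)) (T s\<^sub>0 g)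
      + symp_Omega (T s\<^sub>0 g) (T' g))"
proof -
  have s0: "s\<^sub>0 \<in> ball s\<^sub>0 \<epsilon>" using \<epsilon> by simp
  have csa: "cinner (R s\<^sub>0 x) y = cinner x (R s\<^sub>0 y)" for x y
    using sa[OF s0] by (simp add: bounded_self_adjoint_def)
  have L_eq: "{g \<in> adjoint_op D. snd g + R s (fst g) = 0} = L s" for s by (simp add: L_def)
  obtain \<delta>\<^sub>1 and B :: "real \<Rightarrow> (('k \<times> 'k) \<times> ('k \<times> 'k)) \<Rightarrow>\<^sub>L (('k \<times> 'k) \<times> ('k \<times> 'k))" and B'
    where \<delta>\<^sub>1: "0 < \<delta>\<^sub>1" "\<delta>\<^sub>1 \<le> \<epsilon>" and B: "C1_on B (ball s\<^sub>0 \<delta>\<^sub>1)" "(B has_vector_derivative B') (at s\<^sub>0)"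
    and clK: "closed (blinfun_apply (T s\<^sub>0) ` L s\<^sub>0)"
    and B_img: "\<And>s. s \<in> ball s\<^sub>0 \<delta>\<^sub>1 \<Longrightarrow>
      blinfun_apply (T s) ` L s = blinfun_apply (B s) ` blinfun_apply (T s\<^sub>0) ` L s\<^sub>0"
    and B0: "\<And>g. g \<in> L s\<^sub>0 \<Longrightarrow> B s\<^sub>0 (T s\<^sub>0 g) = T s\<^sub>0 g"
    and B'_eq: "\<And>g. g \<in> L s\<^sub>0 \<Longrightarrow> \<exists>z\<in>adjoint_op D. B' (T s\<^sub>0 g) = T' g + T s\<^sub>0 z \<and>
      snd z + R s\<^sub>0 (fst z) + R' (fst g) = 0"
  proof (rule boundary_values_path[where D = D and R = R, unfolded L_eq, OF D \<epsilon> R T sa[OF s0] surj])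
    show "inner (snd g) (fst g') - inner (fst g) (snd g') = Re (symp_Omega (T s\<^sub>0 g) (T s\<^sub>0 g'))"
      if "g \<in> adjoint_op D" "g' \<in> adjoint_op D" for g g'
      unfolding green[OF that, symmetric] by (simp add: inner_eq_Re_cinner)
    show "\<bar>Re (symp_Omega f f')\<bar> \<le> norm f * norm f'" for f f' :: "('k \<times> 'k) \<times> ('k \<times> 'k)"
      by (rule abs_Re_symp_Omega_le)
  qed (rule that)
  have proj_img: "\<exists>\<delta>>0. \<delta> \<le> \<epsilon> \<and> (\<forall>s\<in>ball s\<^sub>0 \<delta>.
      blinfun_apply (p s) ` range (blinfun_apply (p s\<^sub>0)) = range (blinfun_apply (p s)))"
    if p: "C1_on p (ball s\<^sub>0 \<epsilon>)" "\<And>s. s \<in> ball s\<^sub>0 \<epsilon> \<Longrightarrow> orthogonal_projection (p s)"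
    for p :: "real \<Rightarrow> ('k \<times> 'k) \<Rightarrow>\<^sub>L ('k \<times> 'k)"
  proof (rule range_projection_locally[OF \<epsilon> C1_on_imp_continuous_on[OF p(1)]])
    show "p s o\<^sub>L p s = p s" if "s \<in> ball s\<^sub>0 \<epsilon>" for s
      using p(2)[OF that] by (simp add: orthogonal_projection_def)
  qed blast
  obtain \<delta>\<^sub>2 where \<delta>\<^sub>2: "0 < \<delta>\<^sub>2" "\<delta>\<^sub>2 \<le> \<epsilon>" and P_img: "\<And>s. s \<in> ball s\<^sub>0 \<delta>\<^sub>2 \<Longrightarrow>
      blinfun_apply (P s) ` range (blinfun_apply (P s\<^sub>0)) = range (blinfun_apply (P s))"
    using proj_img[OF P(1) proj_P(1)] by blast
  obtain \<delta>\<^sub>3 where \<delta>\<^sub>3: "0 < \<delta>\<^sub>3" "\<delta>\<^sub>3 \<le> \<epsilon>" and Q_img: "\<And>s. s \<in> ball s\<^sub>0 \<delta>\<^sub>3 \<Longrightarrow>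
      blinfun_apply (Q s) ` range (blinfun_apply (Q s\<^sub>0)) = range (blinfun_apply (Q s))"
    using proj_img[OF Q(1) proj_Q(1)] by blast
  define \<delta> where "\<delta> = min \<delta>\<^sub>1 (min \<delta>\<^sub>2 \<delta>\<^sub>3)"
  have \<delta>: "0 < \<delta>" "ball s\<^sub>0 \<delta> \<subseteq> ball s\<^sub>0 \<epsilon>" "ball s\<^sub>0 \<delta> \<subseteq> ball s\<^sub>0 \<delta>\<^sub>1" "ball s\<^sub>0 \<delta> \<subseteq> ball s\<^sub>0 \<delta>\<^sub>2"
      "ball s\<^sub>0 \<delta> \<subseteq> ball s\<^sub>0 \<delta>\<^sub>3"
    using \<delta>\<^sub>1 \<delta>\<^sub>2 \<delta>\<^sub>3 by (auto simp: \<delta>_def)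
  have s0\<delta>: "s\<^sub>0 \<in> ball s\<^sub>0 \<delta>" using \<delta>(1) by simp
  have rP: "range (blinfun_apply (P s)) = {x. P s x = x}" and rQ: "range (blinfun_apply (Q s)) = {x. Q s x = x}"
    if "s \<in> ball s\<^sub>0 \<epsilon>" for s
    using range_orthogonal_projection proj_P(1)[OF that] proj_Q(1)[OF that] by blast+
  define W where "W s = blinfun_prod (B s) (blinfun_prod (P s) (Q s))" for s
  define W' where "W' = blinfun_prod B' (blinfun_prod P' Q')"
  have "has_crossing_form diagonal_plane \<Upsilon> s\<^sub>0 (T s\<^sub>0 g, T s\<^sub>0 g) (T s\<^sub>0 g, T s\<^sub>0 g)
      (symp_Omega2 (T s\<^sub>0 g, T s\<^sub>0 g) (W' (T s\<^sub>0 g, T s\<^sub>0 g)))"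
  proof (rule has_crossing_form_of_parametrization[of \<delta> W])
    show "0 < \<delta>" by (fact \<delta>)
    show "C1_on W (ball s\<^sub>0 \<delta>)"
      unfolding W_def using C1_on_subset[OF B(1) \<delta>(3)] C1_on_subset[OF P(1) \<delta>(2)] C1_on_subset[OF Q(1) \<delta>(2)]
      by (intro C1_on_blinfun_prod)
    show "(W has_vector_derivative W') (at s\<^sub>0)"
      unfolding W_def W'_def by (intro has_vector_derivative_blinfun_prod B P Q)
    show "complex_vector.subspace (\<Upsilon> s)" if s\<delta>: "s \<in> ball s\<^sub>0 \<delta>" for s
    proof -
      have s: "s \<in> ball s\<^sub>0 \<epsilon>" using s\<delta> \<delta> by blast
      have E: "complex_vector.subspace (adjoint_op D)" by (rule complex_subspace_adjoint_op)
      have L: "0 \<in> L s" "\<And>g h. g \<in> L s \<Longrightarrow> h \<in> L s \<Longrightarrow> g + h \<in> L s" "\<And>g c. g \<in> L s \<Longrightarrow> c *\<^sub>C g \<in> L s"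
      proof -
        show "0 \<in> L s" by (simp add: L_def complex_vector.subspace_0[OF E])
        fix g h c assume g: "g \<in> L s"
        have "c *\<^sub>C (snd g + R s (fst g)) = 0" using g by (simp add: L_def)
        then show "c *\<^sub>C g \<in> L s"
          using g complex_vector.subspace_scale[OF E, of g c]
          by (simp add: L_def scaleC_prod_def blinfun_scaleC[OF sa[OF s]] scaleC_add_right)
        assume h: "h \<in> L s"
        have "(snd g + R s (fst g)) + (snd h + R s (fst h)) = 0" using g h by (simp add: L_def)
        then show "g + h \<in> L s"
          using g h complex_vector.subspace_add[OF E, of g h]
          by (simp add: L_def blinfun.add_right add_ac)
      qed
      have "complex_vector.subspace (blinfun_apply (T s) ` L s)"
      proof (rule complex_vector.subspaceI)
        show "0 \<in> blinfun_apply (T s) ` L s" using L(1) by (metis blinfun.zero_right imageI)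
        show "x + y \<in> blinfun_apply (T s) ` L s" if "x \<in> blinfun_apply (T s) ` L s" "y \<in> blinfun_apply (T s) ` L s" for x y
          using that L(2) by (auto simp flip: blinfun.add_right)
        fix c x assume "x \<in> blinfun_apply (T s) ` L s"
        then obtain h where h: "h \<in> L s" "x = T s h" by blast
        then have "c *\<^sub>C x = T s (c *\<^sub>C h)" using T_lin[OF s] by (simp add: L_def)
        then show "c *\<^sub>C x \<in> blinfun_apply (T s) ` L s" using h L(3) by blast
      qed
      moreover have "complex_vector.subspace (range (blinfun_apply (P s)))" "complex_vector.subspace (range (blinfun_apply (Q s)))"
        using proj_P(2)[OF s] proj_Q(2)[OF s] unfolding lagrangian_def by (blast dest: conjunct1)+
      ultimately show ?thesis
        unfolding \<Upsilon>[OF s] complex_vector.subspace_def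
        by (auto simp: mem_Times_iff scaleC_prod_def)
    qed
    show "closed (\<Upsilon> s\<^sub>0)"
      unfolding \<Upsilon>[OF s0] rP[OF s0] rQ[OF s0]
      by (intro closed_Times clK closed_Collect_eq continuous_intros)
    show "\<Upsilon> s = blinfun_apply (W s) ` \<Upsilon> s\<^sub>0" if s: "s \<in> ball s\<^sub>0 \<delta>" for s
    proof -
      have s': "s \<in> ball s\<^sub>0 \<epsilon>" "s \<in> ball s\<^sub>0 \<delta>\<^sub>1" "s \<in> ball s\<^sub>0 \<delta>\<^sub>2" "s \<in> ball s\<^sub>0 \<delta>\<^sub>3" using s \<delta> by blast+
      show ?thesis
        unfolding \<Upsilon>[OF s0] \<Upsilon>[OF s'(1)] W_def blinfun_apply_prod
        by (rule map_prod_surj_on[symmetric, OF B_img[OF s'(2), symmetric]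
            map_prod_surj_on[OF P_img[OF s'(3)] Q_img[OF s'(4)]]])
    qed
    show "W s\<^sub>0 q = q" if "q \<in> \<Upsilon> s\<^sub>0" for q
      using that B0 unfolding \<Upsilon>[OF s0] rP[OF s0] rQ[OF s0] by (auto simp: W_def blinfun_apply_prod)
    show "symp_Omega2 q p = 0" if pq: "p \<in> \<Upsilon> s\<^sub>0" "q \<in> \<Upsilon> s\<^sub>0" for p q
    proof -
      obtain h k where h: "h \<in> L s\<^sub>0" "fst q = T s\<^sub>0 h" and k: "k \<in> L s\<^sub>0" "fst p = T s\<^sub>0 k"
        using pq unfolding \<Upsilon>[OF s0] by auto
      have "snd h = - R s\<^sub>0 (fst h)" "snd k = - R s\<^sub>0 (fst k)"
        using h k by (auto simp: L_def eq_neg_iff_add_eq_0)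
      then have "symp_Omega (fst q) (fst p) = 0"
        using green[of h k] h k by (simp add: L_def csa cinner_minus_left cinner_minus_right)
      moreover have "symp_Omega (snd q) (snd p) = 0"
        using pq lagrangian_isotropic[OF proj_P(2)[OF s0]] lagrangian_isotropic[OF proj_Q(2)[OF s0]]
        unfolding \<Upsilon>[OF s0] symp_Omega_eq mem_Times_iff by simp
      ultimately show ?thesis by (simp add: symp_Omega2_def)
    qed
    show "(T s\<^sub>0 g, T s\<^sub>0 g) \<in> \<Upsilon> s\<^sub>0 \<inter> diagonal_plane"
      using g by (auto simp: \<Upsilon>[OF s0] diagonal_plane_def)
    then show "(T s\<^sub>0 g, T s\<^sub>0 g) \<in> \<Upsilon> s\<^sub>0 \<inter> diagonal_plane" .
  qed
  moreover have "symp_Omega2 (T s\<^sub>0 g, T s\<^sub>0 g) (W' (T s\<^sub>0 g, T s\<^sub>0 g)) =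
      cinner (R' (fst g)) (fst g)
      + symp_Omega (map_prod (blinfun_apply P') (blinfun_apply Q') (T s\<^sub>0 g)) (T s\<^sub>0 g)
      + symp_Omega (T s\<^sub>0 g) (T' g)"
  proof -
    obtain z where z: "z \<in> adjoint_op D" "B' (T s\<^sub>0 g) = T' g + T s\<^sub>0 z"
      and z_eq: "snd z + R s\<^sub>0 (fst z) + R' (fst g) = 0"
      using B'_eq[OF g(1)] by blast
    have gE: "g \<in> adjoint_op D" and sg: "snd g = - R s\<^sub>0 (fst g)"
      using g(1) by (auto simp: L_def eq_neg_iff_add_eq_0)
    have sz: "snd z = - (R s\<^sub>0 (fst z) + R' (fst g))"
      using z_eq unfolding eq_neg_iff_add_eq_0 add.assoc .
    have "symp_Omega (T s\<^sub>0 g) (T s\<^sub>0 z) = cinner (snd g) (fst z) - cinner (fst g) (snd z)"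
      using green[OF gE z(1)] by simp
    also have "\<dots> = cinner (fst g) (R' (fst g))"
      by (simp add: sg sz cinner_minus_left cinner_minus_right cinner_add_right csa del: minus_add_distrib)
    also have "\<dots> = cinner (R' (fst g)) (fst g)"
      using R(2) \<epsilon> sa by (rule cinner_derivative_self_adjoint)
    finally have 1: "symp_Omega (T s\<^sub>0 g) (B' (T s\<^sub>0 g)) = cinner (R' (fst g)) (fst g) + symp_Omega (T s\<^sub>0 g) (T' g)"
      by (simp add: z(2) symp_Omega_add_right)
    have fix_g: "P s\<^sub>0 (fst (T s\<^sub>0 g)) = fst (T s\<^sub>0 g)" "Q s\<^sub>0 (snd (T s\<^sub>0 g)) = snd (T s\<^sub>0 g)"
      using g(2) unfolding rP[OF s0] rQ[OF s0] by (auto simp: mem_Times_iff)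
    have 2: "symp_Omega (T s\<^sub>0 g) (map_prod (blinfun_apply P') (blinfun_apply Q') (T s\<^sub>0 g)) =
        - symp_Omega (map_prod (blinfun_apply P') (blinfun_apply Q') (T s\<^sub>0 g)) (T s\<^sub>0 g)"
      using symp_omega_derivative_lagrangian[OF P(2) \<epsilon> proj_P(2) fix_g(1)]
        symp_omega_derivative_lagrangian[OF Q(2) \<epsilon> proj_Q(2) fix_g(2)]
      by (simp add: symp_Omega_eq map_prod_def split_beta)
    show ?thesis
      by (simp add: symp_Omega2_def W'_def blinfun_apply_prod 1 2)
  qed
  ultimately show ?thesis by simp
qed


section \<open>Surjectivity of the perturbed maximal operator\<close>

lemma adjoint_op_antimono: "S \<subseteq> T \<Longrightarrow> adjoint_op T \<subseteq> adjoint_op S"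
  by (auto simp: adjoint_op_def)

lemma Range_complex_subspace:
  assumes "complex_vector.subspace X" shows "complex_vector.subspace (Range X)"
proof (rule complex_vector.subspaceI)
  show "0 \<in> Range X" using complex_vector.subspace_0[OF assms] by (auto simp: zero_prod_def)
  show "x + y \<in> Range X" if "x \<in> Range X" "y \<in> Range X" for x y
    using that complex_vector.subspace_add[OF assms] by fastforce
  show "c *\<^sub>C x \<in> Range X" if "x \<in> Range X" for c x
    using that complex_vector.subspace_scale[OF assms, of _ c] by (fastforce simp: scaleC_prod_def)
qed

text \<open>The range of \<open>C + R\<close> has codimension one, and its complement is spanned by the kernel vector
  \<open>e\<close>. If the range of the extension \<open>D\<^sup>* + R\<close> did not reach beyond it, \<open>e\<close> would lie in the
  kernel of \<open>(D\<^sup>* + R)\<^sup>* = D + R\<close>, so in the domain of \<open>D\<close>.\<close>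

lemma adjoint_plus_surjective:
  fixes D C :: "('h::{complex_inner,complete_space}, 'h) oper" and R :: "'h \<Rightarrow>\<^sub>L 'h"
  defines "CR \<equiv> C +\<^sub>o graph_of (blinfun_apply R)"
  assumes D: "complex_vector.subspace D" "closed D"
    and C: "adjoint_op C = C" "D \<subseteq> C"
    and R: "bounded_self_adjoint R"
    and cl: "closed (Range CR)"
    and dim: "complex_vector.dim (op_ker CR) = 1"
    and ucp: "op_ker (adjoint_op D +\<^sub>o graph_of (blinfun_apply R)) \<inter> Domain D \<subseteq> {0}"
  shows "\<exists>g\<in>adjoint_op D. snd g + R (fst g) = h"
proof -
  have sa: "cinner (R x) y = cinner x (R y)" for x y
    using R by (simp add: bounded_self_adjoint_def)
  have C_adj: "C \<subseteq> adjoint_op D" using adjoint_op_antimono[OF C(2)] C(1) by simp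
  have adjCR: "adjoint_op CR = CR"
    unfolding CR_def by (simp add: adjoint_op_plus_graph_of sa C(1))
  have subCR: "complex_vector.subspace CR" by (metis adjCR complex_subspace_adjoint_op)
  define Y where "Y = Range CR"
  have subY: "complex_vector.subspace Y" unfolding Y_def using subCR by (rule Range_complex_subspace)
  note rsubY = complex_subspace_imp_subspace[OF subY]
  have ker: "z \<in> corthogonal Y \<longleftrightarrow> z \<in> op_ker CR" for z
  proof -
    have "z \<in> op_ker CR \<longleftrightarrow> (z, 0) \<in> adjoint_op CR" by (simp add: op_ker_def adjCR)
    also have "\<dots> \<longleftrightarrow> z \<in> corthogonal Y"
      by (auto simp: adjoint_op_def corthogonal_def Y_def cinner_zero_right)
    finally show ?thesis by blast
  qed
  obtain e where e: "e \<in> op_ker CR" "e \<noteq> 0" "op_ker CR \<subseteq> range (\<lambda>c. c *\<^sub>C e)"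
  proof -
    obtain B where B: "B \<subseteq> op_ker CR" "complex_vector.independent B" "op_ker CR \<subseteq> complex_vector.span B"
        "card B = complex_vector.dim (op_ker CR)"
      using complex_vector.basis_exists by blast
    then obtain e where "B = {e}" using dim by (metis card_1_singletonE)
    then show ?thesis
      using B complex_vector.dependent_zero that by (auto simp: complex_vector.span_singleton)
  qed
  define X where "X = Range (adjoint_op D +\<^sub>o graph_of (blinfun_apply R))"
  have X_iff: "x \<in> X \<longleftrightarrow> (\<exists>g\<in>adjoint_op D. snd g + R (fst g) = x)" for x
    by (force simp: X_def op_plus_def graph_of_def)
  have "complex_vector.subspace (adjoint_op (D +\<^sub>o graph_of (blinfun_apply R)))"
    by (rule complex_subspace_adjoint_op)
  then have subX: "complex_vector.subspace X"
    unfolding X_def by (intro Range_complex_subspace) (simp add: adjoint_op_plus_graph_of sa)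
  have YX: "Y \<subseteq> X" using C_adj unfolding Y_def X_def CR_def op_plus_def by blast
  have split: "\<exists>c. h - c *\<^sub>C e \<in> Y" for h
  proof -
    obtain p where p: "p \<in> Y" "h - p \<in> orthogonal_comp Y"
      using orthogonal_decomposition_exists[OF rsubY cl[folded Y_def]] by blast
    then have "h - p \<in> op_ker CR" using ker corthogonal_eq_orthogonal_comp[OF subY] by blast
    then obtain c where "h - p = c *\<^sub>C e" using e(3) by blast
    then have "h - c *\<^sub>C e = p" by (simp add: algebra_simps)
    then show ?thesis using p(1) by metis
  qed
  have "e \<in> X"
  proof -
    have "\<exists>x\<in>X. cinner x e \<noteq> 0"
    proof (rule ccontr)
      assume "\<not> ?thesis"
      then have perp: "cinner (y + R x) e = 0" if "(x, y) \<in> adjoint_op D" for x y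
        using that X_iff by fastforce
      have "(e, - R e) \<in> D"
      proof (rule adjoint_op_adjoint_mem[OF D])
        fix x y assume "(x, y) \<in> adjoint_op D"
        from perp[OF this] have "cinner y e = cinner x (- R e)"
          by (simp add: cinner_add_left sa cinner_minus_right eq_neg_iff_add_eq_0)
        then show "inner y e = inner x (- R e)" by (simp add: inner_eq_Re_cinner)
      qed
      then have "e \<in> Domain D" "(e, - R e) \<in> adjoint_op D" using C(2) C_adj by blast+
      then show False
        using ucp e(2) by (auto simp: op_ker_def op_plus_graph_of_iff)
    qed
    then obtain x where x: "x \<in> X" "cinner x e \<noteq> 0" by blast
    obtain c where c: "x - c *\<^sub>C e \<in> Y" using split by blast
    have "c \<noteq> 0"
    proof
      assume "c = 0"
      then have "x \<in> Y" using c by simp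
      then show False using x(2) ker e(1) by (auto simp: corthogonal_def)
    qed
    have "x - (x - c *\<^sub>C e) \<in> X" using complex_vector.subspace_diff[OF subX x(1)] c YX by blast
    then have "inverse c *\<^sub>C (c *\<^sub>C e) \<in> X" using complex_vector.subspace_scale[OF subX] by fastforce
    then show ?thesis using \<open>c \<noteq> 0\<close> by (simp add: scaleC_scaleC)
  qed
  obtain c where "h - c *\<^sub>C e \<in> Y" using split by blast
  then have "h - c *\<^sub>C e + c *\<^sub>C e \<in> X"
    using YX \<open>e \<in> X\<close> complex_vector.subspace_add[OF subX] complex_vector.subspace_scale[OF subX] by blast
  then show ?thesis by (simp add: X_iff)
qed


section \<open>The diagonal operator of a pair\<close>

text \<open>\<open>op_diag S T\<close> is the operator matrix with diagonal entries \<open>S\<close> and \<open>- T\<close>. Composing the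
  off-diagonal operators of the theorem with the swap \<open>\<tau>\<close> gives operators of this form, which are
  symmetric or self-adjoint together with \<open>S\<close> and \<open>T\<close>.\<close>

definition op_diag :: "('a, 'c) oper \<Rightarrow> ('b, 'd::uminus) oper \<Rightarrow> ('a \<times> 'b, 'c \<times> 'd) oper"
  where "op_diag S T = {((a, b), (c, d)) | a b c d. (a, c) \<in> S \<and> (b, - d) \<in> T}"

lemma op_diag_iff [simp]: "((a, b), (c, d)) \<in> op_diag S T \<longleftrightarrow> (a, c) \<in> S \<and> (b, - d) \<in> T"
  by (simp add: op_diag_def)

lemma mem_op_diag_iff:
  "p \<in> op_diag S T \<longleftrightarrow> (fst (fst p), fst (snd p)) \<in> S \<and> (snd (fst p), - snd (snd p)) \<in> T"
  by (cases p; cases "fst p"; cases "snd p") auto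

lemma mem_op_uminus_iff: "(x, y) \<in> op_uminus T \<longleftrightarrow> (x, - y) \<in> (T :: ('a, 'b::group_add) oper)"
  by (force simp: op_uminus_def)

lemma offdiag_iff: "(p, q) \<in> offdiag S T \<longleftrightarrow> (snd p, fst q) \<in> S \<and> (fst p, snd q) \<in> T"
  by (cases p; cases q) (auto simp: offdiag_def)

lemma offdiag_swap_eq_op_diag:
  fixes S :: "('b, 'c::group_add) oper"
  shows "offdiag (op_uminus S) T O graph_of prod.swap = op_diag T S"
  by (auto simp: offdiag_iff mem_op_uminus_iff graph_of_def op_diag_def relcomp_unfold)

lemma complex_subspace_op_diag:
  fixes S T :: "('a::complex_inner, 'a) oper"
  assumes "complex_vector.subspace S" "complex_vector.subspace T"
  shows "complex_vector.subspace (op_diag S T)"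
proof (rule complex_vector.subspaceI)
  show "0 \<in> op_diag S T"
    using assms[THEN complex_vector.subspace_0] by (simp add: zero_prod_def mem_op_diag_iff)
  show "p + q \<in> op_diag S T" if "p \<in> op_diag S T" "q \<in> op_diag S T" for p q
    using that complex_vector.subspace_add[OF assms(1)] complex_vector.subspace_add[OF assms(2)]
    by (fastforce simp: mem_op_diag_iff)
  show "c *\<^sub>C p \<in> op_diag S T" if "p \<in> op_diag S T" for c p
    using that complex_vector.subspace_scale[OF assms(1), of "(fst (fst p), fst (snd p))" c]
      complex_vector.subspace_scale[OF assms(2), of "(snd (fst p), - snd (snd p))" c]
    by (simp add: mem_op_diag_iff scaleC_prod_def complex_vector.scale_minus_right)
qed

lemma closed_op_diag:
  fixes S T :: "('a::complex_inner, 'a) oper"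
  assumes "closed S" "closed T"
  shows "closed (op_diag S T)"
proof -
  have "op_diag S T = (\<lambda>p. (fst (fst p), fst (snd p))) -` S \<inter> (\<lambda>p. (snd (fst p), - snd (snd p))) -` T"
    by (auto simp: mem_op_diag_iff)
  also have "closed \<dots>" by (intro closed_Int closed_vimage assms continuous_intros)
  finally show ?thesis .
qed

lemma adjoint_op_diag:
  fixes S T :: "('a::complex_inner, 'a) oper"
  assumes "(0, 0) \<in> S" "(0, 0) \<in> T"
  shows "adjoint_op (op_diag S T) = op_diag (adjoint_op S) (adjoint_op T)"
proof -
  have "((a, b), (c, d)) \<in> adjoint_op (op_diag S T) \<longleftrightarrow> (a, c) \<in> adjoint_op S \<and> (b, - d) \<in> adjoint_op T"
    (is "?l \<longleftrightarrow> ?r") for a b c d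
  proof -
    have l: "?l \<longleftrightarrow> (\<forall>x x' y y'. (x, x') \<in> S \<longrightarrow> (y, y') \<in> T \<longrightarrow>
        cinner x' a - cinner y' b = cinner x c + cinner y d)"
    proof (intro iffI allI impI)
      fix x x' y y' assume "?l" "(x, x') \<in> S" "(y, y') \<in> T"
      moreover from this have "((x, y), (x', - y')) \<in> op_diag S T" by simp
      ultimately have "cinner (x', - y') (a, b) = cinner (x, y) (c, d)"
        unfolding adjoint_op_def by blast
      then show "cinner x' a - cinner y' b = cinner x c + cinner y d"
        by (simp add: cinner_Pair_left cinner_minus_left)
    next
      assume *: "\<forall>x x' y y'. (x, x') \<in> S \<longrightarrow> (y, y') \<in> T \<longrightarrow>
        cinner x' a - cinner y' b = cinner x c + cinner y d"
      have "cinner q (a, b) = cinner p (c, d)" if "(p, q) \<in> op_diag S T" for p q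
        using *[rule_format, of "fst p" "fst q" "snd p" "- snd q"] that
        by (simp add: mem_op_diag_iff cinner_prod_def cinner_minus_left)
      then show ?l unfolding adjoint_op_def by blast
    qed
    have r: "?r \<longleftrightarrow> (\<forall>x x'. (x, x') \<in> S \<longrightarrow> cinner x' a = cinner x c) \<and>
        (\<forall>y y'. (y, y') \<in> T \<longrightarrow> - cinner y' b = cinner y d)"
      unfolding adjoint_op_def by (auto simp: cinner_minus_right minus_equation_iff[of "cinner _ b"])
    show ?thesis
      unfolding l r
    proof (intro iffI conjI allI impI)
      assume *: "\<forall>x x' y y'. (x, x') \<in> S \<longrightarrow> (y, y') \<in> T \<longrightarrow>
        cinner x' a - cinner y' b = cinner x c + cinner y d"
      show "cinner x' a = cinner x c" if "(x, x') \<in> S" for x x'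
        using *[rule_format, OF that assms(2)] by (simp add: cinner_zero_left)
      show "- cinner y' b = cinner y d" if "(y, y') \<in> T" for y y'
        using *[rule_format, OF assms(1) that] by (simp add: cinner_zero_left)
    next
      fix x x' y y'
      assume "(\<forall>x x'. (x, x') \<in> S \<longrightarrow> cinner x' a = cinner x c) \<and>
        (\<forall>y y'. (y, y') \<in> T \<longrightarrow> - cinner y' b = cinner y d)" "(x, x') \<in> S" "(y, y') \<in> T"
      then have "cinner x' a = cinner x c" "- cinner y' b = cinner y d" by blast+
      then show "cinner x' a - cinner y' b = cinner x c + cinner y d" by simp
    qed
  qed
  then show ?thesis by (auto simp: op_diag_def set_eq_iff)
qed


section \<open>Graph norms and the bounded perturbation\<close>

lemma adjoint_op_single_valued:
  fixes A :: "('a::complex_inner, 'b::complex_inner) oper"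
  assumes "densely_defined A"
  shows "single_valued (adjoint_op A)"
proof (rule single_valuedI)
  fix v w w' assume *: "(v, w) \<in> adjoint_op A" "(v, w') \<in> adjoint_op A"
  have "Domain A \<subseteq> {x. cinner x (w - w') = 0}"
  proof
    fix x assume "x \<in> Domain A"
    then obtain y where "(x, y) \<in> A" by blast
    then have "cinner y v = cinner x w" "cinner y v = cinner x w'"
      using * unfolding adjoint_op_def by blast+
    then have "cinner x (w - w') = 0"
      using cinner_add_right[of x w "- w'"] by (simp add: cinner_minus_right)
    then show "x \<in> {x. cinner x (w - w') = 0}" by simp
  qed
  moreover have "continuous_on UNIV (\<lambda>x. cinner x (w - w'))"
    by (rule linear_continuous_on[OF bounded_bilinear.bounded_linear_left[OF bounded_bilinear_cinner]])
  then have "closed {x. cinner x (w - w') = 0}"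
    by (rule closed_Collect_eq[OF _ continuous_on_const])
  ultimately have "closure (Domain A) \<subseteq> {x. cinner x (w - w') = 0}" by (rule closure_minimal)
  then have "cinner (w - w') (w - w') = 0"
    using assms unfolding densely_defined_def by blast
  then have "inner (w - w') (w - w') = 0" by (simp add: inner_eq_Re_cinner)
  then show "w = w'" by simp
qed

lemma graph_norm_eq:
  assumes "single_valued X" "(u, u') \<in> X" shows "graph_norm X u = norm (u, u')"
proof -
  have "op_apply X u = u'"
    unfolding op_apply_def using assms by (blast intro: the_equality dest: single_valuedD)
  then show ?thesis by (simp add: graph_norm_def)
qed

lemma graph_norm2_eq:
  assumes "single_valued X" "g \<in> op_diag X X"
  shows "graph_norm2 X (fst g) = norm g"
proof -
  obtain a b c d where g: "g = ((a, b), (c, d))" by (cases g, cases "fst g", cases "snd g") auto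
  then have "graph_norm X a = norm (a, c)" "graph_norm X b = norm (b, - d)"
    using assms by (auto intro: graph_norm_eq)
  then show ?thesis by (simp add: g graph_norm2_def norm_prod_def[of "(_, _)"] add_ac)
qed

lemma Domain_op_diag: "Domain (op_diag S T) = Domain S \<times> Domain (T :: ('b, 'd::group_add) oper)"
proof (intro equalityI subsetI)
  fix p assume "p \<in> Domain S \<times> Domain T"
  then obtain c d where "(fst p, c) \<in> S" "(snd p, d) \<in> T" by auto
  then have "(p, (c, - d)) \<in> op_diag S T" by (simp add: mem_op_diag_iff)
  then show "p \<in> Domain (op_diag S T)" by blast
qed (auto simp: op_diag_def)

lemma bounded_clinear_on_map_prod:
  assumes f: "bounded_clinear_on (Domain X) (graph_norm X) f"
  shows "bounded_clinear_on (Domain X \<times> Domain X) (graph_norm2 X) (map_prod f f)"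
proof -
  obtain K where K: "\<And>x. x \<in> Domain X \<Longrightarrow> norm (f x) \<le> K * graph_norm X x"
    using f unfolding bounded_clinear_on_def by blast
  have add: "f (x + y) = f x + f y" if "x \<in> Domain X" "y \<in> Domain X" for x y
    using f that unfolding bounded_clinear_on_def by blast
  have scale: "f (c *\<^sub>C x) = c *\<^sub>C f x" if "x \<in> Domain X" for c x
    using f that unfolding bounded_clinear_on_def by blast
  have "norm (f a, f b) \<le> \<bar>K\<bar> * norm (graph_norm X a, graph_norm X b)"
    if "a \<in> Domain X" "b \<in> Domain X" for a b
  proof -
    have nn: "0 \<le> graph_norm X x" for x by (simp add: graph_norm_def)
    have le: "norm (f x) \<le> \<bar>K\<bar> * graph_norm X x" if "x \<in> Domain X" for x
      using K[OF that] mult_right_mono[OF abs_ge_self[of K] nn[of x]] by linarith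
    have "norm (f a, f b) \<le> sqrt ((\<bar>K\<bar> * graph_norm X a)\<^sup>2 + (\<bar>K\<bar> * graph_norm X b)\<^sup>2)"
      unfolding norm_Pair by (intro real_sqrt_le_mono add_mono power_mono le that norm_ge_zero)
    also have "\<dots> = \<bar>K\<bar> * norm (graph_norm X a, graph_norm X b)"
      by (simp add: norm_Pair power_mult_distrib real_sqrt_mult flip: distrib_left)
    finally show ?thesis .
  qed
  then have "\<forall>x\<in>Domain X \<times> Domain X. norm (map_prod f f x) \<le> \<bar>K\<bar> * graph_norm2 X x"
    by (auto simp: graph_norm2_def)
  moreover have "map_prod f f (x + y) = map_prod f f x + map_prod f f y"
    if "x \<in> Domain X \<times> Domain X" "y \<in> Domain X \<times> Domain X" for x y
    using add that by (simp add: map_prod_def split_beta mem_Times_iff)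
  moreover have "map_prod f f (c *\<^sub>C x) = c *\<^sub>C map_prod f f x"
    if "x \<in> Domain X \<times> Domain X" for c x
    using scale that by (simp add: map_prod_def split_beta mem_Times_iff scaleC_prod_def)
  ultimately show ?thesis unfolding bounded_clinear_on_def by blast
qed

definition swap_blinfun :: "('a::real_normed_vector \<times> 'a) \<Rightarrow>\<^sub>L ('a \<times> 'a)"
  where "swap_blinfun = Blinfun prod.swap"

lemma blinfun_apply_swap [simp]: "blinfun_apply swap_blinfun = prod.swap"
proof -
  have "bounded_linear (prod.swap :: 'a \<times> 'a \<Rightarrow> 'a \<times> 'a)"
    unfolding prod.swap_def by (intro bounded_linear_Pair bounded_linear_fst bounded_linear_snd)
  then show ?thesis unfolding swap_blinfun_def by (rule bounded_linear_Blinfun_apply)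
qed

text \<open>For self-adjoint \<open>F\<close> and \<open>G\<close> one has \<open>V\<^sup>* \<tau> = \<tau> V\<close>, so this is the bounded part of
  \<open>(N\<^sup>* + V\<^sup>* - \<mu>) \<tau>\<close>; the other part \<open>N\<^sup>* \<tau>\<close> is \<open>diag(A\<^sup>*, - A\<^sup>*)\<close>.\<close>

definition swap_pert :: "(('a::complex_inner \<times> 'a) \<Rightarrow>\<^sub>L ('a \<times> 'a)) \<Rightarrow> real \<Rightarrow> ('a \<times> 'a) \<Rightarrow>\<^sub>L ('a \<times> 'a)"
  where "swap_pert V \<mu> = (swap_blinfun o\<^sub>L V) - \<mu> *\<^sub>R swap_blinfun"

lemma swap_pert_apply: "swap_pert V \<mu> x = prod.swap (V x) - \<mu> *\<^sub>R prod.swap x"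
  by (simp add: swap_pert_def blinfun.bilinear_simps)

lemma bounded_self_adjoint_swap_pert:
  assumes "bounded_self_adjoint F" "bounded_self_adjoint G"
  shows "bounded_self_adjoint (swap_pert (blinfun_offdiag (- G) F) \<mu>)"
proof -
  let ?R = "swap_pert (blinfun_offdiag (- G) F) \<mu>"
  have R: "?R p = (F (fst p) - \<mu> *\<^sub>R snd p, - G (snd p) - \<mu> *\<^sub>R fst p)" for p
    by (cases p) (simp add: swap_pert_apply blinfun_apply_offdiag blinfun.minus_left)
  have sa: "cinner (F x) y = cinner x (F y)" "cinner (G x) y = cinner x (G y)" for x y
    using assms by (simp_all add: bounded_self_adjoint_def)
  have d: "cinner (x - y) z = cinner x z - cinner y z" "cinner z (x - y) = cinner z x - cinner z y" for x y z :: 'a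
    using cinner_add_left[of x "- y" z] cinner_add_right[of z x "- y"]
    by (simp_all add: cinner_minus_left cinner_minus_right)
  have "?R (c *\<^sub>C p) = c *\<^sub>C ?R p" for c p
    by (simp add: R scaleC_prod_def blinfun_scaleC assms complex_vector.scale_right_diff_distrib scaleC_scaleR
        complex_vector.scale_minus_right)
  moreover have "cinner (?R p) q = cinner p (?R q)" for p q
    by (simp add: R cinner_prod_def d sa cinner_minus_left cinner_minus_right scaleR_scaleC
        cinner_scaleC_left cinner_scaleC_right)
  ultimately show ?thesis
    unfolding bounded_self_adjoint_def Vector_Spaces.linear_iff
    using complex_vector.vector_space_axioms by (simp add: blinfun.add_right)
qed


lemma bounded_clinear_on_scaleC_arg:
  "bounded_clinear_on S \<nu> f \<Longrightarrow> x \<in> S \<Longrightarrow> f (c *\<^sub>C x) = c *\<^sub>C f x"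
  by (simp add: bounded_clinear_on_def)

lemma op_shift_iff: "(x, y) \<in> T -\<^sub>o z \<longleftrightarrow> (x, y + z *\<^sub>C x) \<in> T"
  by (simp add: op_shift_def op_plus_graph_of_iff)

lemma mem_relcomp_graph_of: "(x, y) \<in> graph_of f O T \<longleftrightarrow> (f x, y) \<in> T"
  by (auto simp: graph_of_def relcomp_unfold)

lemma C1_on_swap_pert_V: "C1_on V I \<Longrightarrow> C1_on (\<lambda>t. swap_pert (V t) \<mu>) I"
  unfolding swap_pert_def by (intro C1_on_diff C1_on_blinfun_compose C1_on_const)

lemma has_vector_derivative_swap_pert_V:
  assumes "(V has_vector_derivative V') F"
  shows "((\<lambda>t. swap_pert (V t) \<mu>) has_vector_derivative swap_blinfun o\<^sub>L V') F"
proof -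
  have "((\<lambda>t. swap_pert (V t) \<mu>) has_vector_derivative (swap_blinfun o\<^sub>L V') - 0) F"
    unfolding swap_pert_def
    by (intro has_vector_derivative_diff has_vector_derivative_const
        bounded_linear.has_vector_derivative[OF bounded_bilinear.bounded_linear_right[OF bounded_bilinear_blinfun_compose] assms])
  then show ?thesis by simp
qed

lemma has_vector_derivative_swap_pert_mu:
  "((\<lambda>\<mu>. swap_pert V \<mu>) has_vector_derivative - swap_blinfun) F"
proof -
  have "((\<lambda>\<mu>. swap_pert V \<mu>) has_vector_derivative 0 - 1 *\<^sub>R swap_blinfun) F"
    unfolding swap_pert_def
    by (intro has_vector_derivative_diff has_vector_derivative_const
        bounded_linear.has_vector_derivative[OF bounded_linear_scaleR_left has_vector_derivative_id])
  then show ?thesis by simp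
qed

lemma C1_on_swap_pert_mu: "C1_on (\<lambda>\<mu>. swap_pert V \<mu>) I"
  by (rule C1_onI[OF has_vector_derivative_swap_pert_mu continuous_on_const])

lemma has_vector_derivative_C1_on_interior:
  assumes f: "C1_on f I" and t: "t \<in> interior I" "0 < t" "t < 1"
  shows "(f has_vector_derivative vector_derivative f (at t within {0..1})) (at t)"
proof -
  obtain f' where f': "\<And>s. s \<in> I \<Longrightarrow> (f has_vector_derivative f' s) (at s within I)"
    using f unfolding C1_on_def by blast
  have "t \<in> I" using t(1) interior_subset by blast
  from f'[OF this] have d: "(f has_vector_derivative f' t) (at t)" by (simp add: at_within_interior[OF t(1)])
  have "at t within {0..1} = at t" using t by (intro at_within_interior) simp
  then show ?thesis using vector_derivative_at[OF d] d by simp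
qed

section \<open>The crossing forms at a simple conjugate point\<close>

theorem lemma4p5:
  fixes A :: "('h::{complex_inner,polish_space}, 'h) oper"
    and \<Gamma>\<^sub>0 \<Gamma>\<^sub>1 :: "real \<Rightarrow> 'h \<Rightarrow> 'k::{complex_inner,polish_space}"
    and P Q :: "real \<Rightarrow> ('k \<times> 'k) \<Rightarrow>\<^sub>L ('k \<times> 'k)"
    and \<A> \<B> :: "real \<Rightarrow> ('h, 'h) oper"
    and F G :: "real \<Rightarrow> 'h \<Rightarrow>\<^sub>L 'h"
    and \<mu>\<^sub>0 t\<^sub>0 :: real and I :: "real set" and \<u> :: "'h \<times> 'h"
  defines "Hp \<equiv> Domain (adjoint_op A)"
    and "N \<equiv> offdiag (op_uminus A) A"
    and "\<tau> \<equiv> (prod.swap :: 'h \<times> 'h \<Rightarrow> 'h \<times> 'h)"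
    and "tr \<equiv> \<lambda>t u. (\<Gamma>\<^sub>0 t u, \<Gamma>\<^sub>1 t u)"
  defines "T \<equiv> \<lambda>t. map_prod (tr t) (tr t)"
    and "V \<equiv> \<lambda>t. blinfun_offdiag (- G t) (F t)"
    and "\<N> \<equiv> \<lambda>t. offdiag (op_uminus (\<B> t)) (\<A> t)"
  defines "NV \<equiv> \<lambda>t. \<N> t +\<^sub>o graph_of (blinfun_apply (V t))"
    and "\<L> \<equiv> \<lambda>\<mu> t. graph_of \<tau> O
            (adjoint_op N +\<^sub>o adjoint_op (graph_of (blinfun_apply (V t))) -\<^sub>o complex_of_real \<mu>)"
  defines "\<K> \<equiv> \<lambda>\<mu> t. T t ` op_ker (\<L> \<mu> t)"
  defines "\<Upsilon> \<equiv> \<lambda>\<mu> t. \<K> \<mu> t \<times> (range (blinfun_apply (P t)) \<times> range (blinfun_apply (Q t)))"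
  defines "V' \<equiv> vector_derivative V (at t\<^sub>0 within {0..1})"
    and "P' \<equiv> vector_derivative P (at t\<^sub>0 within {0..1})"
    and "Q' \<equiv> vector_derivative Q (at t\<^sub>0 within {0..1})"
    and "T' \<equiv> op_derivative (Hp \<times> Hp) (graph_norm2 (adjoint_op A)) T t\<^sub>0 {0..1}"
  defines "\<q> \<equiv> (T t\<^sub>0 \<u>, T t\<^sub>0 \<u>)"
  assumes A: "linear_operator A" "closed A" "densely_defined A" "symmetric_op A"
    and deficiency:
      "finite_cdim (op_ker (adjoint_op A -\<^sub>o (- \<i>)))"
      "finite_cdim (op_ker (adjoint_op A -\<^sub>o \<i>))"
      "complex_vector.dim (op_ker (adjoint_op A -\<^sub>o (- \<i>))) =
       complex_vector.dim (op_ker (adjoint_op A -\<^sub>o \<i>))"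
    and trace_bounded:
      "\<And>t. t \<in> {0..1} \<Longrightarrow> bounded_clinear_on Hp (graph_norm (adjoint_op A)) (tr t)"
    and trace_surj: "\<And>t. t \<in> {0..1} \<Longrightarrow> tr t ` Hp = UNIV"
    and green: "\<And>t u u' v v'. \<lbrakk>t \<in> {0..1}; (u, u') \<in> adjoint_op A; (v, v') \<in> adjoint_op A\<rbrakk> \<Longrightarrow>
      cinner u' v - cinner u v' = cinner (\<Gamma>\<^sub>1 t u) (\<Gamma>\<^sub>0 t v) - cinner (\<Gamma>\<^sub>0 t u) (\<Gamma>\<^sub>1 t v)"
    and proj_P: "\<And>t. t \<in> {0..1} \<Longrightarrow>
      orthogonal_projection (P t) \<and> lagrangian (range (blinfun_apply (P t)))"
    and proj_Q: "\<And>t. t \<in> {0..1} \<Longrightarrow>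
      orthogonal_projection (Q t) \<and> lagrangian (range (blinfun_apply (Q t)))"
    and ext_A: "\<And>t. t \<in> {0..1} \<Longrightarrow> self_adjoint_op (\<A> t) \<and> A \<subseteq> \<A> t \<and>
      tr t ` Domain (\<A> t) = range (blinfun_apply (P t))"
    and ext_B: "\<And>t. t \<in> {0..1} \<Longrightarrow> self_adjoint_op (\<B> t) \<and> A \<subseteq> \<B> t \<and>
      tr t ` Domain (\<B> t) = range (blinfun_apply (Q t))"
    and FG: "\<And>t. t \<in> {0..1} \<Longrightarrow> bounded_self_adjoint (F t) \<and> bounded_self_adjoint (G t)"
    and t\<^sub>0: "0 < t\<^sub>0" "t\<^sub>0 < 1"
    and not_ess: "complex_of_real \<mu>\<^sub>0 \<notin> ess_spectrum (NV t\<^sub>0)"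
    and simple: "complex_vector.dim (op_ker (NV t\<^sub>0 -\<^sub>o complex_of_real \<mu>\<^sub>0)) = 1"
    and I: "is_interval I" "I \<subseteq> {0..1}" "t\<^sub>0 \<in> interior I"
    and C2: "C2_on V I" "C2_on P I" "C2_on Q I"
      "op_C2_on (Hp \<times> Hp) (graph_norm2 (adjoint_op A)) T I"
    and ucp: "\<exists>\<delta>>0. \<forall>t\<in>I. \<forall>\<mu>. \<bar>\<mu> - \<mu>\<^sub>0\<bar> < \<delta> \<longrightarrow>
      op_ker (\<L> \<mu> t) \<inter> Domain (N O graph_of \<tau>) = {0}"
    and \<u>: "\<u> \<in> op_ker (NV t\<^sub>0 -\<^sub>o complex_of_real \<mu>\<^sub>0)"
  shows "has_crossing_form diagonal_plane (\<lambda>t. \<Upsilon> \<mu>\<^sub>0 t) t\<^sub>0 \<q> \<q>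
           (cinner (\<tau> (blinfun_apply V' \<u>)) \<u>
            + symp_Omega (map_prod (blinfun_apply P') (blinfun_apply Q') (T t\<^sub>0 \<u>)) (T t\<^sub>0 \<u>)
            + symp_Omega (T t\<^sub>0 \<u>) (T' \<u>))
       \<and> has_crossing_form diagonal_plane (\<lambda>\<mu>. \<Upsilon> \<mu> t\<^sub>0) \<mu>\<^sub>0 \<q> \<q> (- cinner (\<tau> \<u>) \<u>)"
proof -
  define As where "As = adjoint_op A"
  define D where "D = op_diag A A"
  define E where "E = op_diag As As"
  define \<nu> where "\<nu> = graph_norm2 As"
  define R where "R t \<mu> = swap_pert (V t) \<mu>" for t \<mu>
  have A0: "complex_vector.subspace A" "(0, 0) \<in> A"
    using A(1) complex_vector.subspace_0[of A] by (simp_all add: linear_operator_def zero_prod_def)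
  have D: "complex_vector.subspace D" "closed D"
    unfolding D_def using A0(1) A(2) by (simp_all add: complex_subspace_op_diag closed_op_diag)
  have D_adj: "adjoint_op D = E" unfolding D_def E_def As_def by (rule adjoint_op_diag[OF A0(2) A0(2)])
  have E: "subspace E" "closed E"
    using subspace_adjoint_op[OF D(1)] closed_adjoint_op[OF D(1)] by (simp_all add: D_adj)
  have sv: "single_valued As" unfolding As_def using A(3) by (rule adjoint_op_single_valued)
  have S_eq: "Hp \<times> Hp = Domain E" by (simp add: Hp_def E_def As_def Domain_op_diag)
  have norm_E: "\<nu> (fst g) = norm g" if "g \<in> E" for g
    using graph_norm2_eq[OF sv] that by (simp add: \<nu>_def E_def)
  have t0I: "t\<^sub>0 \<in> I" using I(3) interior_subset by blast
  have t01: "t\<^sub>0 \<in> {0..1}" using t\<^sub>0 by simp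
  have at01: "at t\<^sub>0 within {0..1} = at t\<^sub>0" using t\<^sub>0 by (intro at_within_interior) simp
  have atI: "at t\<^sub>0 within I = at t\<^sub>0" using I(3) by (rule at_within_interior)
  obtain \<epsilon> where \<epsilon>: "0 < \<epsilon>" "ball t\<^sub>0 \<epsilon> \<subseteq> I" using I(3) mem_interior by blast
  have ball01: "s \<in> {0..1}" if "s \<in> ball t\<^sub>0 \<epsilon>" for s using that \<epsilon>(2) I(2) by blast

  \<comment> \<open>The domain with its graph norm is isometric to the graph of \<open>E\<close>. Extending by the orthogonal
    projection onto the graph gives bounded operators on the whole Hilbert space of pairs.\<close>
  define \<iota> where "\<iota> g = fst (proj_onto E g)" for g
  define Tl where "Tl t = Blinfun (T t \<circ> \<iota>)" for t
  have \<iota>_E: "\<iota> g = fst g" if "g \<in> E" for g using proj_onto_ident[OF E that] by (simp add: \<iota>_def)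
  have \<iota>: "linear \<iota>" "\<And>g. \<iota> g \<in> Hp \<times> Hp" "\<And>g. \<nu> (\<iota> g) \<le> norm g"
  proof -
    show "linear \<iota>"
      unfolding \<iota>_def
      by (intro bounded_linear.linear bounded_linear_compose[OF bounded_linear_fst blinfun.bounded_linear_right])
    show "\<iota> g \<in> Hp \<times> Hp" for g
      using proj_onto_mem[OF E, of g] unfolding S_eq \<iota>_def by (metis Domain.DomainI prod.collapse)
    show "\<nu> (\<iota> g) \<le> norm g" for g
      using norm_E[OF proj_onto_mem[OF E, of g]] norm_proj_onto_apply[OF E, of g] by (simp add: \<iota>_def)
  qed
  have \<nu>: "0 \<le> \<nu> x" for x by (simp add: \<nu>_def graph_norm2_def)
  have T_bdd: "bounded_clinear_on (Hp \<times> Hp) \<nu> (T t)" if "t \<in> {0..1}" for t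
    unfolding T_def \<nu>_def Hp_def As_def
    by (rule bounded_clinear_on_map_prod) (use trace_bounded[OF that] in \<open>simp add: Hp_def\<close>)
  have lift_E: "Blinfun (f \<circ> \<iota>) g = f (fst g)" if "bounded_clinear_on (Hp \<times> Hp) \<nu> f" "g \<in> E"
    for f :: "'h \<times> 'h \<Rightarrow> ('k \<times> 'k) \<times> ('k \<times> 'k)" and g
    using bounded_linear_Blinfun_apply[OF bounded_linear_lift[OF \<iota> \<nu> that(1)]] \<iota>_E[OF that(2)] by simp
  have Tl_E: "Tl t g = T t (fst g)" if "t \<in> {0..1}" "g \<in> E" for t g
    unfolding Tl_def using T_bdd[OF that(1)] that(2) by (rule lift_E)
  obtain F' where F': "\<And>t. t \<in> I \<Longrightarrow> has_op_derivative (Hp \<times> Hp) \<nu> T (F' t) t I" "op_C1_on (Hp \<times> Hp) \<nu> F' I"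
    using C2(4) unfolding op_C2_on_def \<nu>_def As_def by blast
  have C1_Tl: "C1_on Tl I"
    unfolding Tl_def
    by (rule C1_onI[OF has_vector_derivative_lift[OF \<iota> \<nu> F'(1)]
          C1_on_imp_continuous_on[OF C1_on_lift[OF \<iota> \<nu> F'(2)]]])
  have "has_op_derivative (Hp \<times> Hp) \<nu> T (F' t\<^sub>0) t\<^sub>0 {0..1}"
    using F'(1)[OF t0I] T_bdd unfolding has_op_derivative_def at01 atI by blast
  then have T': "has_op_derivative (Hp \<times> Hp) \<nu> T T' t\<^sub>0 {0..1}"
    unfolding T'_def op_derivative_def \<nu>_def As_def
    by (rule someI[of "\<lambda>X. has_op_derivative (Hp \<times> Hp) (graph_norm2 (adjoint_op A)) T X t\<^sub>0 {0..1}"])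
  have T'_bdd: "bounded_clinear_on (Hp \<times> Hp) \<nu> T'" using T' by (simp add: has_op_derivative_def)
  have dTl: "(Tl has_vector_derivative Blinfun (T' \<circ> \<iota>)) (at t\<^sub>0)"
    unfolding Tl_def using has_vector_derivative_lift[OF \<iota> \<nu> T' t01] by (simp add: at01)
  have Tl_lin: "Tl t (c *\<^sub>C g) = c *\<^sub>C Tl t g" if "t \<in> {0..1}" "g \<in> E" for t c g
  proof -
    have "c *\<^sub>C g \<in> E" using complex_vector.subspace_scale[OF complex_subspace_adjoint_op] that(2) D_adj by metis
    moreover have "fst g \<in> Hp \<times> Hp" using that(2) S_eq by (metis Domain.DomainI prod.collapse)
    then have "T t (c *\<^sub>C fst g) = c *\<^sub>C T t (fst g)" by (rule bounded_clinear_on_scaleC_arg[OF T_bdd[OF that(1)]])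
    ultimately show ?thesis using Tl_E[OF that(1)] that(2) by (simp add: scaleC_prod_def)
  qed

  \<comment> \<open>After composition with \<open>\<tau>\<close> all operators of the statement become diagonal plus \<open>R\<close>.\<close>
  have R_sa: "bounded_self_adjoint (R t \<mu>)" if "t \<in> {0..1}" for t \<mu>
    unfolding R_def V_def using FG[OF that] by (intro bounded_self_adjoint_swap_pert) auto
  have N_adj: "(\<tau> x, q) \<in> adjoint_op N \<longleftrightarrow> (x, q) \<in> E" for x q
    unfolding N_def adjoint_offdiag_uminus[OF A(1)]
    by (simp add: offdiag_iff mem_op_uminus_iff mem_op_diag_iff E_def As_def \<tau>_def)
  have ker_iff: "x \<in> op_ker (\<L> \<mu> t) \<longleftrightarrow> (x, - R t \<mu> x) \<in> E" if t: "t \<in> {0..1}" for x \<mu> t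
  proof -
    have "adjoint_op (graph_of (blinfun_apply (V t))) = graph_of (blinfun_apply (blinfun_offdiag (F t) (- G t)))"
      unfolding V_def using FG[OF t] by (intro adjoint_offdiag_bounded) auto
    then have "x \<in> op_ker (\<L> \<mu> t) \<longleftrightarrow>
        (\<tau> x, complex_of_real \<mu> *\<^sub>C \<tau> x - blinfun_offdiag (F t) (- G t) (\<tau> x)) \<in> adjoint_op N"
      by (simp add: op_ker_def \<L>_def mem_relcomp_graph_of op_shift_iff op_plus_graph_of_iff)
    also have "complex_of_real \<mu> *\<^sub>C \<tau> x - blinfun_offdiag (F t) (- G t) (\<tau> x) = - R t \<mu> x"
      by (cases x) (simp add: R_def V_def swap_pert_apply blinfun_apply_offdiag \<tau>_def blinfun.minus_left
          flip: scaleR_scaleC)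
    finally show ?thesis by (simp add: N_adj)
  qed
  define C where "C = op_diag (\<A> t\<^sub>0) (\<B> t\<^sub>0)"
  define CR where "CR = C +\<^sub>o graph_of (blinfun_apply (R t\<^sub>0 \<mu>\<^sub>0))"
  have C_adj: "adjoint_op C = C"
  proof -
    have "(0, 0) \<in> \<A> t\<^sub>0" "(0, 0) \<in> \<B> t\<^sub>0" using ext_A[OF t01] ext_B[OF t01] A0(2) by blast+
    then have "adjoint_op C = op_diag (adjoint_op (\<A> t\<^sub>0)) (adjoint_op (\<B> t\<^sub>0))"
      unfolding C_def by (rule adjoint_op_diag)
    then show ?thesis using ext_A[OF t01] ext_B[OF t01] by (simp add: C_def self_adjoint_op_def)
  qed
  have DC: "D \<subseteq> C" using ext_A[OF t01] ext_B[OF t01] unfolding D_def C_def op_diag_def by blast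
  have CE: "C \<subseteq> E" using adjoint_op_antimono[OF DC] by (simp add: C_adj D_adj)
  have NV_iff: "(x, y) \<in> NV t\<^sub>0 -\<^sub>o complex_of_real \<mu>\<^sub>0 \<longleftrightarrow> (x, \<tau> y) \<in> CR" for x y
  proof -
    have "(x, y) \<in> NV t\<^sub>0 -\<^sub>o complex_of_real \<mu>\<^sub>0 \<longleftrightarrow> (x, y + \<mu>\<^sub>0 *\<^sub>R x - V t\<^sub>0 x) \<in> \<N> t\<^sub>0"
      by (simp add: NV_def op_shift_iff op_plus_graph_of_iff scaleR_scaleC)
    also have "\<dots> \<longleftrightarrow> (x, \<tau> (y + \<mu>\<^sub>0 *\<^sub>R x - V t\<^sub>0 x)) \<in> C"
      by (simp add: \<N>_def C_def \<tau>_def offdiag_iff mem_op_uminus_iff mem_op_diag_iff conj_commute)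
    also have "\<tau> (y + \<mu>\<^sub>0 *\<^sub>R x - V t\<^sub>0 x) = \<tau> y - R t\<^sub>0 \<mu>\<^sub>0 x"
      by (simp add: R_def swap_pert_apply \<tau>_def prod_eq_iff)
    finally show ?thesis by (simp add: CR_def op_plus_graph_of_iff)
  qed
  have ker_CR: "op_ker CR = op_ker (NV t\<^sub>0 -\<^sub>o complex_of_real \<mu>\<^sub>0)"
    by (simp add: op_ker_def NV_iff \<tau>_def zero_prod_def)
  have surj: "\<exists>g\<in>adjoint_op D. snd g + R t\<^sub>0 \<mu>\<^sub>0 (fst g) = h" for h
  proof (rule adjoint_plus_surjective[OF D C_adj DC R_sa[OF t01, of \<mu>\<^sub>0], folded CR_def])
    have "closed (Range (NV t\<^sub>0 -\<^sub>o complex_of_real \<mu>\<^sub>0))"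
      using not_ess by (simp add: ess_spectrum_def fredholm_def)
    moreover have "Range CR = prod.swap -` Range (NV t\<^sub>0 -\<^sub>o complex_of_real \<mu>\<^sub>0)"
      by (rule set_eqI) (simp only: vimage_eq Range_iff NV_iff \<tau>_def swap_swap)
    moreover have "continuous_on UNIV (prod.swap :: 'h \<times> 'h \<Rightarrow> 'h \<times> 'h)"
      unfolding prod.swap_def by (intro continuous_intros)
    ultimately show "closed (Range CR)" by (simp only: closed_vimage)
    show "complex_vector.dim (op_ker CR) = 1" using simple by (simp add: ker_CR)
    have "op_ker (adjoint_op D +\<^sub>o graph_of (blinfun_apply (R t\<^sub>0 \<mu>\<^sub>0))) = op_ker (\<L> \<mu>\<^sub>0 t\<^sub>0)"
      using ker_iff[OF t01] by (auto simp: op_ker_def op_plus_graph_of_iff D_adj)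
    moreover have "N O graph_of \<tau> = D" unfolding N_def \<tau>_def D_def by (rule offdiag_swap_eq_op_diag)
    moreover obtain \<delta> where "0 < \<delta>" and \<delta>: "\<forall>t\<in>I. \<forall>\<mu>. \<bar>\<mu> - \<mu>\<^sub>0\<bar> < \<delta> \<longrightarrow>
        op_ker (\<L> \<mu> t) \<inter> Domain (N O graph_of \<tau>) = {0}"
      using ucp by (elim exE conjE)
    then have "op_ker (\<L> \<mu>\<^sub>0 t\<^sub>0) \<inter> Domain (N O graph_of \<tau>) = {0}"
      using \<delta>[rule_format, OF t0I, of \<mu>\<^sub>0] by simp
    ultimately show "op_ker (adjoint_op D +\<^sub>o graph_of (blinfun_apply (R t\<^sub>0 \<mu>\<^sub>0))) \<inter> Domain D \<subseteq> {0}"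
      by (simp only: subset_refl)
  qed
  have green': "cinner (snd g) (fst g') - cinner (fst g) (snd g') = symp_Omega (Tl t\<^sub>0 g) (Tl t\<^sub>0 g')"
    if "g \<in> adjoint_op D" "g' \<in> adjoint_op D" for g g'
  proof -
    have g: "(fst (fst g), fst (snd g)) \<in> adjoint_op A" "(snd (fst g), - snd (snd g)) \<in> adjoint_op A"
      "(fst (fst g'), fst (snd g')) \<in> adjoint_op A" "(snd (fst g'), - snd (snd g')) \<in> adjoint_op A"
      using that by (simp_all add: D_adj E_def As_def mem_op_diag_iff)
    have "cinner (snd g) (fst g') - cinner (fst g) (snd g') =
        (cinner (fst (snd g)) (fst (fst g')) - cinner (fst (fst g)) (fst (snd g'))) -
        (cinner (- snd (snd g)) (snd (fst g')) - cinner (snd (fst g)) (- snd (snd g')))"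
      by (simp add: cinner_prod_def cinner_minus_left cinner_minus_right)
    also have "\<dots> = symp_Omega (T t\<^sub>0 (fst g)) (T t\<^sub>0 (fst g'))"
      unfolding green[OF t01 g(1,3)] green[OF t01 g(2,4)]
      by (simp add: symp_Omega_eq symp_omega_eq T_def tr_def map_prod_def split_beta)
    finally show ?thesis using that Tl_E[OF t01] by (simp add: D_adj)
  qed

  define g where "g = (\<u>, - R t\<^sub>0 \<mu>\<^sub>0 \<u>)"
  have "prod.swap (0 :: 'h \<times> 'h) = 0" by (simp add: zero_prod_def)
  then have gC: "g \<in> C" using \<u> by (simp add: g_def op_ker_def NV_iff CR_def op_plus_graph_of_iff \<tau>_def)
  then have gE: "g \<in> E" using CE by blast
  have gL: "g \<in> {g \<in> adjoint_op D. snd g + R t\<^sub>0 \<mu>\<^sub>0 (fst g) = 0}" using gE by (simp add: D_adj) (simp add: g_def)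
  have Tg: "Tl t\<^sub>0 g = T t\<^sub>0 \<u>" using Tl_E[OF t01 gE] by (simp add: g_def)
  have T'g: "Blinfun (T' \<circ> \<iota>) g = T' \<u>" using lift_E[OF T'_bdd gE] by (simp add: g_def)
  have gF: "Tl t\<^sub>0 g \<in> range (blinfun_apply (P t\<^sub>0)) \<times> range (blinfun_apply (Q t\<^sub>0))"
  proof -
    have "fst \<u> \<in> Domain (\<A> t\<^sub>0)" "snd \<u> \<in> Domain (\<B> t\<^sub>0)"
      using gC by (auto simp: C_def mem_op_diag_iff g_def)
    then have "tr t\<^sub>0 (fst \<u>) \<in> range (blinfun_apply (P t\<^sub>0))" "tr t\<^sub>0 (snd \<u>) \<in> range (blinfun_apply (Q t\<^sub>0))"
      using ext_A[OF t01] ext_B[OF t01] by blast+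
    then show ?thesis unfolding Tg T_def by (simp add: mem_Times_iff map_prod_def split_beta)
  qed
  have \<K>_eq: "\<K> \<mu> t = blinfun_apply (Tl t) ` {g \<in> adjoint_op D. snd g + R t \<mu> (fst g) = 0}"
    if t: "t \<in> {0..1}" for \<mu> t
  proof (intro equalityI subsetI)
    fix k assume "k \<in> \<K> \<mu> t"
    then obtain x where x: "(x, - R t \<mu> x) \<in> E" "k = T t x" using ker_iff[OF t] by (auto simp: \<K>_def)
    then show "k \<in> blinfun_apply (Tl t) ` {g \<in> adjoint_op D. snd g + R t \<mu> (fst g) = 0}"
      using Tl_E[OF t x(1)] by (intro image_eqI[of _ _ "(x, - R t \<mu> x)"]) (simp_all add: D_adj)
  next
    fix k assume "k \<in> blinfun_apply (Tl t) ` {g \<in> adjoint_op D. snd g + R t \<mu> (fst g) = 0}"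
    then obtain h where h: "h \<in> E" "snd h = - R t \<mu> (fst h)" "k = Tl t h"
      by (auto simp: D_adj eq_neg_iff_add_eq_0)
    then have "(fst h, - R t \<mu> (fst h)) \<in> E" by (metis prod.collapse)
    then have "fst h \<in> op_ker (\<L> \<mu> t)" using ker_iff[OF t] by blast
    then show "k \<in> \<K> \<mu> t" using h Tl_E[OF t h(1)] by (auto simp: \<K>_def)
  qed
  have C1: "C1_on V I" "C1_on P I" "C1_on Q I" using C2(1-3) by (simp_all add: C2_on_imp_C1_on)
  have dV: "(V has_vector_derivative V') (at t\<^sub>0)" and dP: "(P has_vector_derivative P') (at t\<^sub>0)"
    and dQ: "(Q has_vector_derivative Q') (at t\<^sub>0)"
    unfolding V'_def P'_def Q'_def using C1 I(3) t\<^sub>0 by (simp_all add: has_vector_derivative_C1_on_interior)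

  have "has_crossing_form diagonal_plane (\<lambda>t. \<Upsilon> \<mu>\<^sub>0 t) t\<^sub>0 (Tl t\<^sub>0 g, Tl t\<^sub>0 g) (Tl t\<^sub>0 g, Tl t\<^sub>0 g)
    (cinner ((swap_blinfun o\<^sub>L V') (fst g)) (fst g)
      + symp_Omega (map_prod (blinfun_apply P') (blinfun_apply Q') (Tl t\<^sub>0 g)) (Tl t\<^sub>0 g)
      + symp_Omega (Tl t\<^sub>0 g) (Blinfun (T' \<circ> \<iota>) g))"
  proof (rule crossing_form_of_boundary_path[where R = "\<lambda>t. R t \<mu>\<^sub>0", OF D \<epsilon>(1) _ _ _ _ dTl _ dP _ dQ _ _ _ _ _ _ surj green' gL gF])
    show "\<Upsilon> \<mu>\<^sub>0 s = blinfun_apply (Tl s) ` {g \<in> adjoint_op D. snd g + R s \<mu>\<^sub>0 (fst g) = 0} \<times>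
        (range (blinfun_apply (P s)) \<times> range (blinfun_apply (Q s)))" if "s \<in> ball t\<^sub>0 \<epsilon>" for s
      by (simp add: \<Upsilon>_def \<K>_eq[OF ball01[OF that]])
    show "C1_on (\<lambda>t. R t \<mu>\<^sub>0) (ball t\<^sub>0 \<epsilon>)"
      unfolding R_def by (rule C1_on_swap_pert_V[OF C1_on_subset[OF C1(1) \<epsilon>(2)]])
    show "((\<lambda>t. R t \<mu>\<^sub>0) has_vector_derivative swap_blinfun o\<^sub>L V') (at t\<^sub>0)"
      unfolding R_def by (rule has_vector_derivative_swap_pert_V[OF dV])
    show "C1_on Tl (ball t\<^sub>0 \<epsilon>)" "C1_on P (ball t\<^sub>0 \<epsilon>)" "C1_on Q (ball t\<^sub>0 \<epsilon>)"
      using C1_Tl C1(2,3) \<epsilon>(2) by (auto intro: C1_on_subset)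
    fix s assume "s \<in> ball t\<^sub>0 \<epsilon>"
    then have s: "s \<in> {0..1}" by (rule ball01)
    show "bounded_self_adjoint (R s \<mu>\<^sub>0)" by (rule R_sa[OF s])
    show "Tl s (c *\<^sub>C h) = c *\<^sub>C Tl s h" if "h \<in> adjoint_op D" for c h
      using Tl_lin[OF s] that by (simp add: D_adj)
    show "orthogonal_projection (P s)" "lagrangian (range (blinfun_apply (P s)))"
      "orthogonal_projection (Q s)" "lagrangian (range (blinfun_apply (Q s)))"
      using proj_P[OF s] proj_Q[OF s] by blast+
  qed
  \<comment> \<open>For the path in \<open>\<mu>\<close> the traces and projections are constant; the radius 1 is arbitrary.\<close>
  moreover have "has_crossing_form diagonal_plane (\<lambda>\<mu>. \<Upsilon> \<mu> t\<^sub>0) \<mu>\<^sub>0 (Tl t\<^sub>0 g, Tl t\<^sub>0 g) (Tl t\<^sub>0 g, Tl t\<^sub>0 g)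
    (cinner ((- swap_blinfun) (fst g)) (fst g)
      + symp_Omega (map_prod (blinfun_apply 0) (blinfun_apply 0) (Tl t\<^sub>0 g)) (Tl t\<^sub>0 g)
      + symp_Omega (Tl t\<^sub>0 g) (blinfun_apply 0 g))"
  proof (rule crossing_form_of_boundary_path[where R = "\<lambda>\<mu>. R t\<^sub>0 \<mu>" and T = "\<lambda>\<mu>. Tl t\<^sub>0"
        and P = "\<lambda>\<mu>. P t\<^sub>0" and Q = "\<lambda>\<mu>. Q t\<^sub>0", OF D zero_less_one _ _ _ C1_on_const has_vector_derivative_const
        C1_on_const has_vector_derivative_const C1_on_const has_vector_derivative_const _ _ _ _ _ _ surj green' gL gF])
    show "\<Upsilon> \<mu> t\<^sub>0 = blinfun_apply (Tl t\<^sub>0) ` {g \<in> adjoint_op D. snd g + R t\<^sub>0 \<mu> (fst g) = 0} \<times>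
        (range (blinfun_apply (P t\<^sub>0)) \<times> range (blinfun_apply (Q t\<^sub>0)))" for \<mu>
      by (simp add: \<Upsilon>_def \<K>_eq[OF t01])
    show "C1_on (R t\<^sub>0) (ball \<mu>\<^sub>0 1)" unfolding R_def by (rule C1_on_swap_pert_mu)
    show "(R t\<^sub>0 has_vector_derivative - swap_blinfun) (at \<mu>\<^sub>0)"
      unfolding R_def by (rule has_vector_derivative_swap_pert_mu)
    show "bounded_self_adjoint (R t\<^sub>0 \<mu>)" for \<mu> by (rule R_sa[OF t01])
    show "Tl t\<^sub>0 (c *\<^sub>C h) = c *\<^sub>C Tl t\<^sub>0 h" if "h \<in> adjoint_op D" for c h
      using Tl_lin[OF t01] that by (simp add: D_adj)
    show "orthogonal_projection (P t\<^sub>0)" "lagrangian (range (blinfun_apply (P t\<^sub>0)))"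
      "orthogonal_projection (Q t\<^sub>0)" "lagrangian (range (blinfun_apply (Q t\<^sub>0)))"
      using proj_P[OF t01] proj_Q[OF t01] by blast+
  qed
  moreover have "map_prod (blinfun_apply 0) (blinfun_apply 0) x = (0 :: ('k \<times> 'k) \<times> ('k \<times> 'k))"
    for x :: "('k \<times> 'k) \<times> ('k \<times> 'k)"
    by (cases x) (simp add: zero_prod_def)
  moreover have "symp_Omega 0 x = 0" "symp_Omega x 0 = 0" for x :: "('k \<times> 'k) \<times> ('k \<times> 'k)"
    by (simp_all add: symp_Omega_eq symp_omega_eq cinner_zero_left cinner_zero_right)
  moreover have "fst g = \<u>" by (simp add: g_def)
  ultimately show ?thesis
    by (simp add: Tg T'g \<q>_def \<tau>_def blinfun.minus_left cinner_minus_left)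
qed

end
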